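(* Let $a,b\in\mathbb{R}$, let $Q(x,y,z) = 1 - e_1 + a\,e_2 + b\,e_3$, let $F = 1/Q = \sum_{\mathbf r\in\mathbb{Z}_{\ge 0}^3} a_{\mathbf r}\,x^{r_1}y^{r_2}z^{r_3}$ be its power series expansion at the origin, and let $\delta_n = a_{n,n,n}$ be the diagonal coefficients of $F$. Define $$ B(a) = \begin{cases} -9a & a \le -3,\\ 2-3a+2(1-a)^{3/2} & -3\le a\le 1,\\ -a^3 & a\ge 1.\end{cases}$$ If $b < B(a)$, then $\delta_n$ is eventually positive (i.e. $\delta_n>0$ for all but finitely many $n$). If $b > B(a)$, then $\delta_n>0$ for infinitely many $n$ and $\delta_n<0$ for infinitely many $n$.
   Context: $e_1=x+y+z$, $e_2=xy+xz+yz$, $e_3=xyz$ are the elementary symmetric polynomials in three variables. *)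

theory Defs
  imports Complex_Main "HOL-Computational_Algebra.Formal_Power_Series"
begin

(* Formal power series in x, y, z over the reals, as iterated univariate power series:
   ((R[[x]])[[y]])[[z]]. *)
type_synonym fps3 = "real fps fps fps"

definition const3 :: "real \<Rightarrow> fps3"
  where "const3 c = fps_const (fps_const (fps_const c))"

definition X3 :: fps3 where "X3 = fps_const (fps_const fps_X)"
definition Y3 :: fps3 where "Y3 = fps_const fps_X"
definition Z3 :: fps3 where "Z3 = fps_X"

definition coeff3 :: "fps3 \<Rightarrow> nat \<Rightarrow> nat \<Rightarrow> nat \<Rightarrow> real"
  where "coeff3 F i j k = fps_nth (fps_nth (fps_nth F k) j) i"

lemma coeff3_monomial:
  "coeff3 (const3 c * X3 ^ i * Y3 ^ j * Z3 ^ k) p q r = (if p = i \<and> q = j \<and> r = k then c else 0)"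
proof -
  have "const3 c * X3 ^ i * Y3 ^ j * Z3 ^ k
      = fps_const (fps_const (fps_const c * fps_X ^ i) * fps_X ^ j) * fps_X ^ k"
    by (simp add: const3_def X3_def Y3_def Z3_def fps_const_power
        del: fps_const_mult flip: fps_const_mult)
  then show ?thesis
    by (auto simp add: coeff3_def fps_X_power_nth fps_X_power_mult_right_nth)
qed

definition e1 :: "'a::comm_ring_1 \<Rightarrow> 'a \<Rightarrow> 'a \<Rightarrow> 'a"
  where "e1 x y z = x + y + z"
definition e2 :: "'a::comm_ring_1 \<Rightarrow> 'a \<Rightarrow> 'a \<Rightarrow> 'a"
  where "e2 x y z = x * y + x * z + y * z"
definition e3 :: "'a::comm_ring_1 \<Rightarrow> 'a \<Rightarrow> 'a \<Rightarrow> 'a"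
  where "e3 x y z = x * y * z"

definition Q :: "real \<Rightarrow> real \<Rightarrow> fps3"
  where "Q a b = 1 - e1 X3 Y3 Z3 + const3 a * e2 X3 Y3 Z3 + const3 b * e3 X3 Y3 Z3"

definition F :: "real \<Rightarrow> real \<Rightarrow> fps3"
  where "F a b = inverse (Q a b)"

definition \<delta> :: "real \<Rightarrow> real \<Rightarrow> nat \<Rightarrow> real"
  where "\<delta> a b n = coeff3 (F a b) n n n"

(* The library's inverse on power series over a ring (rather than a field) yields a true inverse
   only if the constant term is inverted correctly. This is the case here, at every level. *)
lemma Q_times_F: "Q a b * F a b = 1"
proof -
  include fps_syntax
  let ?q1 = "1 - fps_X :: real fps"
  have q1: "?q1 * inverse ?q1 = 1"
    by (simp add: inverse_mult_eq_1')
  have nth0: "Q a b $ 0 = 1 - fps_const fps_X - fps_X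
      + fps_const (fps_const a) * (fps_const fps_X * fps_X)"
    by (simp add: Q_def e1_def e2_def e3_def const3_def X3_def Y3_def Z3_def)
  have nth00: "Q a b $ 0 $ 0 = ?q1"
    by (simp add: nth0)
  have q2: "Q a b $ 0 * inverse (Q a b $ 0) = 1"
    using fps_right_inverse[of "Q a b $ 0" "inverse ?q1"] q1
    by (simp add: fps_inverse_def nth00)
  show ?thesis
    using fps_right_inverse[of "Q a b" "inverse (Q a b $ 0)"] q2
    by (simp add: F_def fps_inverse_def)
qed

definition B :: "real \<Rightarrow> real"
  where "B a =
    (if a \<le> - 3 then - 9 * a
     else if a \<le> 1 then 2 - 3 * a + 2 * (1 - a) powr (3 / 2)
     else - (a ^ 3))"

lemma B_cases:
  "a \<le> - 3 \<Longrightarrow> B a = - 9 * a"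
  "- 3 \<le> a \<Longrightarrow> a \<le> 1 \<Longrightarrow> B a = 2 - 3 * a + 2 * (1 - a) powr (3 / 2)"
  "1 \<le> a \<Longrightarrow> B a = - (a ^ 3)"
proof -
  have "(4::real) powr (3 / 2) = (2 powr 2) powr (3 / 2)" by simp
  also have "\<dots> = 2 powr 3" unfolding powr_powr by simp
  finally have "(4::real) powr (3 / 2) = 8" by simp
  then show "- 3 \<le> a \<Longrightarrow> a \<le> 1 \<Longrightarrow> B a = 2 - 3 * a + 2 * (1 - a) powr (3 / 2)"
    by (cases "a = - 3") (simp_all add: B_def)
  show "a \<le> - 3 \<Longrightarrow> B a = - 9 * a" by (simp add: B_def)
  show "1 \<le> a \<Longrightarrow> B a = - (a ^ 3)" by (cases "a = 1") (simp_all add: B_def)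
qed

end

theory Submission
  imports Defs "HOL-Complex_Analysis.Complex_Analysis" "HOL-Real_Asymp.Real_Asymp"
begin

text \<open>
  Write $Q = H(x,y) - z\,G(x,y)$, so that the coefficient of $z^n$ in $F$ is $G^n/H^{n+1}$.
  By Cauchy's formula on a torus $x = x_0 X$, $y = x_0 Y$ with $|X| = |Y| = 1$, the number
  $\delta_n x_0^{3n}$ is the mean of $W^n/H$, where $W = x_0 G/(H X Y)$; hence
  $\sum_n \delta_n x_0^{3n} \tau^n$ is the mean of $1/Q(x,y,\tau z)$, where $xyz = x_0^3$.
  In half angles, $|H|^2 - |x_0|^2 |G|^2$ is an explicit form whose coefficients decide whether
  $|W| \le 1$ on the torus through the roots of least modulus of $Q(x,x,x)$.

  If one real root $x_0$ is strictly closest to the origin, then $|W| < 1$ except at $X = Y = 1$,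
  and Laplace's method shows that $\delta_n x_0^{3n}$ is eventually positive. This covers
  $b < B(a)$ (there $x_0 > 0$) and part of $b > B(a)$ (there $x_0 < 0$, so signs alternate).
  In the rest of $b > B(a)$ the roots of least modulus $\rho$ are a complex pair, possibly
  together with $-\rho$. If $\delta_n$ had constant sign for large $n$, then
  $\sum_n \delta_n (\rho\zeta)^{3n} \tau^n$ with $|\zeta| = 1$ would be bounded for $\tau < 1$, since
  it is bounded for $\zeta = 1$, where $Q$ has no zero on the torus. But for a suitable root
  $\rho\zeta$ the mean of $1/Q$ diverges as $\tau \rightarrow 1$.
\<close>

section \<open>Columns of the power series along lines through the origin\<close>

text \<open>The relevant critical points lie on x = y = z. In the variable 1/x they are the roots of
  t^3 - 3 t^2 + 3 a t + b. Its roots \<alpha>, \<beta>, \<gamma> satisfy 3 (\<alpha> - a) =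
  \<alpha>^2 - \<beta> \<gamma>, 3 (\<alpha>^2 - 2 \<alpha> + a) = (\<alpha> - \<beta>)(\<alpha> -
  \<gamma>) and \<alpha>^2 + 3 a = (\<alpha> + \<beta>)(\<alpha> + \<gamma>). These signs tell which
  root is largest in modulus. On b = \<open>B a\<close> the largest positive root loses this rank:
  its negative is also a root for a \<le> -3 (at sqrt (-3 a)), it becomes a double root for -3 \<le>
  a \<le> 1 (at 1 + sqrt (1 - a)), and the other two roots reach the same modulus for a \<ge> 1 (at
  a). For a conjugate pair the two contributions interfere. So no asymptotic formula is sought
  there, only boundedness of the generating function in one direction against divergence in another.
  Divergence of an integral must in turn exclude cancellation: a constant multiple of 1/Q is shown
  to have real part bounded below.\<close>

definition Hf :: "real \<Rightarrow> real fps fps" where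
  "Hf a = 1 - fps_const fps_X - fps_X + fps_const (fps_const a) * (fps_const fps_X * fps_X)"

definition Gf :: "real \<Rightarrow> real \<Rightarrow> real fps fps" where
  "Gf a b = 1 - fps_const (fps_const a) * (fps_const fps_X + fps_X)
            - fps_const (fps_const b) * (fps_const fps_X * fps_X)"

lemma Q_eq_H_G: "Q a b = fps_const (Hf a) - fps_const (Gf a b) * fps_X"
proof -
  have "fps_const (Hf a) = 1 - X3 - Y3 + const3 a * (X3 * Y3)"
    by (simp add: Hf_def const3_def X3_def Y3_def flip: fps_const_add fps_const_sub fps_const_mult)
  moreover have "fps_const (Gf a b) = 1 - const3 a * (X3 + Y3) - const3 b * (X3 * Y3)"
    by (simp add: Gf_def const3_def X3_def Y3_def flip: fps_const_add fps_const_sub fps_const_mult)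
  moreover have "fps_X = Z3" by (simp add: Z3_def)
  ultimately show ?thesis
    unfolding Q_def e1_def e2_def e3_def by (simp only: ring_distribs) (simp add: algebra_simps)
qed

lemma F_column_0: "Hf a * fps_nth (F a b) 0 = 1"
  using Q_times_F[of a b, THEN arg_cong[where f = "\<lambda>f. fps_nth f 0"]]
  by (simp add: Q_eq_H_G)

lemma F_column_Suc: "Hf a * fps_nth (F a b) (Suc n) = Gf a b * fps_nth (F a b) n"
proof -
  have "fps_nth (Q a b * F a b) (Suc n)
      = Hf a * fps_nth (F a b) (Suc n) - Gf a b * fps_nth (F a b) n"
    by (simp add: Q_eq_H_G left_diff_distrib mult.assoc)
  then show ?thesis by (simp add: Q_times_F)
qed

text \<open>Cleared of denominators, since iterated power series form no field. The division is made
  only after restriction to a ray, where the divisor is a complex series with constant term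
  1.\<close>

lemma F_column: "Hf a ^ Suc n * fps_nth (F a b) n = Gf a b ^ n"
proof (induction n)
  case 0
  then show ?case using F_column_0 by simp
next
  case (Suc n)
  have "Hf a ^ Suc (Suc n) * fps_nth (F a b) (Suc n)
      = Hf a ^ Suc n * (Hf a * fps_nth (F a b) (Suc n))"
    by (simp add: mult_ac)
  also have "\<dots> = Gf a b * (Hf a ^ Suc n * fps_nth (F a b) n)"
    by (simp only: F_column_Suc mult_ac)
  finally show ?case unfolding Suc.IH by simp
qed

(* C(x, y) restricted to the line (x, y) = (X u, Y u), as a power series in u *)
definition ray :: "complex \<Rightarrow> complex \<Rightarrow> real fps fps \<Rightarrow> complex fps" where
  "ray X Y C = Abs_fps (\<lambda>m. \<Sum>j\<le>m. of_real (fps_nth (fps_nth C j) (m - j)) * X ^ (m - j) * Y ^ j)"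

lemma ray_nth: "fps_nth (ray X Y C) m
    = (\<Sum>j\<le>m. of_real (fps_nth (fps_nth C j) (m - j)) * X ^ (m - j) * Y ^ j)"
  by (simp add: ray_def)

lemma ray_add: "ray X Y (C + D) = ray X Y C + ray X Y D"
  by (intro fps_ext) (simp add: ray_nth ring_distribs sum.distrib)

lemma ray_diff: "ray X Y (C - D) = ray X Y C - ray X Y D"
  by (intro fps_ext) (simp add: ray_nth ring_distribs sum_subtractf)

lemma ray_const_mult: "ray X Y (fps_const (fps_const c) * C) = fps_const (of_real c) * ray X Y C"
  by (intro fps_ext) (simp add: ray_nth sum_distrib_left mult.assoc)

lemma ray_1: "ray X Y 1 = 1"
proof (intro fps_ext)
  fix m
  have "fps_nth (ray X Y 1) m = (\<Sum>j\<le>m. if j = 0 \<and> m = 0 then 1 else 0)"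
    unfolding ray_nth by (intro sum.cong) auto
  then show "fps_nth (ray X Y 1) m = fps_nth 1 m" by (cases m) auto
qed

lemma ray_X_mult: "ray X Y (fps_const fps_X * C) = fps_const X * fps_X * ray X Y C"
proof (intro fps_ext)
  fix m
  show "fps_nth (ray X Y (fps_const fps_X * C)) m = fps_nth (fps_const X * fps_X * ray X Y C) m"
  proof (cases m)
    case (Suc k)
    have "fps_nth (ray X Y (fps_const fps_X * C)) m
        = (\<Sum>j\<le>k. of_real (fps_nth (fps_nth C j) (k - j)) * X ^ Suc (k - j) * Y ^ j)"
      unfolding ray_nth Suc by (simp add: Suc_diff_le)
    also have "\<dots> = X * fps_nth (ray X Y C) k"
      by (simp add: ray_nth sum_distrib_left mult_ac)
    finally show ?thesis by (simp add: Suc mult.assoc)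
  qed (simp add: ray_nth mult.assoc)
qed

lemma ray_Y_mult: "ray X Y (fps_X * C) = fps_const Y * fps_X * ray X Y C"
proof (intro fps_ext)
  fix m
  show "fps_nth (ray X Y (fps_X * C)) m = fps_nth (fps_const Y * fps_X * ray X Y C) m"
  proof (cases m)
    case (Suc k)
    have "fps_nth (ray X Y (fps_X * C)) m
        = (\<Sum>j\<le>k. of_real (fps_nth (fps_nth C j) (k - j)) * X ^ (k - j) * Y ^ Suc j)"
      unfolding ray_nth Suc by (subst sum.atMost_Suc_shift) simp
    also have "\<dots> = Y * fps_nth (ray X Y C) k"
      by (simp add: ray_nth sum_distrib_left mult_ac)
    finally show ?thesis by (simp add: Suc mult.assoc)
  qed (simp add: ray_nth mult.assoc)
qed

definition hr :: "real \<Rightarrow> complex \<Rightarrow> complex \<Rightarrow> complex fps" where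
  "hr a X Y = 1 - fps_const X * fps_X - fps_const Y * fps_X
     + fps_const (of_real a) * (fps_const X * fps_X * (fps_const Y * fps_X))"

definition gr :: "real \<Rightarrow> real \<Rightarrow> complex \<Rightarrow> complex \<Rightarrow> complex fps" where
  "gr a b X Y = 1 - fps_const (of_real a) * (fps_const X * fps_X + fps_const Y * fps_X)
     - fps_const (of_real b) * (fps_const X * fps_X * (fps_const Y * fps_X))"

lemma ray_H: "ray X Y (Hf a * C) = hr a X Y * ray X Y C"
proof -
  have "Hf a * C = C - fps_const fps_X * C - fps_X * C
      + fps_const (fps_const a) * (fps_const fps_X * (fps_X * C))"
    by (simp only: Hf_def ring_distribs mult_1_left mult.assoc)
  then show ?thesis
    by (simp only: hr_def ray_add ray_diff ray_const_mult ray_X_mult ray_Y_mult)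
      (simp only: ring_distribs mult_1_left mult.assoc)
qed

lemma ray_G: "ray X Y (Gf a b * C) = gr a b X Y * ray X Y C"
proof -
  have "Gf a b * C = C - fps_const (fps_const a) * (fps_const fps_X * C + fps_X * C)
      - fps_const (fps_const b) * (fps_const fps_X * (fps_X * C))"
    by (simp only: Gf_def ring_distribs mult_1_left mult.assoc)
  then show ?thesis
    by (simp only: gr_def ray_add ray_diff ray_const_mult ray_X_mult ray_Y_mult)
      (simp only: ring_distribs mult_1_left mult.assoc)
qed

lemma ray_F: "hr a X Y ^ Suc n * ray X Y (fps_nth (F a b) n) = gr a b X Y ^ n"
proof -
  have H: "ray X Y (Hf a ^ k * C) = hr a X Y ^ k * ray X Y C" for k C
    by (induction k) (simp_all add: ray_H mult.assoc)
  have G: "ray X Y (Gf a b ^ k) = gr a b X Y ^ k" for k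
    by (induction k) (simp_all add: ray_1 ray_G)
  from F_column[of a n b] show ?thesis by (metis H G)
qed

definition Hc :: "real \<Rightarrow> complex \<Rightarrow> complex \<Rightarrow> complex" where
  "Hc a x y = 1 - x - y + of_real a * x * y"

definition Gc :: "real \<Rightarrow> real \<Rightarrow> complex \<Rightarrow> complex \<Rightarrow> complex" where
  "Gc a b x y = 1 - of_real a * (x + y) - of_real b * x * y"

lemma hr_0: "fps_nth (hr a X Y) 0 = 1"
  by (simp add: hr_def mult.assoc)

text \<open>The step from formal series to functions: on a ray the divisor has a formal inverse, so
  \<open>ray_F\<close> determines the series, and the rational function of one complex variable
  becomes accessible to Cauchy's estimate.\<close>

lemma ray_F_expansion:
  "(\<lambda>u. Gc a b (u * X) (u * Y) ^ n / Hc a (u * X) (u * Y) ^ Suc n)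
     has_fps_expansion ray X Y (fps_nth (F a b) n)"
proof -
  have G: "(\<lambda>u. Gc a b (u * X) (u * Y)) has_fps_expansion gr a b X Y"
  proof -
    have "(\<lambda>u. 1 - of_real a * (X * u + Y * u) - of_real b * (X * u * (Y * u))) has_fps_expansion gr a b X Y"
      unfolding gr_def by (intro fps_expansion_intros)
    then show ?thesis by (simp add: Gc_def mult_ac)
  qed
  have H: "(\<lambda>u. Hc a (u * X) (u * Y)) has_fps_expansion hr a X Y"
  proof -
    have "(\<lambda>u. 1 - X * u - Y * u + of_real a * (X * u * (Y * u))) has_fps_expansion hr a X Y"
      unfolding hr_def by (intro fps_expansion_intros)
    then show ?thesis by (simp add: Hc_def mult_ac)
  qed
  have nz: "fps_nth (hr a X Y ^ Suc n) 0 \<noteq> 0" by (simp add: hr_0 fps_power_zeroth)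
  have "(\<lambda>u. Gc a b (u * X) (u * Y) ^ n * inverse (Hc a (u * X) (u * Y) ^ Suc n))
     has_fps_expansion gr a b X Y ^ n * inverse (hr a X Y ^ Suc n)"
    by (intro fps_expansion_intros G H nz)
  also have "gr a b X Y ^ n * inverse (hr a X Y ^ Suc n) = ray X Y (fps_nth (F a b) n)"
  proof -
    have "gr a b X Y ^ n * inverse (hr a X Y ^ Suc n)
        = (hr a X Y ^ Suc n * inverse (hr a X Y ^ Suc n)) * ray X Y (fps_nth (F a b) n)"
      unfolding ray_F[symmetric] by (simp only: mult_ac)
    also have "hr a X Y ^ Suc n * inverse (hr a X Y ^ Suc n) = 1"
      using nz by (rule inverse_mult_eq_1')
    finally show ?thesis by simp
  qed
  finally show ?thesis by (simp add: divide_inverse)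
qed

section \<open>Torus integrals for the diagonal coefficients\<close>

definition torus :: "(real \<times> real) set" where "torus = cbox (-pi, -pi) (pi, pi)"

lemma torus_iff: "p \<in> torus \<longleftrightarrow> \<bar>fst p\<bar> \<le> pi \<and> \<bar>snd p\<bar> \<le> pi"
  by (cases p) (auto simp: torus_def abs_le_iff)

lemma compact_torus: "compact torus"
  by (simp add: torus_def compact_cbox)

lemma integral_cis:
  "integral {-pi..pi} (\<lambda>t. cis (of_int k * t)) = (if k = 0 then of_real (2 * pi) else 0)"
proof (cases "k = 0")
  case False
  have "((\<lambda>t. cis (of_int k * t)) has_integral
      (cis (of_int k * pi) / (\<i> * of_int k) - cis (of_int k * (-pi)) / (\<i> * of_int k))) {-pi..pi}"
  proof (rule fundamental_theorem_of_calculus)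
    fix t :: real
    show "((\<lambda>t. cis (of_int k * t) / (\<i> * of_int k)) has_vector_derivative cis (of_int k * t))
        (at t within {-pi..pi})"
      unfolding cis_conv_exp using False
      by (auto intro!: derivative_eq_intros has_vector_derivative_real_field simp: field_simps)
  qed auto
  moreover have "cis (of_int k * (-pi)) = cis (of_int k * pi)"
    by (simp add: complex_eq_iff) (use sin_zero_iff_int2 in blast)
  ultimately show ?thesis using False by (simp add: integral_unique)
qed (simp add: scaleR_conv_of_real)

lemma torus_orthogonality:
  "integral torus (\<lambda>p. cis (of_int k * fst p) * cis (of_int l * snd p))
    = (if k = 0 \<and> l = 0 then of_real (4 * pi\<^sup>2) else 0)"
proof -
  have "integral torus (\<lambda>p. cis (of_int k * fst p) * cis (of_int l * snd p))
     = integral (cbox (-pi) pi) (\<lambda>x. integral (cbox (-pi) pi) (\<lambda>y. cis (of_int k * x) * cis (of_int l * y)))"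
    unfolding torus_def
    by (subst integral_prod_continuous) (auto intro!: continuous_intros)
  also have "\<dots> = integral {-pi..pi} (\<lambda>x. cis (of_int k * x)) * integral {-pi..pi} (\<lambda>y. cis (of_int l * y))"
    by simp
  also have "\<dots> = (if k = 0 \<and> l = 0 then of_real (4 * pi\<^sup>2) else 0)"
    by (simp add: integral_cis power2_eq_square)
  finally show ?thesis .
qed

text \<open>The Weierstrass test justifies the interchange. It serves both the expansion along rays
  and the geometric series in \<tau>.\<close>

lemma torus_sums:
  fixes f :: "nat \<Rightarrow> real \<times> real \<Rightarrow> complex"
  assumes "\<And>n. continuous_on torus (f n)"
    and "\<And>n p. p \<in> torus \<Longrightarrow> norm (f n p) \<le> M n" and "summable M"
    and "\<And>p. p \<in> torus \<Longrightarrow> (\<lambda>n. f n p) sums g p"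
  shows "(\<lambda>n. integral torus (f n)) sums integral torus g"
proof -
  have "uniform_limit torus (\<lambda>n p. \<Sum>i<n. f i p) (\<lambda>p. \<Sum>i. f i p) sequentially"
    by (rule Weierstrass_m_test) (use assms in auto)
  then have lim: "uniform_limit torus (\<lambda>n p. \<Sum>i<n. f i p) g sequentially"
    by (rule uniform_limit_cong'[THEN iffD1, rotated -1]) (use sums_unique[OF assms(4)] in auto)
  from assms(1) have cont: "continuous_on (cbox (-pi, -pi) (pi, pi)) (\<lambda>p. \<Sum>i<n. f i p)" for n
    unfolding torus_def by (intro continuous_intros)
  obtain I J where IJ: "\<And>n. ((\<lambda>p. \<Sum>i<n. f i p) has_integral I n) torus"
      "(g has_integral J) torus" "I \<longlonglongrightarrow> J"
    using uniform_limit_integral_cbox[OF lim[unfolded torus_def] cont] unfolding torus_def by auto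
  have "I n = (\<Sum>i<n. integral torus (f i))" for n
  proof -
    have "f i integrable_on torus" for i
      using assms(1) unfolding torus_def by (intro integrable_continuous)
    then have "integral torus (\<lambda>p. \<Sum>i<n. f i p) = (\<Sum>i<n. integral torus (f i))"
      by (intro integral_sum) auto
    with integral_unique[OF IJ(1)[of n]] show ?thesis by simp
  qed
  then have "I = (\<lambda>n. \<Sum>i<n. integral torus (f i))" by auto
  with IJ show ?thesis by (auto simp: sums_def integral_unique)
qed

(* On |x| = |y| = t, |1 - x|^2 - t^2 |1 - a x|^2 = (1 - a t^2) (1 + a t^2 - 2 Re x); hence H has no
   zero with |x| = |y| <= s. *)
definition zero_free :: "real \<Rightarrow> real \<Rightarrow> bool" where
  "zero_free a s \<longleftrightarrow> s > 0 \<and> (\<forall>t\<in>{0..s}. a * t\<^sup>2 < 1 \<and> 1 - 2 * t + a * t\<^sup>2 > 0)"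

lemma Hc_nonzero:
  assumes "zero_free a s" "cmod x = t" "cmod y = t" "t \<le> s"
  shows "Hc a x y \<noteq> 0"
proof
  assume "Hc a x y = 0"
  then have "y * (1 - of_real a * x) = 1 - x" by (simp add: Hc_def algebra_simps)
  then have "(cmod y)\<^sup>2 * (cmod (1 - of_real a * x))\<^sup>2 = (cmod (1 - x))\<^sup>2"
    by (metis norm_mult power_mult_distrib)
  moreover have ht: "t\<^sup>2 = (Re x)\<^sup>2 + (Im x)\<^sup>2" using assms(2) cmod_power2[of x] by simp
  have "(cmod (1 - of_real a * x))\<^sup>2 = 1 - 2 * a * Re x + a\<^sup>2 * t\<^sup>2" for a
    unfolding ht unfolding cmod_power2 by (simp add: power2_eq_square algebra_simps)
  from this[of a] this[of 1] have "(cmod (1 - of_real a * x))\<^sup>2 = 1 - 2 * a * Re x + a\<^sup>2 * t\<^sup>2"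
    "(cmod (1 - x))\<^sup>2 = 1 - 2 * Re x + t\<^sup>2" by simp_all
  ultimately have "t\<^sup>2 * (1 - 2 * a * Re x + a\<^sup>2 * t\<^sup>2) = 1 - 2 * Re x + t\<^sup>2"
    using assms(3) by simp
  then have "(1 - a * t\<^sup>2) * (1 + a * t\<^sup>2 - 2 * Re x) = 0"
    by algebra
  moreover have "0 \<le> t" "Re x \<le> t" using assms complex_Re_le_cmod[of x] by auto
  moreover have "a * t\<^sup>2 < 1" "1 - 2 * t + a * t\<^sup>2 > 0"
    using assms \<open>0 \<le> t\<close> by (auto simp: zero_free_def)
  ultimately show False by auto
qed

text \<open>The conditions are strict at s, so they persist slightly beyond it. The gap between the
  two radii gives geometric decay of the terms on the torus itself.\<close>

lemma zero_free_extend: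
  assumes "zero_free a s"
  obtains s' where "s' > s" "zero_free a s'"
proof -
  have ev: "\<forall>\<^sub>F t in at s. 1 - a * t\<^sup>2 > 0" "\<forall>\<^sub>F t in at s. 1 - 2 * t + a * t\<^sup>2 > 0"
  proof -
    have "((\<lambda>t. 1 - a * t\<^sup>2) \<longlongrightarrow> 1 - a * s\<^sup>2) (at s)"
      "((\<lambda>t. 1 - 2 * t + a * t\<^sup>2) \<longlongrightarrow> 1 - 2 * s + a * s\<^sup>2) (at s)"
      by (auto intro!: tendsto_intros)
    moreover have "1 - a * s\<^sup>2 > 0" "1 - 2 * s + a * s\<^sup>2 > 0"
      using assms by (auto simp: zero_free_def)
    ultimately show "\<forall>\<^sub>F t in at s. 1 - a * t\<^sup>2 > 0" "\<forall>\<^sub>F t in at s. 1 - 2 * t + a * t\<^sup>2 > 0"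
      using order_tendstoD(1) by blast+
  qed
  from eventually_conj[OF this] obtain d where d: "d > 0"
    "\<And>t. t \<noteq> s \<Longrightarrow> dist t s < d \<Longrightarrow> 1 - a * t\<^sup>2 > 0 \<and> 1 - 2 * t + a * t\<^sup>2 > 0"
    by (auto simp: eventually_at)
  have "zero_free a (s + d / 2)" unfolding zero_free_def
  proof (intro conjI ballI)
    show "s + d / 2 > 0" using assms d by (auto simp: zero_free_def)
    fix t assume t: "t \<in> {0..s + d/2}"
    have "1 - a * t\<^sup>2 > 0 \<and> 1 - 2 * t + a * t\<^sup>2 > 0"
    proof (cases "t \<le> s")
      case True
      with t assms show ?thesis by (auto simp: zero_free_def)
    next
      case False
      with t d show ?thesis by (auto simp: dist_real_def)
    qed
    then show "a * t\<^sup>2 < 1" "1 - 2 * t + a * t\<^sup>2 > 0" by auto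
  qed
  with that[of "s + d/2"] d show ?thesis by auto
qed

text \<open>One M serves all directions X, Y because they range over a compact set; the bound is
  Cauchy's estimate on a circle slightly larger than s.\<close>

lemma ray_F_uniform_bound:
  assumes "zero_free a s"
  obtains r M where "r > s" "\<And>X Y m. cmod X = 1 \<Longrightarrow> cmod Y = 1 \<Longrightarrow>
      cmod (fps_nth (ray X Y (fps_nth (F a b) n)) m) \<le> M / r ^ m"
    "\<And>X Y u. cmod X = 1 \<Longrightarrow> cmod Y = 1 \<Longrightarrow> cmod u \<le> s \<Longrightarrow>
      (\<lambda>m. fps_nth (ray X Y (fps_nth (F a b) n)) m * u ^ m)
        sums (Gc a b (u * X) (u * Y) ^ n / Hc a (u * X) (u * Y) ^ Suc n)"
proof -
  obtain r where r: "r > s" "zero_free a r" using zero_free_extend[OF assms] by blast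
  have r0: "r > 0" using r by (auto simp: zero_free_def)
  have nz: "Hc a (u * X) (u * Y) \<noteq> 0" if "cmod X = 1" "cmod Y = 1" "cmod u \<le> r" for u X Y
    using Hc_nonzero[OF r(2), of "u * X" "cmod u" "u * Y"] that by (simp add: norm_mult)
  let ?f = "\<lambda>X Y u. Gc a b (u * X) (u * Y) ^ n / Hc a (u * X) (u * Y) ^ Suc n"
  let ?K = "cball 0 r \<times> (sphere 0 1 \<times> sphere 0 1) :: (complex \<times> complex \<times> complex) set"
  have "continuous_on ?K (\<lambda>(u, X, Y). ?f X Y u)"
    unfolding case_prod_unfold using nz
    unfolding Gc_def Hc_def by (auto intro!: continuous_intros)
  then have "compact ((\<lambda>(u, X, Y). ?f X Y u) ` ?K)"
    by (intro compact_continuous_image compact_Times) auto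
  from compact_imp_bounded[OF this] obtain M
    where M': "\<forall>w\<in>(\<lambda>(u, X, Y). ?f X Y u) ` ?K. cmod w \<le> M"
    unfolding bounded_iff by blast
  have M: "cmod (?f X Y u) \<le> M" if "(u, X, Y) \<in> ?K" for u X Y
    using M' imageI[OF that, of "\<lambda>(u, X, Y). ?f X Y u"] unfolding case_prod_conv by blast
  have hol: "?f X Y holomorphic_on S" if "cmod X = 1" "cmod Y = 1" "S \<subseteq> cball 0 r" for X Y S
    using nz that unfolding Gc_def Hc_def
    by (auto intro!: holomorphic_intros)
  show ?thesis
  proof (rule that)
    fix X Y :: complex assume XY: "cmod X = 1" "cmod Y = 1"
    note ex = ray_F_expansion[of a b X Y n]
    show "cmod (fps_nth (ray X Y (fps_nth (F a b) n)) m) \<le> M / r ^ m" for m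
    proof -
      have "cmod ((deriv ^^ m) (?f X Y) 0) \<le> fact m * M / r ^ m"
      proof (rule Cauchy_inequality)
        show "?f X Y holomorphic_on ball 0 r" using XY by (intro hol) auto
        show "continuous_on (cball 0 r) (?f X Y)"
          using XY by (intro holomorphic_on_imp_continuous_on hol) auto
        show "cmod (?f X Y u) \<le> M" if "cmod (0 - u) = r" for u
          using that XY by (intro M) auto
      qed (use r0 in auto)
      then show ?thesis unfolding fps_nth_fps_expansion[OF ex, of m] norm_divide
        by (simp add: field_simps)
    qed
    show "(\<lambda>m. fps_nth (ray X Y (fps_nth (F a b) n)) m * u ^ m) sums ?f X Y u" if "cmod u \<le> s" for u
    proof (rule has_fps_expansion_imp_sums_complex[OF ex])
      show "?f X Y holomorphic_on eball 0 (ereal r)" using XY by (intro hol) (auto simp: eball_def)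
      show "ereal (cmod u) < ereal r" using that r by auto
    qed
  qed (use r in auto)
qed

text \<open>With x = x0 X, y = x0 Y and xyz = x0^3, the factor
  \<open>x0 * cis (- fst p) * cis (- snd p)\<close> is z. So W = zG/H, and W = 1 exactly where Q
  vanishes.\<close>

definition Wt :: "real \<Rightarrow> real \<Rightarrow> complex \<Rightarrow> real \<times> real \<Rightarrow> complex" where
  "Wt a b x0 p = x0 * cis (- fst p) * cis (- snd p) * Gc a b (x0 * cis (fst p)) (x0 * cis (snd p))
      / Hc a (x0 * cis (fst p)) (x0 * cis (snd p))"

definition Ht :: "real \<Rightarrow> complex \<Rightarrow> real \<times> real \<Rightarrow> complex" where
  "Ht a x0 p = Hc a (x0 * cis (fst p)) (x0 * cis (snd p))"

lemma Ht_nonzero: "zero_free a s \<Longrightarrow> cmod x0 = s \<Longrightarrow> Ht a x0 p \<noteq> 0"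
  unfolding Ht_def by (rule Hc_nonzero[of a s]) (auto simp: norm_mult)

lemma continuous_on_Ht [continuous_intros]: "continuous_on S (Ht a x0)"
  unfolding Ht_def Hc_def by (intro continuous_intros)

lemma continuous_on_Wt:
  assumes "zero_free a s" "cmod x0 = s"
  shows "continuous_on S (Wt a b x0)"
  using Ht_nonzero[OF assms] unfolding Wt_def Ht_def Gc_def Hc_def
  by (intro continuous_intros) auto

lemma delta_integral:
  assumes zf: "zero_free a s" and x0: "cmod x0 = s"
  shows "of_real (4 * pi\<^sup>2 * \<delta> a b n) * x0 ^ (3 * n) = integral torus (\<lambda>p. Wt a b x0 p ^ n / Ht a x0 p)"
proof -
  define A where "A = (\<lambda>i j. fps_nth (fps_nth (fps_nth (F a b) n) j) i)"
  define R where "R = (\<lambda>p. ray (cis (fst p)) (cis (snd p)) (fps_nth (F a b) n))"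
  define E where "E = (\<lambda>p :: real \<times> real. cis (- of_nat n * fst p) * cis (- of_nat n * snd p))"
  define f where "f = (\<lambda>m p. x0 ^ n * E p * (fps_nth (R p) m * x0 ^ m))"
  obtain r M where r: "r > s"
    and M: "\<And>X Y m. cmod X = 1 \<Longrightarrow> cmod Y = 1 \<Longrightarrow>
      cmod (fps_nth (ray X Y (fps_nth (F a b) n)) m) \<le> M / r ^ m"
    and S: "\<And>X Y u. cmod X = 1 \<Longrightarrow> cmod Y = 1 \<Longrightarrow> cmod u \<le> s \<Longrightarrow>
      (\<lambda>m. fps_nth (ray X Y (fps_nth (F a b) n)) m * u ^ m)
        sums (Gc a b (u * X) (u * Y) ^ n / Hc a (u * X) (u * Y) ^ Suc n)"
    by (rule ray_F_uniform_bound[OF zf, where b = b and n = n], rule that) blast+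
  have s0: "s > 0" using zf by (auto simp: zero_free_def)
  have R_nth: "fps_nth (R p) m = (\<Sum>j\<le>m. of_real (A (m - j) j) * cis (fst p) ^ (m - j) * cis (snd p) ^ j)" for p m
    by (simp add: R_def ray_nth A_def)
  have "(\<lambda>m. integral torus (f m)) sums integral torus (\<lambda>p. Wt a b x0 p ^ n / Ht a x0 p)"
  proof (rule torus_sums)
    show "continuous_on torus (f m)" for m
      unfolding f_def R_nth E_def by (intro continuous_intros)
    show "norm (f m p) \<le> s ^ n * (M * (s / r) ^ m)" for m p
    proof -
      have "norm (f m p) = s ^ n * (cmod (fps_nth (R p) m) * s ^ m)"
        by (simp add: f_def E_def norm_mult norm_power x0)
      also have "\<dots> \<le> s ^ n * (M / r ^ m * s ^ m)"
        using s0 by (intro mult_left_mono mult_right_mono) (auto simp: R_def intro!: M)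
      finally show ?thesis by (simp add: power_divide)
    qed
    show "summable (\<lambda>m. s ^ n * (M * (s / r) ^ m))"
      using r s0 by (intro summable_mult summable_geometric) auto
    show "(\<lambda>m. f m p) sums (Wt a b x0 p ^ n / Ht a x0 p)" for p
    proof -
      have "(\<lambda>m. f m p) sums (x0 ^ n * E p * (Gc a b (x0 * cis (fst p)) (x0 * cis (snd p)) ^ n
          / Hc a (x0 * cis (fst p)) (x0 * cis (snd p)) ^ Suc n))"
        unfolding f_def R_def by (intro sums_mult S) (auto simp: x0)
      also have "x0 ^ n * E p * (Gc a b (x0 * cis (fst p)) (x0 * cis (snd p)) ^ n
          / Hc a (x0 * cis (fst p)) (x0 * cis (snd p)) ^ Suc n) = Wt a b x0 p ^ n / Ht a x0 p"
        unfolding E_def Wt_def Ht_def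
        by (simp add: power_mult_distrib power_divide Complex.DeMoivre mult_ac)
      finally show ?thesis .
    qed
  qed
  \<comment> \<open>\<open>f m\<close> carries the part of total degree m with both exponents
    lowered by n. Its mean survives only if both exponents equal n, so the single index m = 2 n
    contributes.\<close>
  moreover have "integral torus (f m)
      = (if m = 2 * n then of_real (4 * pi\<^sup>2 * \<delta> a b n) * x0 ^ (3 * n) else 0)" for m
  proof -
    have "f m = (\<lambda>p. \<Sum>j\<le>m. x0 ^ (n + m) * of_real (A (m - j) j)
        * (cis (of_int (int (m - j) - int n) * fst p) * cis (of_int (int j - int n) * snd p)))"
    proof
      fix p :: "real \<times> real"
      have "E p * (cis (fst p) ^ i * cis (snd p) ^ j)
          = cis (of_int (int i - int n) * fst p) * cis (of_int (int j - int n) * snd p)" for i j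
      proof -
        have 1: "cis (of_int (int i - int n) * t) = cis (- of_nat n * t) * cis t ^ i" for i and t :: real
          by (simp add: Complex.DeMoivre cis_mult algebra_simps)
        show ?thesis unfolding 1 E_def by (simp only: mult_ac)
      qed
      then have "x0 ^ (n + m) * of_real c * (cis (of_int (int i - int n) * fst p) * cis (of_int (int j - int n) * snd p))
         = x0 ^ n * E p * (of_real c * cis (fst p) ^ i * cis (snd p) ^ j * x0 ^ m)" for i j c
        unfolding power_add by (metis (no_types, lifting) mult.assoc mult.left_commute mult.commute)
      then show "f m p = (\<Sum>j\<le>m. x0 ^ (n + m) * of_real (A (m - j) j)
        * (cis (of_int (int (m - j) - int n) * fst p) * cis (of_int (int j - int n) * snd p)))"
        by (simp only: f_def R_nth sum_distrib_left sum_distrib_right)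
    qed
    then have "integral torus (f m) = (\<Sum>j\<le>m. x0 ^ (n + m) * of_real (A (m - j) j) *
       integral torus (\<lambda>p. cis (of_int (int (m - j) - int n) * fst p) * cis (of_int (int j - int n) * snd p)))"
      by (simp only:) (subst integral_sum, auto simp: torus_def intro!: integrable_continuous continuous_intros)
    also have "\<dots> = (\<Sum>j\<le>m. x0 ^ (n + m) * of_real (A (m - j) j) *
       (if j = n \<and> m = 2 * n then of_real (4 * pi\<^sup>2) else 0))"
      by (intro sum.cong refl arg_cong2[where f = "(*)"], subst torus_orthogonality) auto
    also have "\<dots> = (if m = 2 * n then x0 ^ (n + m) * of_real (A n n) * of_real (4 * pi\<^sup>2) else 0)"
      by (auto simp: if_distrib cong: if_cong)
    finally show ?thesis by (simp add: A_def \<delta>_def coeff3_def mult_ac)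
  qed
  ultimately have "(\<lambda>m. if m = 2 * n then of_real (4 * pi\<^sup>2 * \<delta> a b n) * x0 ^ (3 * n) else 0)
     sums integral torus (\<lambda>p. Wt a b x0 p ^ n / Ht a x0 p)"
    by simp
  from sums_unique2[OF this sums_single[of "2 * n" "\<lambda>_. of_real (4 * pi\<^sup>2 * \<delta> a b n) * x0 ^ (3 * n)"]]
  show ?thesis by simp
qed

(* Q at the point (x, y, tau z) of the torus, where xyz = x0^3 *)
definition Qt :: "real \<Rightarrow> real \<Rightarrow> complex \<Rightarrow> real \<Rightarrow> real \<times> real \<Rightarrow> complex" where
  "Qt a b x0 \<tau> p = Ht a x0 p - of_real \<tau> * (x0 * cis (- fst p) * cis (- snd p)
      * Gc a b (x0 * cis (fst p)) (x0 * cis (snd p)))"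

lemma Qt_Wt:
  assumes "zero_free a s" "cmod x0 = s"
  shows "Qt a b x0 \<tau> p = Ht a x0 p * (1 - of_real \<tau> * Wt a b x0 p)"
  using Ht_nonzero[OF assms] by (simp add: Qt_def Wt_def Ht_def right_diff_distrib)

lemma one_minus_Wt_nonzero:
  assumes "cmod w \<le> 1" "0 \<le> \<tau>" "\<tau> < 1"
  shows "1 - of_real \<tau> * w \<noteq> (0 :: complex)"
proof
  assume "1 - of_real \<tau> * w = (0 :: complex)"
  then have "1 = \<tau> * cmod w" using assms(2) by (metis eq_iff_diff_eq_0 norm_mult norm_of_real norm_one abs_of_nonneg)
  also have "\<dots> \<le> \<tau>" using assms by (simp add: mult_left_le)
  finally show False using assms by simp
qed

lemma Qt_nonzero:
  assumes "zero_free a s" "cmod x0 = s" "cmod (Wt a b x0 p) \<le> 1" "0 \<le> \<tau>" "\<tau> < 1"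
  shows "Qt a b x0 \<tau> p \<noteq> 0"
  using Ht_nonzero[OF assms(1,2)] one_minus_Wt_nonzero[OF assms(3-5)]
  by (simp add: Qt_Wt[OF assms(1,2)])

lemma continuous_on_Qt [continuous_intros]: "continuous_on S (Qt a b x0 \<tau>)"
  unfolding Qt_def Ht_def Gc_def Hc_def by (intro continuous_intros)

lemma delta_gf_integral:
  assumes zf: "zero_free a s" "cmod x0 = s"
    and W: "\<And>p. p \<in> torus \<Longrightarrow> cmod (Wt a b x0 p) \<le> 1" and \<tau>: "0 \<le> \<tau>" "\<tau> < 1"
  shows "(\<lambda>n. of_real (4 * pi\<^sup>2 * \<delta> a b n) * x0 ^ (3 * n) * of_real \<tau> ^ n)
     sums integral torus (\<lambda>p. 1 / Qt a b x0 \<tau> p)"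
proof -
  have "continuous_on torus (\<lambda>p. 1 / Ht a x0 p)"
    using Ht_nonzero[OF zf] by (intro continuous_intros) auto
  then have "compact ((\<lambda>p. 1 / Ht a x0 p) ` torus)"
    by (rule compact_continuous_image[OF _ compact_torus])
  from compact_imp_bounded[OF this] obtain M where M: "\<And>p. p \<in> torus \<Longrightarrow> cmod (1 / Ht a x0 p) \<le> M"
    unfolding bounded_iff by blast
  have "(\<lambda>n. integral torus (\<lambda>p. of_real \<tau> ^ n * (Wt a b x0 p ^ n / Ht a x0 p)))
     sums integral torus (\<lambda>p. 1 / Qt a b x0 \<tau> p)"
  proof (rule torus_sums)
    show "continuous_on torus (\<lambda>p. of_real \<tau> ^ n * (Wt a b x0 p ^ n / Ht a x0 p))" for n
      using Ht_nonzero[OF zf] by (intro continuous_intros continuous_on_Wt[OF zf]) auto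
    show "cmod (of_real \<tau> ^ n * (Wt a b x0 p ^ n / Ht a x0 p)) \<le> \<tau> ^ n * M" if "p \<in> torus" for n p
    proof -
      have "cmod (Wt a b x0 p ^ n / Ht a x0 p) = cmod (Wt a b x0 p) ^ n * cmod (1 / Ht a x0 p)"
        by (simp add: norm_power norm_divide)
      also have "\<dots> \<le> 1 * M"
        using W[OF that] M[OF that] by (intro mult_mono) (auto simp: power_le_one)
      finally have "cmod (Wt a b x0 p ^ n / Ht a x0 p) \<le> M" by simp
      then show ?thesis unfolding norm_mult norm_power using \<tau> by (simp add: mult_left_mono)
    qed
    show "summable (\<lambda>n. \<tau> ^ n * M)"
      using \<tau> by (intro summable_mult2 summable_geometric) auto
    show "(\<lambda>n. of_real \<tau> ^ n * (Wt a b x0 p ^ n / Ht a x0 p)) sums (1 / Qt a b x0 \<tau> p)"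
      if "p \<in> torus" for p
    proof -
      have "cmod (of_real \<tau> * Wt a b x0 p) \<le> \<tau>" using W[OF that] \<tau> by (simp add: norm_mult mult_left_le)
      then have "(\<lambda>n. (of_real \<tau> * Wt a b x0 p) ^ n) sums (1 / (1 - of_real \<tau> * Wt a b x0 p))"
        using \<tau> by (intro geometric_sums) auto
      from sums_divide[OF this, of "Ht a x0 p"] show ?thesis
        by (simp add: Qt_Wt[OF zf] power_mult_distrib mult_ac)
    qed
  qed
  then show ?thesis
    unfolding delta_integral[OF zf] integral_mult_right by (simp only: mult.commute)
qed

section \<open>Constant signs against divergence of the generating function\<close>

lemma integral_Re_torus:
  assumes "continuous_on torus f"
  shows "integral torus (\<lambda>p. Re (f p)) = Re (integral torus f)"
  using integral_linear[OF _ bounded_linear_Re, of f torus] assms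
  unfolding torus_def by (simp add: integrable_continuous o_def)

text \<open>Pringsheim's principle in elementary form: if almost all terms are nonnegative, the sum
  of moduli differs from the sum on the positive axis by finitely many bounded terms. A bound on the
  axis thus holds in every direction.\<close>

lemma abs_sum_bound:
  fixes f :: "nat \<Rightarrow> real"
  assumes "finite {n. f n < 0}"
    and sm: "\<And>\<tau>. 0 < \<tau> \<Longrightarrow> \<tau> < 1 \<Longrightarrow> summable (\<lambda>n. f n * \<tau> ^ n)"
    and bd: "\<And>\<tau>. 0 < \<tau> \<Longrightarrow> \<tau> < 1 \<Longrightarrow> \<bar>\<Sum>n. f n * \<tau> ^ n\<bar> \<le> K"
  shows "\<exists>C. \<forall>\<tau> \<zeta>. 0 < \<tau> \<longrightarrow> \<tau> < 1 \<longrightarrow> cmod \<zeta> = 1 \<longrightarrow> cmod (\<Sum>n. of_real (f n) * \<zeta> ^ n * of_real \<tau> ^ n) \<le> C"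
proof (intro exI allI impI)
  \<comment> \<open>Twice the modulus of each negative term, since |f| = f + 2 |f| where f < 0; a
    finite correction by hypothesis.\<close>
  define g where "g = (\<lambda>n. if n \<in> {n. f n < 0} then 2 * \<bar>f n\<bar> else 0)"
  have sg: "summable g" unfolding g_def by (rule summable_If_finite_set[OF assms(1)])
  fix \<tau> :: real and \<zeta> :: complex assume \<tau>: "0 < \<tau>" "\<tau> < 1" and \<zeta>: "cmod \<zeta> = 1"
  let ?h = "\<lambda>n. of_real (f n) * \<zeta> ^ n * of_real \<tau> ^ n"
  have *: "cmod (?h n) \<le> f n * \<tau> ^ n + g n" for n
  proof -
    have "cmod (?h n) = \<bar>f n\<bar> * \<tau> ^ n" using \<tau> \<zeta> by (simp add: norm_mult norm_power)
    also have "\<dots> \<le> f n * \<tau> ^ n + g n"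
      using mult_left_le[of "\<tau> ^ n" "\<bar>f n\<bar>"] power_le_one[of \<tau> n] \<tau>
      by (auto simp: g_def abs_if split: if_splits)
    finally show ?thesis .
  qed
  have "cmod (suminf ?h) \<le> (\<Sum>n. f n * \<tau> ^ n + g n)"
    by (rule norm_suminf_le) (use * sm[OF \<tau>] sg in \<open>auto intro: summable_add\<close>)
  also have "\<dots> = (\<Sum>n. f n * \<tau> ^ n) + suminf g" using suminf_add[OF sm[OF \<tau>] sg] by simp
  also have "\<dots> \<le> K + suminf g" using bd[OF \<tau>] by simp
  finally show "cmod (suminf ?h) \<le> K + suminf g" .
qed

lemma sign_changes:
  fixes f :: "nat \<Rightarrow> real"
  assumes sm: "\<And>\<tau>. 0 < \<tau> \<Longrightarrow> \<tau> < 1 \<Longrightarrow> summable (\<lambda>n. f n * \<tau> ^ n)"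
    and bd: "\<And>\<tau>. 0 < \<tau> \<Longrightarrow> \<tau> < 1 \<Longrightarrow> \<bar>\<Sum>n. f n * \<tau> ^ n\<bar> \<le> K"
    and \<zeta>: "cmod \<zeta> = 1"
    and ub: "\<And>M. \<exists>\<tau>. 0 < \<tau> \<and> \<tau> < 1 \<and> M < cmod (\<Sum>n. of_real (f n) * \<zeta> ^ n * of_real \<tau> ^ n)"
  shows "infinite {n. f n > 0} \<and> infinite {n. f n < 0}"
proof (intro conjI notI)
  assume "finite {n. f n < 0}"
  from abs_sum_bound[OF this sm bd] obtain C where
    C: "\<forall>\<tau> \<zeta>. 0 < \<tau> \<longrightarrow> \<tau> < 1 \<longrightarrow> cmod \<zeta> = 1 \<longrightarrow> cmod (\<Sum>n. of_real (f n) * \<zeta> ^ n * of_real \<tau> ^ n) \<le> C"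
    by blast
  from ub[of C] obtain \<tau> where \<tau>: "0 < \<tau>" "\<tau> < 1" "C < cmod (\<Sum>n. of_real (f n) * \<zeta> ^ n * of_real \<tau> ^ n)"
    by blast
  with C \<zeta> show False by fastforce
next
  assume "finite {n. f n > 0}"
  then have "finite {n. - f n < 0}" by simp
  moreover have "summable (\<lambda>n. - f n * \<tau> ^ n)" "\<bar>\<Sum>n. - f n * \<tau> ^ n\<bar> \<le> K" if "0 < \<tau>" "\<tau> < 1" for \<tau>
    using summable_minus[OF sm[OF that]] suminf_minus[OF sm[OF that]] bd[OF that] by simp_all
  ultimately obtain C where
    C: "\<forall>\<tau> \<zeta>. 0 < \<tau> \<longrightarrow> \<tau> < 1 \<longrightarrow> cmod \<zeta> = 1 \<longrightarrow> cmod (\<Sum>n. of_real (- f n) * \<zeta> ^ n * of_real \<tau> ^ n) \<le> C"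
    using abs_sum_bound[of "\<lambda>n. - f n" K] by blast
  from ub[of C] obtain \<tau> where \<tau>: "0 < \<tau>" "\<tau> < 1" "C < cmod (\<Sum>n. of_real (f n) * \<zeta> ^ n * of_real \<tau> ^ n)"
    by blast
  have "summable (\<lambda>n. of_real (f n) * \<zeta> ^ n * of_real \<tau> ^ n)"
  proof (rule summable_norm_cancel)
    \<comment> \<open>Convergence at the larger point (1 + \<tau>) / 2 < 1 gives absolute
      convergence at \<tau>.\<close>
    have "summable (\<lambda>n. norm (f n * \<tau> ^ n))"
      using \<tau> by (intro powser_insidea[of f "(1 + \<tau>) / 2"] sm) auto
    then show "summable (\<lambda>n. norm (of_real (f n) * \<zeta> ^ n * of_real \<tau> ^ n))"
      using \<zeta> by (simp add: norm_mult norm_power abs_mult power_abs)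
  qed
  from suminf_minus[OF this] have "cmod (\<Sum>n. of_real (- f n) * \<zeta> ^ n * of_real \<tau> ^ n)
      = cmod (\<Sum>n. of_real (f n) * \<zeta> ^ n * of_real \<tau> ^ n)"
    by simp
  with C[rule_format, OF \<tau>(1,2) \<zeta>] \<tau>(3) show False by simp
qed

text \<open>In the plane 1 / (\<epsilon> + |p|^2) has an integral of order ln (1/\<epsilon>), while
  the rest of the torus costs at most K times its area. One quadrant is enough for a lower
  bound.\<close>

lemma torus_log_divergence:
  fixes g :: "real \<Rightarrow> real \<times> real \<Rightarrow> real"
  assumes "c > 0" "\<nu> > 0" "\<nu> \<le> pi" "\<epsilon>0 > 0" "K \<ge> 0"
    and cont: "\<And>\<epsilon>. 0 < \<epsilon> \<Longrightarrow> \<epsilon> < \<epsilon>0 \<Longrightarrow> continuous_on torus (g \<epsilon>)"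
    and lower: "\<And>\<epsilon> p. 0 < \<epsilon> \<Longrightarrow> \<epsilon> < \<epsilon>0 \<Longrightarrow> p \<in> torus \<Longrightarrow> g \<epsilon> p \<ge> - K"
    and near: "\<And>\<epsilon> x y. 0 < \<epsilon> \<Longrightarrow> \<epsilon> < \<epsilon>0 \<Longrightarrow> 0 \<le> x \<Longrightarrow> x \<le> \<nu> \<Longrightarrow> 0 \<le> y \<Longrightarrow> y \<le> \<nu> \<Longrightarrow> g \<epsilon> (x, y) \<ge> c / (\<epsilon> + x\<^sup>2 + y\<^sup>2)"
  shows "\<exists>\<epsilon>>0. \<epsilon> < \<epsilon>0 \<and> integral torus (g \<epsilon>) > M"
proof -
  have fl: "filterlim (\<lambda>\<epsilon>. c / 4 * ln (\<epsilon> + 2 * \<nu>\<^sup>2) - c / 4 * ln \<epsilon> + - K * (4 * pi\<^sup>2)) at_top (at_right 0)"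
    using assms(1,2) by real_asymp
  from eventually_conj[OF filterlim_at_top_dense[THEN iffD1, rule_format, OF fl, of M] eventually_at_right_real[OF assms(4)]]
  obtain \<epsilon> where \<epsilon>: "c / 4 * ln (\<epsilon> + 2 * \<nu>\<^sup>2) - c / 4 * ln \<epsilon> + - K * (4 * pi\<^sup>2) > M" "0 < \<epsilon>" "\<epsilon> < \<epsilon>0"
    by (auto dest!: eventually_happens)
  let ?U = "cbox (0, 0) (\<nu>, \<nu>) :: (real \<times> real) set"
  define h where "h = (\<lambda>p :: real \<times> real. c / (\<epsilon> + (fst p)\<^sup>2 + (snd p)\<^sup>2))"
  have pos: "\<epsilon> + x\<^sup>2 + y\<^sup>2 > 0" for x y :: real
    using \<epsilon>(2) by (simp add: add_pos_nonneg)
  have nz: "\<epsilon> + x\<^sup>2 + y\<^sup>2 \<noteq> 0" for x y :: real using pos[of x y] by simp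
  have pos2: "\<epsilon> + 2 * x\<^sup>2 > 0" for x :: real using pos[of x x] by (simp only: mult_2 add.assoc)
  have sub: "?U \<subseteq> torus" using assms unfolding torus_def by (auto simp: subset_iff)
  have gi: "(\<lambda>p. g \<epsilon> p + K) integrable_on torus"
    using cont[OF \<epsilon>(2,3)] unfolding torus_def by (intro integrable_continuous continuous_intros)
  have gU: "(\<lambda>p. g \<epsilon> p + K) integrable_on ?U"
    by (intro integrable_continuous continuous_intros continuous_on_subset[OF cont[OF \<epsilon>(2,3)] sub])
  have hU: "continuous_on ?U h" unfolding h_def using nz by (intro continuous_intros) auto
  \<comment> \<open>For y \<le> x the kernel is at least c / (\<epsilon> + 2 x^2). Integrating this
    over y from 0 to x gives the integrand here, which has an elementary primitive.\<close>
  have "((\<lambda>x. c * x / (\<epsilon> + 2 * x\<^sup>2)) has_integral (c / 4 * ln (\<epsilon> + 2 * \<nu>\<^sup>2) - c / 4 * ln (\<epsilon> + 2 * 0\<^sup>2))) {0..\<nu>}"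
  proof (rule fundamental_theorem_of_calculus)
    fix x :: real
    have "\<epsilon> + 2 * x\<^sup>2 > 0" using pos[of x x] by simp
    then show "((\<lambda>x. c / 4 * ln (\<epsilon> + 2 * x\<^sup>2)) has_vector_derivative c * x / (\<epsilon> + 2 * x\<^sup>2)) (at x within {0..\<nu>})"
      unfolding has_real_derivative_iff_has_vector_derivative[symmetric]
      by (auto intro!: derivative_eq_intros simp: field_simps)
  qed (use assms in auto)
  then have I1: "c / 4 * ln (\<epsilon> + 2 * \<nu>\<^sup>2) - c / 4 * ln \<epsilon> = integral {0..\<nu>} (\<lambda>x. c * x / (\<epsilon> + 2 * x\<^sup>2))"
    and I1': "(\<lambda>x. c * x / (\<epsilon> + 2 * x\<^sup>2)) integrable_on {0..\<nu>}"
    by (auto simp: integral_unique has_integral_integrable)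
  have "integral {0..\<nu>} (\<lambda>x. c * x / (\<epsilon> + 2 * x\<^sup>2)) \<le> integral {0..\<nu>} (\<lambda>x. integral (cbox 0 \<nu>) (\<lambda>y. h (x, y)))"
  proof (rule integral_le[OF I1'])
    show "(\<lambda>x. integral (cbox 0 \<nu>) (\<lambda>y. h (x, y))) integrable_on {0..\<nu>}"
      using integral_integrable_2dim[OF hU] by simp
    fix x assume x: "x \<in> {0..\<nu>}"
    have "c * x / (\<epsilon> + 2 * x\<^sup>2) = integral {0..x} (\<lambda>y. c / (\<epsilon> + 2 * x\<^sup>2))"
      using x by simp
    also have "\<dots> \<le> integral {0..x} (\<lambda>y. h (x, y))"
    proof (rule integral_le)
      show "(\<lambda>y. h (x, y)) integrable_on {0..x}"
        unfolding h_def using nz by (intro integrable_continuous_interval continuous_intros) auto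
      show "c / (\<epsilon> + 2 * x\<^sup>2) \<le> h (x, y)" if "y \<in> {0..x}" for y
      proof -
        have "\<epsilon> + x\<^sup>2 + y\<^sup>2 \<le> \<epsilon> + 2 * x\<^sup>2" using that power_mono[of y x 2] by auto
        then show ?thesis unfolding h_def fst_conv snd_conv
          using pos2[of x] pos[of x y] assms(1) by (intro divide_left_mono mult_pos_pos) auto
      qed
    qed auto
    also have "\<dots> \<le> integral (cbox 0 \<nu>) (\<lambda>y. h (x, y))"
    proof (rule integral_subset_le)
      show "(\<lambda>y. h (x, y)) integrable_on {0..x}" "(\<lambda>y. h (x, y)) integrable_on cbox 0 \<nu>"
        unfolding h_def cbox_interval using nz by (intro integrable_continuous_interval continuous_intros; auto)+
      show "\<forall>y\<in>cbox 0 \<nu>. 0 \<le> h (x, y)"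
        unfolding h_def using pos assms(1) by (auto intro!: divide_nonneg_pos)
    qed (use x in auto)
    finally show "c * x / (\<epsilon> + 2 * x\<^sup>2) \<le> integral (cbox 0 \<nu>) (\<lambda>y. h (x, y))" .
  qed
  also have "\<dots> = integral ?U h"
    using integral_prod_continuous[of 0 0 \<nu> \<nu> h] hU by simp
  also have "\<dots> \<le> integral ?U (\<lambda>p. g \<epsilon> p + K)"
  proof (rule integral_le[OF integrable_continuous[OF hU] gU])
    fix p assume p: "p \<in> ?U"
    then have "p \<in> torus" using sub by auto
    have "h p \<le> g \<epsilon> p" using near[OF \<epsilon>(2,3), of "fst p" "snd p"] p
      by (cases p) (auto simp: h_def)
    then show "h p \<le> g \<epsilon> p + K" using \<open>K \<ge> 0\<close> by simp
  qed
  also have "\<dots> \<le> integral torus (\<lambda>p. g \<epsilon> p + K)"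
  proof (intro integral_subset_le[OF sub gU gi] ballI)
    show "0 \<le> g \<epsilon> p + K" if "p \<in> torus" for p
      using lower[OF \<epsilon>(2,3) that] by linarith
  qed
  also have "\<dots> = integral torus (g \<epsilon>) + K * (4 * pi\<^sup>2)"
  proof -
    have "g \<epsilon> integrable_on torus"
      using cont[OF \<epsilon>(2,3)] unfolding torus_def by (intro integrable_continuous)
    moreover have "integral torus (\<lambda>p. K) = K * (4 * pi\<^sup>2)"
      unfolding torus_def by (simp add: content_Pair power2_eq_square)
    ultimately show ?thesis by (subst integral_add) (auto simp: torus_def)
  qed
  finally have "integral torus (g \<epsilon>) > M" using \<epsilon>(1) I1 by simp
  with \<epsilon> show ?thesis by blast
qed

section \<open>The modulus of the kernel on the torus\<close>

text \<open>With X = cis (2 u) and Y = cis (2 v), these are H and s G after removal of the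
  unimodular factor cis (u + v). That leaves only cosines in the real part and sin (u + v) in the
  imaginary part. The letters p, q, r stand for s, a s^2, b s^3.\<close>

definition H1 :: "real \<Rightarrow> real \<Rightarrow> real \<Rightarrow> real \<Rightarrow> complex" where
  "H1 p q u v = Complex ((1 + q) * cos (u + v) - 2 * p * cos (u - v)) (- (1 - q) * sin (u + v))"

definition G1 :: "real \<Rightarrow> real \<Rightarrow> real \<Rightarrow> real \<Rightarrow> real \<Rightarrow> complex" where
  "G1 p q r u v = Complex ((p - r) * cos (u + v) - 2 * q * cos (u - v)) (- (p + r) * sin (u + v))"

lemma half_angle:
  "cis (2 * u) + cis (2 * v) = cis (u + v) * of_real (2 * cos (u - v))"
  "cis (2 * u) * cis (2 * v) = cis (u + v) * cis (u + v)"
  "1 = cis (u + v) * cis (- (u + v))"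
proof -
  have "of_real (2 * cos (u - v)) = cis (u - v) + cis (v - u)"
    by (simp add: complex_eq_iff cos_diff sin_diff)
  then have "cis (u + v) * of_real (2 * cos (u - v)) = cis ((u + v) + (u - v)) + cis ((u + v) + (v - u))"
    by (simp add: ring_distribs cis_mult)
  moreover have "(u + v) + (u - v) = 2 * u" "(u + v) + (v - u) = 2 * v" by simp_all
  ultimately show "cis (2 * u) + cis (2 * v) = cis (u + v) * of_real (2 * cos (u - v))" by simp
  show "cis (2 * u) * cis (2 * v) = cis (u + v) * cis (u + v)" by (simp add: cis_mult)
  show "1 = cis (u + v) * cis (- (u + v))" by (simp add: cis_mult)
qed

lemma H1_eq:
  "1 - of_real p * (cis (2 * u) + cis (2 * v)) + of_real q * (cis (2 * u) * cis (2 * v)) = cis (u + v) * H1 p q u v"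
proof -
  have "H1 p q u v = cis (- (u + v)) - of_real p * of_real (2 * cos (u - v)) + of_real q * cis (u + v)"
    unfolding cis_cnj[symmetric] by (simp add: complex_eq_iff H1_def algebra_simps)
  then show ?thesis
    unfolding half_angle(1,2) by (simp only: ring_distribs half_angle(3)[symmetric]) (simp add: mult_ac)
qed

lemma G1_eq:
  "of_real p - of_real q * (cis (2 * u) + cis (2 * v)) - of_real r * (cis (2 * u) * cis (2 * v)) = cis (u + v) * G1 p q r u v"
proof -
  have "G1 p q r u v = of_real p * cis (- (u + v)) - of_real q * of_real (2 * cos (u - v)) - of_real r * cis (u + v)"
    unfolding cis_cnj[symmetric] by (simp add: complex_eq_iff G1_def algebra_simps)
  moreover have "of_real p = of_real p * (cis (u + v) * cis (- (u + v)))"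
    by (simp only: half_angle(3)[symmetric] mult_1_right)
  ultimately show ?thesis
    unfolding half_angle(1,2) by (simp add: ring_distribs mult_ac)
qed

(* This is |H|^2 - |x0 G|^2 on the torus, in half angles. Up to factors 3, its four coefficients are those
   of the Cayley transform of Q(x, x, x), for p = s, q = a s^2, r = b s^3 and |x0| = s. *)
definition Ef :: "real \<Rightarrow> real \<Rightarrow> real \<Rightarrow> real \<Rightarrow> real \<Rightarrow> real" where
  "Ef p q r u v = (1 - p - q - r) * (1 + p - q + r) * (sin (u + v))\<^sup>2
     + ((1 - p - q - r) * (cos u * cos v) - (1 + 3 * p + 3 * q - r) * (sin u * sin v))
       * ((1 - 3 * p + 3 * q + r) * (cos u * cos v) - (1 + p - q + r) * (sin u * sin v))"

text \<open>A difference of squares in the real part and another in the imaginary part; their linear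
  factors are the ones displayed in \<open>Ef\<close>.\<close>

lemma Ef_eq: "(cmod (H1 p q u v))\<^sup>2 - (cmod (G1 p q r u v))\<^sup>2 = Ef p q r u v"
  unfolding cmod_power2 H1_def G1_def Ef_def complex.sel cos_add cos_diff sin_add
  by (simp add: power2_eq_square algebra_simps)

text \<open>The argument of x0 is absorbed into u and v. Hence a single real form, depending on s
  alone, governs |W| for every x0 on the circle.\<close>

lemma torus_half_angles:
  fixes s t0 :: real
  assumes "x0 = of_real s * cis t0"
  defines "u \<equiv> \<lambda>p. (t0 + fst p) / 2" and "v \<equiv> \<lambda>p. (t0 + snd p) / 2"
  shows Ht_H1: "Ht a x0 p = cis (u p + v p) * H1 s (a * s\<^sup>2) (u p) (v p)"
    and Wt_G1: "Wt a b x0 p = cis (t0 - fst p - snd p) * (G1 s (a * s\<^sup>2) (b * s ^ 3) (u p) (v p) / H1 s (a * s\<^sup>2) (u p) (v p))"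
proof -
  have X: "x0 * cis (fst p) = of_real s * cis (2 * u p)" "x0 * cis (snd p) = of_real s * cis (2 * v p)"
  proof -
    have "2 * u p = t0 + fst p" "2 * v p = t0 + snd p" by (simp_all add: u_def v_def)
    then show "x0 * cis (fst p) = of_real s * cis (2 * u p)" "x0 * cis (snd p) = of_real s * cis (2 * v p)"
      by (simp_all only: assms(1) cis_mult mult.assoc)
  qed
  show H: "Ht a x0 p = cis (u p + v p) * H1 s (a * s\<^sup>2) (u p) (v p)"
    unfolding H1_eq[symmetric] Ht_def Hc_def X by (simp add: power2_eq_square algebra_simps)
  have "of_real s * Gc a b (x0 * cis (fst p)) (x0 * cis (snd p)) = cis (u p + v p) * G1 s (a * s\<^sup>2) (b * s ^ 3) (u p) (v p)"
    unfolding G1_eq[symmetric] Gc_def X by (simp add: power2_eq_square power3_eq_cube algebra_simps)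
  then have "Wt a b x0 p = cis t0 * cis (- fst p) * cis (- snd p)
      * (cis (u p + v p) * G1 s (a * s\<^sup>2) (b * s ^ 3) (u p) (v p)) / (cis (u p + v p) * H1 s (a * s\<^sup>2) (u p) (v p))"
    unfolding Wt_def H[unfolded Ht_def, symmetric] by (simp add: assms(1) mult_ac)
  then show "Wt a b x0 p = cis (t0 - fst p - snd p) * (G1 s (a * s\<^sup>2) (b * s ^ 3) (u p) (v p) / H1 s (a * s\<^sup>2) (u p) (v p))"
    by (simp add: cis_mult)
qed

lemma Wt_Ef:
  assumes "x0 = of_real s * cis t0" "Ht a x0 p \<noteq> 0"
  shows "1 - (cmod (Wt a b x0 p))\<^sup>2
    = Ef s (a * s\<^sup>2) (b * s ^ 3) ((t0 + fst p) / 2) ((t0 + snd p) / 2) / (cmod (Ht a x0 p))\<^sup>2"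
  using assms(2) unfolding Ef_eq[symmetric] Ht_H1[OF assms(1)] Wt_G1[OF assms(1)]
  by (simp add: norm_mult norm_divide power_divide field_simps)

text \<open>Constant up to second order at the origin. Sums and products preserve this on the
  bounded torus, so expansions of trigonometric polynomials reduce to evaluation at the origin,
  without derivatives.\<close>

definition near_const :: "(real \<times> real \<Rightarrow> real) \<Rightarrow> real \<Rightarrow> bool" where
  "near_const f c \<longleftrightarrow> (\<exists>C\<ge>0. \<forall>p\<in>torus. \<bar>f p - c\<bar> \<le> C * ((fst p)\<^sup>2 + (snd p)\<^sup>2))"

lemma near_const_const: "near_const (\<lambda>_. c) c"
  unfolding near_const_def by (intro exI[of _ 0]) auto

lemma near_const_add:
  assumes "near_const f c" "near_const g d"
  shows "near_const (\<lambda>p. f p + g p) (c + d)"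
proof -
  obtain C D where CD: "C \<ge> 0" "D \<ge> 0" "\<And>p. p \<in> torus \<Longrightarrow> \<bar>f p - c\<bar> \<le> C * ((fst p)\<^sup>2 + (snd p)\<^sup>2)"
    "\<And>p. p \<in> torus \<Longrightarrow> \<bar>g p - d\<bar> \<le> D * ((fst p)\<^sup>2 + (snd p)\<^sup>2)"
    using assms unfolding near_const_def by blast
  have "\<bar>f p + g p - (c + d)\<bar> \<le> (C + D) * ((fst p)\<^sup>2 + (snd p)\<^sup>2)" if "p \<in> torus" for p
    using CD(3,4)[OF that] by (simp add: ring_distribs)
  with CD(1,2) show ?thesis unfolding near_const_def by (intro exI[of _ "C + D"]) auto
qed

lemma near_const_mult:
  assumes "near_const f c" "near_const g d"
  shows "near_const (\<lambda>p. f p * g p) (c * d)"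
proof -
  obtain C D where CD: "C \<ge> 0" "D \<ge> 0" "\<And>p. p \<in> torus \<Longrightarrow> \<bar>f p - c\<bar> \<le> C * ((fst p)\<^sup>2 + (snd p)\<^sup>2)"
    "\<And>p. p \<in> torus \<Longrightarrow> \<bar>g p - d\<bar> \<le> D * ((fst p)\<^sup>2 + (snd p)\<^sup>2)"
    using assms unfolding near_const_def by blast
  define L where "L = \<bar>c\<bar> + C * (2 * pi\<^sup>2)"
  have "\<bar>f p * g p - c * d\<bar> \<le> (L * D + C * \<bar>d\<bar>) * ((fst p)\<^sup>2 + (snd p)\<^sup>2)" if p: "p \<in> torus" for p
  proof -
    define e where "e = (fst p)\<^sup>2 + (snd p)\<^sup>2"
    have e: "0 \<le> e" "e \<le> 2 * pi\<^sup>2"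
      using p power_mono[of "\<bar>fst p\<bar>" pi 2] power_mono[of "\<bar>snd p\<bar>" pi 2]
      by (auto simp: e_def torus_iff)
    have "\<bar>f p - c\<bar> \<le> C * e" "\<bar>g p - d\<bar> \<le> D * e" using CD(3,4)[OF p] by (auto simp: e_def)
    moreover have "C * e \<le> C * (2 * pi\<^sup>2)" using CD(1) e by (intro mult_left_mono)
    ultimately have "\<bar>f p\<bar> \<le> L" unfolding L_def by linarith
    have "\<bar>f p * g p - c * d\<bar> = \<bar>f p * (g p - d) + (f p - c) * d\<bar>" by (simp add: algebra_simps)
    also have "\<dots> \<le> \<bar>f p\<bar> * \<bar>g p - d\<bar> + \<bar>f p - c\<bar> * \<bar>d\<bar>"
      by (metis abs_mult abs_triangle_ineq)
    also have "\<dots> \<le> L * (D * e) + (C * e) * \<bar>d\<bar>"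
      using \<open>\<bar>f p\<bar> \<le> L\<close> \<open>\<bar>f p - c\<bar> \<le> C * e\<close> \<open>\<bar>g p - d\<bar> \<le> D * e\<close>
      by (intro add_mono mult_mono) auto
    finally show ?thesis by (simp add: e_def algebra_simps)
  qed
  moreover have "L * D + C * \<bar>d\<bar> \<ge> 0" using CD by (simp add: L_def)
  ultimately show ?thesis unfolding near_const_def by blast
qed

lemma near_const_diff:
  assumes "near_const f c" "near_const g d"
  shows "near_const (\<lambda>p. f p - g p) (c - d)"
  using near_const_add[OF assms(1) near_const_mult[OF near_const_const[of "-1"] assms(2)]] by simp

text \<open>From |sin x - x| \<le> |x|^3 / 6. The range |x| \<le> 2 covers the half angles, which
  are at most pi / 2.\<close>

lemma sin_squared_ge:
  fixes x :: real
  assumes "\<bar>x\<bar> \<le> 2"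
  shows "(sin x)\<^sup>2 \<ge> x\<^sup>2 / 9"
proof -
  have "\<bar>sin x - (\<Sum>m<3. sin_coeff m * x ^ m)\<bar> \<le> inverse (fact 3) * \<bar>x\<bar> ^ 3"
    by (rule Maclaurin_sin_bound)
  also have "(\<Sum>m<3. sin_coeff m * x ^ m) = x"
    by (simp add: numeral_3_eq_3 sin_coeff_def)
  also have "inverse (fact 3) * \<bar>x\<bar> ^ 3 = \<bar>x\<bar> * (\<bar>x\<bar>\<^sup>2 / 6)"
    by (simp add: fact_numeral power3_eq_cube power2_eq_square)
  also have "\<dots> \<le> \<bar>x\<bar> * (2\<^sup>2 / 6)"
    using assms by (intro mult_left_mono divide_right_mono power_mono) auto
  finally have "\<bar>x / 3\<bar> \<le> \<bar>sin x\<bar>" by (simp add: abs_if split: if_splits)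
  then have "(x / 3)\<^sup>2 \<le> (sin x)\<^sup>2" by (rule abs_le_square_iff[THEN iffD1])
  then show ?thesis by (simp add: power_divide)
qed

lemma near_const_cos:
  "near_const (\<lambda>p. cos (fst p / 2 + snd p / 2)) 1" "near_const (\<lambda>p. cos (fst p / 2 - snd p / 2)) 1"
proof -
  have *: "\<bar>cos t - 1\<bar> \<le> 1 * (x\<^sup>2 + y\<^sup>2)" if "\<bar>t\<bar> \<le> \<bar>x\<bar> / 2 + \<bar>y\<bar> / 2" for t x y :: real
  proof -
    have "cos t = 1 - 2 * (sin (t / 2))\<^sup>2" using cos_double_sin[of "t / 2"] by simp
    moreover have "(sin (t / 2))\<^sup>2 \<le> (t / 2)\<^sup>2" using abs_sin_x_le_abs_x[of "t / 2"] abs_le_square_iff by blast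
    moreover have "t\<^sup>2 \<le> (\<bar>x\<bar> / 2 + \<bar>y\<bar> / 2)\<^sup>2" using that by (metis abs_ge_zero order.trans power2_abs power_mono)
    moreover have "(\<bar>x\<bar> / 2 + \<bar>y\<bar> / 2)\<^sup>2 \<le> x\<^sup>2 + y\<^sup>2"
    proof -
      have "(\<bar>x\<bar> / 2 + \<bar>y\<bar> / 2)\<^sup>2 = (x\<^sup>2 + y\<^sup>2 + 2 * \<bar>x\<bar> * \<bar>y\<bar>) / 4"
        by (simp add: power2_sum power_divide field_simps)
      also have "\<dots> \<le> (x\<^sup>2 + y\<^sup>2 + (x\<^sup>2 + y\<^sup>2)) / 4"
        using sum_squares_bound[of "\<bar>x\<bar>" "\<bar>y\<bar>"] by simp
      also have "\<dots> \<le> x\<^sup>2 + y\<^sup>2" using sum_power2_ge_zero[of x y] by simp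
      finally show ?thesis .
    qed
    moreover have "(t / 2)\<^sup>2 = t\<^sup>2 / 4" by (simp add: power_divide)
    ultimately have "2 * (sin (t / 2))\<^sup>2 \<le> x\<^sup>2 + y\<^sup>2"
      using zero_le_power2[of "sin (t / 2)"] by linarith
    then show ?thesis using \<open>cos t = _\<close> by simp
  qed
  show "near_const (\<lambda>p. cos (fst p / 2 + snd p / 2)) 1" "near_const (\<lambda>p. cos (fst p / 2 - snd p / 2)) 1"
    unfolding near_const_def by (intro exI[of _ 1] conjI ballI *; linarith)+
qed

lemma near_const_sin_sq: "near_const (\<lambda>p. (sin (fst p / 2 + snd p / 2))\<^sup>2) 0"
proof -
  have "near_const (\<lambda>p. 1 - cos (fst p / 2 + snd p / 2) * cos (fst p / 2 + snd p / 2)) (1 - 1 * 1)"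
    by (intro near_const_diff near_const_mult near_const_cos near_const_const)
  then show ?thesis by (simp add: sin_squared_eq) (simp add: power2_eq_square)
qed

section \<open>A dominant real critical point\<close>

locale real_saddle =
  fixes a b \<alpha> :: real
  assumes \<alpha>: "\<alpha> \<noteq> 0" and root: "\<alpha> ^ 3 - 3 * \<alpha>\<^sup>2 + 3 * a * \<alpha> + b = 0"
    and ineq: "\<alpha>\<^sup>2 - 2 * \<alpha> + a > 0" "a < \<alpha>" "\<alpha>\<^sup>2 + 3 * a > 0"
    and zf: "zero_free a (1 / \<bar>\<alpha>\<bar>)"
begin

text \<open>Signed, so that x0 is the critical point itself and not only its modulus. Below,
  \<open>h0\<close> is the value of H at (x0, x0).\<close>

definition s where "s = 1 / \<alpha>"
definition P where "P = s"
definition Q' where "Q' = a * s\<^sup>2"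
definition R where "R = b * s ^ 3"
definition h0 where "h0 = 1 + Q' - 2 * P"
abbreviation x0 :: complex where "x0 \<equiv> of_real s"
abbreviation "W \<equiv> Wt a b x0"
abbreviation "H \<equiv> Ht a x0"

lemma cmod_x0: "cmod x0 = 1 / \<bar>\<alpha>\<bar>"
  unfolding norm_of_real by (simp add: s_def)

text \<open>The constant coefficient of the Cayley transform; it vanishes because 1/\<alpha> is a
  zero of Q(x, x, x).\<close>

lemma A0: "1 - 3 * P + 3 * Q' + R = 0"
proof -
  have "\<alpha> ^ 3 * (1 - 3 * P + 3 * Q' + R) = \<alpha> ^ 3 - 3 * \<alpha>\<^sup>2 + 3 * a * \<alpha> + b"
    using \<alpha> by (simp add: P_def Q'_def R_def s_def field_simps power2_eq_square power3_eq_cube)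
  with root \<alpha> show ?thesis by simp
qed

text \<open>Once \<open>A0\<close> is used, the other three Cayley coefficients are positive
  multiples of \<alpha>^2 - 2 \<alpha> + a, \<alpha> - a and \<alpha>^2 + 3 a. Each inequality of
  the locale gives one sign.\<close>

lemma h0_pos: "h0 > 0" and A1: "1 - P - Q' - R = 2 * h0" and A2_pos: "1 + P - Q' + R > 0"
  and A3_pos: "1 + 3 * P + 3 * Q' - R > 0"
proof -
  have "h0 = (\<alpha>\<^sup>2 - 2 * \<alpha> + a) / \<alpha>\<^sup>2"
    using \<alpha> by (simp add: h0_def P_def Q'_def s_def field_simps power2_eq_square)
  then show "h0 > 0" using ineq \<alpha> by simp
  show "1 - P - Q' - R = 2 * h0" using A0 by (simp add: h0_def)
  have "1 + P - Q' + R = 4 * (P - Q')" using A0 by simp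
  also have "P - Q' = (\<alpha> - a) / \<alpha>\<^sup>2"
    using \<alpha> by (simp add: P_def Q'_def s_def field_simps power2_eq_square)
  finally show "1 + P - Q' + R > 0" using ineq \<alpha> by simp
  have "1 + 3 * P + 3 * Q' - R = 2 * (1 + 3 * Q')" using A0 by simp
  also have "1 + 3 * Q' = (\<alpha>\<^sup>2 + 3 * a) / \<alpha>\<^sup>2"
    using \<alpha> by (simp add: Q'_def s_def field_simps power2_eq_square)
  finally show "1 + 3 * P + 3 * Q' - R > 0" using ineq \<alpha> by simp
qed

definition E where "E p = Ef P Q' R (fst p / 2) (snd p / 2)"

lemma W_E: "1 - (cmod (W p))\<^sup>2 = E p / (cmod (H p))\<^sup>2"
  using Wt_Ef[of x0 s 0 a p b] Ht_nonzero[OF zf cmod_x0] by (simp add: E_def P_def Q'_def R_def)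

text \<open>With the constant Cayley coefficient zero, \<open>E\<close> is a form in sin u cos v,
  cos u sin v and sin u sin v with positive coefficients on the squares; the only term of indefinite
  sign is the product of the first two, and it costs at most half of their squares. Hence |W| < 1
  off the origin.\<close>

lemma E_lower: "\<exists>m>0. \<forall>p\<in>torus. E p \<ge> m * ((fst p)\<^sup>2 + (snd p)\<^sup>2)"
proof (intro exI conjI ballI)
  define m where "m = (1 + P - Q' + R) * min (1 - P - Q' - R) (1 + 3 * P + 3 * Q' - R)"
  have m: "m > 0" unfolding m_def using h0_pos A1 A2_pos A3_pos by auto
  have m1: "(1 - P - Q' - R) * (1 + P - Q' + R) \<ge> m" "(1 + P - Q' + R) * (1 + 3 * P + 3 * Q' - R) \<ge> m"
    unfolding m_def using A2_pos by (auto simp: min_def mult.commute mult_le_cancel_right)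
  show "m / 72 > 0" using m by simp
  fix p :: "real \<times> real" assume p: "p \<in> torus"
  have sin_ge: "(sin (t / 2))\<^sup>2 \<ge> t\<^sup>2 / 36" if "\<bar>t\<bar> \<le> pi" for t :: real
    using sin_squared_ge[of "t / 2"] that pi_less_4 by (simp add: power_divide)
  define s1 c1 s2 c2 where "s1 = sin (fst p / 2)" "c1 = cos (fst p / 2)" "s2 = sin (snd p / 2)" "c2 = cos (snd p / 2)"
  note d = this
  have one: "s1\<^sup>2 + c1\<^sup>2 = 1" "s2\<^sup>2 + c2\<^sup>2 = 1" by (simp_all add: d)
  have "E p = (1 - P - Q' - R) * (1 + P - Q' + R) * ((s1 * c2)\<^sup>2 + (c1 * s2)\<^sup>2 + (s1 * c2) * (c1 * s2))
      + (1 + P - Q' + R) * (1 + 3 * P + 3 * Q' - R) * (s1 * s2)\<^sup>2"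
    unfolding E_def Ef_def A0 sin_add d[symmetric] by (simp add: power2_eq_square algebra_simps)
  moreover have *: "((s1 * c2)\<^sup>2 + (c1 * s2)\<^sup>2) / 2 \<le> (s1 * c2)\<^sup>2 + (c1 * s2)\<^sup>2 + (s1 * c2) * (c1 * s2)"
    using zero_le_power2[of "s1 * c2 + c1 * s2"] by (simp add: power2_sum)
  have "m * (((s1 * c2)\<^sup>2 + (c1 * s2)\<^sup>2) / 2) \<le> (1 - P - Q' - R) * (1 + P - Q' + R) * ((s1 * c2)\<^sup>2 + (c1 * s2)\<^sup>2 + (s1 * c2) * (c1 * s2))"
    using m m1 * by (intro mult_mono) auto
  moreover have "m * (s1 * s2)\<^sup>2 \<le> (1 + P - Q' + R) * (1 + 3 * P + 3 * Q' - R) * (s1 * s2)\<^sup>2"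
    using m1 by (intro mult_right_mono) auto
  ultimately have "E p \<ge> m * (((s1 * c2)\<^sup>2 + (c1 * s2)\<^sup>2) / 2) + m * (s1 * s2)\<^sup>2" by linarith
  also have "m * (((s1 * c2)\<^sup>2 + (c1 * s2)\<^sup>2) / 2) + m * (s1 * s2)\<^sup>2
      = m / 2 * (s1\<^sup>2 * (s2\<^sup>2 + c2\<^sup>2) + s2\<^sup>2 * (s1\<^sup>2 + c1\<^sup>2))"
    by (simp add: algebra_simps power_mult_distrib)
  also have "\<dots> = m / 2 * (s1\<^sup>2 + s2\<^sup>2)" by (simp add: one)
  also have "m / 2 * (s1\<^sup>2 + s2\<^sup>2) \<ge> m / 2 * ((fst p)\<^sup>2 / 36 + (snd p)\<^sup>2 / 36)"
    using m p sin_ge[of "fst p"] sin_ge[of "snd p"] by (intro mult_left_mono add_mono) (auto simp: d torus_iff)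
  finally show "m / 72 * ((fst p)\<^sup>2 + (snd p)\<^sup>2) \<le> E p" by (simp add: field_simps)
qed

abbreviation "\<psi> \<equiv> \<lambda>p :: real \<times> real. cos (fst p / 2 + snd p / 2)"
abbreviation "\<omega> \<equiv> \<lambda>p :: real \<times> real. cos (fst p / 2 - snd p / 2)"
abbreviation "\<sigma> \<equiv> \<lambda>p :: real \<times> real. sin (fst p / 2 + snd p / 2)"

text \<open>The estimate opposite to \<open>E_lower\<close>: it keeps |W|^n from decaying within
  distance of order n^(-1/2) of the origin.\<close>

lemma E_upper: "near_const E 0"
proof -
  have "E = (\<lambda>p. (1 - P - Q' - R) * (1 + P - Q' + R) * (\<sigma> p)\<^sup>2
      + ((1 - P - Q' - R) * (1/2 * (\<omega> p + \<psi> p)) - (1 + 3 * P + 3 * Q' - R) * (1/2 * (\<omega> p - \<psi> p)))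
       * (0 - (1 + P - Q' + R) * (1/2 * (\<omega> p - \<psi> p))))"
    unfolding E_def Ef_def A0 by (intro ext) (simp add: cos_add cos_diff)
  moreover have "near_const \<dots> ((1 - P - Q' - R) * (1 + P - Q' + R) * 0
      + ((1 - P - Q' - R) * (1/2 * (1 + 1)) - (1 + 3 * P + 3 * Q' - R) * (1/2 * (1 - 1)))
       * (0 - (1 + P - Q' + R) * (1/2 * (1 - 1))))"
    by (intro near_const_add near_const_mult near_const_diff near_const_const near_const_cos near_const_sin_sq)
  ultimately show ?thesis by simp
qed

(* Im (W p) = sigma p * K p / |H p|^2 vanishes to third order at the origin, as both sigma and K vanish there. *)
definition K where "K p = (\<psi> p * \<psi> p - (\<sigma> p)\<^sup>2)
     * (((P - R) * \<psi> p - 2 * Q' * \<omega> p) * (1 - Q') - ((1 + Q') * \<psi> p - 2 * P * \<omega> p) * (P + R))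
   - 2 * \<psi> p * (((P - R) * \<psi> p - 2 * Q' * \<omega> p) * ((1 + Q') * \<psi> p - 2 * P * \<omega> p) + (P + R) * (1 - Q') * (\<sigma> p)\<^sup>2)"

lemma K_near: "near_const K 0"
proof -
  have "near_const K ((1 * 1 - 0) * (((P - R) * 1 - 2 * Q' * 1) * (1 - Q') - ((1 + Q') * 1 - 2 * P * 1) * (P + R))
     - 2 * 1 * (((P - R) * 1 - 2 * Q' * 1) * ((1 + Q') * 1 - 2 * P * 1) + (P + R) * (1 - Q') * 0))"
    unfolding K_def
    by (intro near_const_add near_const_mult near_const_diff near_const_const near_const_cos near_const_sin_sq)
  moreover have "(1 * 1 - 0) * (((P - R) * 1 - 2 * Q' * 1) * (1 - Q') - ((1 + Q') * 1 - 2 * P * 1) * (P + R))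
     - 2 * 1 * (((P - R) * 1 - 2 * Q' * 1) * ((1 + Q') * 1 - 2 * P * 1) + (P + R) * (1 - Q') * 0) = 0"
  \<comment> \<open>At the origin the real parts of \<open>G1\<close> and \<open>H1\<close> are both
    \<open>h0\<close>, and 1 - Q' - (P + R) = 2 \<open>h0\<close>. Thus the two products in
    \<open>K\<close> cancel.\<close>
  proof -
    have h: "P - R - 2 * Q' = h0" "1 + Q' - 2 * P = h0" using A0 by (simp_all add: h0_def)
    have "(1 - Q') - (P + R) = 2 * h0" using A1 by simp
    have "(P - R - 2 * Q') * (1 - Q') - (1 + Q' - 2 * P) * (P + R) - 2 * ((P - R - 2 * Q') * (1 + Q' - 2 * P))
        = h0 * (1 - Q' - (P + R)) - h0 * (2 * h0)"
      unfolding h by (simp add: right_diff_distrib)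
    also have "\<dots> = 0" using \<open>(1 - Q') - (P + R) = 2 * h0\<close> by simp
    finally have "(P - R - 2 * Q') * (1 - Q') - (1 + Q' - 2 * P) * (P + R) - 2 * ((P - R - 2 * Q') * (1 + Q' - 2 * P)) = 0" .
    then show ?thesis by simp
  qed
  ultimately show ?thesis by simp
qed

lemma Im_W: "Im (W p) = \<sigma> p * K p / (cmod (H p))\<^sup>2"
proof -
  let ?u = "fst p / 2" and ?v = "snd p / 2"
  have nz: "H1 P Q' ?u ?v \<noteq> 0"
    using Ht_nonzero[OF zf cmod_x0, of p] Ht_H1[of x0 s 0 a p] by (auto simp: P_def Q'_def)
  have cm: "cmod (H p) = cmod (H1 P Q' ?u ?v)"
    using Ht_H1[of x0 s 0 a p] by (auto simp: P_def Q'_def norm_mult)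
  have "W p = cis (- (2 * (?u + ?v))) * (G1 P Q' R ?u ?v / H1 P Q' ?u ?v)"
    using Wt_G1[of x0 s 0 a b p] by (simp add: P_def Q'_def R_def algebra_simps)
  also have "G1 P Q' R ?u ?v / H1 P Q' ?u ?v = G1 P Q' R ?u ?v * cnj (H1 P Q' ?u ?v) / of_real ((cmod (H1 P Q' ?u ?v))\<^sup>2)"
    by (metis complex_div_cnj of_real_power)
  finally have "Im (W p) = Im (cis (- (2 * (?u + ?v))) * (G1 P Q' R ?u ?v * cnj (H1 P Q' ?u ?v))) / (cmod (H p))\<^sup>2"
    unfolding cm times_divide_eq_right Im_divide_of_real by simp
  also have "cis (- (2 * (?u + ?v))) = Complex (\<psi> p * \<psi> p - (\<sigma> p)\<^sup>2) (- (2 * \<sigma> p * \<psi> p))"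
    unfolding cis_cnj[symmetric] complex_eq_iff by (simp only: cnj.sel cis.sel cos_double sin_double complex.sel) (simp add: power2_eq_square)
  also have "Im (\<dots> * (G1 P Q' R ?u ?v * cnj (H1 P Q' ?u ?v))) = \<sigma> p * K p"
    unfolding G1_def H1_def K_def by (simp add: power2_eq_square algebra_simps)
  finally show ?thesis .
qed

text \<open>The inputs of Laplace's method: decay of |W| off the origin, a matching lower bound, a
  cubic bound on the phase, and a denominator bounded away from zero.\<close>

lemma W_bounds:
  obtains \<kappa> K2 C hm where "\<kappa> > 0" "K2 > 0" "C > 0" "hm > 0"
    "\<And>p. p \<in> torus \<Longrightarrow> (cmod (W p))\<^sup>2 \<le> 1 - \<kappa> * ((fst p)\<^sup>2 + (snd p)\<^sup>2)"
    "\<And>p. p \<in> torus \<Longrightarrow> (cmod (W p))\<^sup>2 \<ge> 1 - K2 * ((fst p)\<^sup>2 + (snd p)\<^sup>2)"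
    "\<And>p. p \<in> torus \<Longrightarrow> \<bar>Im (W p)\<bar> \<le> C * ((fst p)\<^sup>2 + (snd p)\<^sup>2) * sqrt ((fst p)\<^sup>2 + (snd p)\<^sup>2)"
    "\<And>p. p \<in> torus \<Longrightarrow> cmod (H p) \<ge> hm"
proof -
  obtain m where m: "m > 0" "\<And>p. p \<in> torus \<Longrightarrow> E p \<ge> m * ((fst p)\<^sup>2 + (snd p)\<^sup>2)"
    using E_lower by blast
  obtain K1 where K1: "K1 \<ge> 0" "\<And>p. p \<in> torus \<Longrightarrow> \<bar>E p\<bar> \<le> K1 * ((fst p)\<^sup>2 + (snd p)\<^sup>2)"
    using E_upper unfolding near_const_def by auto
  obtain C1 where C1: "C1 \<ge> 0" "\<And>p. p \<in> torus \<Longrightarrow> \<bar>K p\<bar> \<le> C1 * ((fst p)\<^sup>2 + (snd p)\<^sup>2)"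
    using K_near unfolding near_const_def by auto
  have ne: "torus \<noteq> {}" using torus_iff[of "(0, 0)"] by auto
  have cH: "continuous_on torus (\<lambda>p. cmod (H p))" by (intro continuous_intros)
  obtain p0 where p0: "\<And>p. p \<in> torus \<Longrightarrow> cmod (H p0) \<le> cmod (H p)"
    using continuous_attains_inf[OF compact_torus ne cH] by blast
  obtain p1 where p1: "\<And>p. p \<in> torus \<Longrightarrow> cmod (H p) \<le> cmod (H p1)"
    using continuous_attains_sup[OF compact_torus ne cH] by blast
  define hm hM where "hm = (cmod (H p0))\<^sup>2" and "hM = (cmod (H p1))\<^sup>2"
  have pos: "hm > 0" "hM > 0" using Ht_nonzero[OF zf cmod_x0] by (auto simp: hm_def hM_def)
  have hb: "hm \<le> (cmod (H p))\<^sup>2" "(cmod (H p))\<^sup>2 \<le> hM" if "p \<in> torus" for p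
    using p0[OF that] p1[OF that] by (auto simp: hm_def hM_def intro!: power_mono)
  show ?thesis
  proof (rule that)
    show "m / hM > 0" "(K1 + 1) / hm > 0" "(C1 + 1) / hm > 0" "cmod (H p0) > 0"
      using m(1) K1(1) C1(1) pos Ht_nonzero[OF zf cmod_x0] by auto
    fix p :: "real \<times> real" assume p: "p \<in> torus"
    define e where "e = (fst p)\<^sup>2 + (snd p)\<^sup>2"
    have e: "e \<ge> 0" by (simp add: e_def)
    have Hp: "(cmod (H p))\<^sup>2 > 0" using hb[OF p] pos by linarith
    show "cmod (H p) \<ge> cmod (H p0)" using p0 p by blast
    have "m / hM * e = m * e / hM" by simp
    also have "\<dots> \<le> E p / (cmod (H p))\<^sup>2"
      using m(1) m(2)[OF p] hb[OF p] Hp e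
      by (intro frac_le) (auto simp: e_def intro: order.trans[rotated, OF m(2)[OF p]])
    finally show "(cmod (W p))\<^sup>2 \<le> 1 - m / hM * ((fst p)\<^sup>2 + (snd p)\<^sup>2)"
      using W_E[of p] by (simp add: e_def)
    have "E p / (cmod (H p))\<^sup>2 \<le> ((K1 + 1) * e) / hm"
    proof (rule frac_le)
      have "\<bar>E p\<bar> \<le> K1 * e" using K1(2)[OF p] by (simp add: e_def)
      then show "E p \<le> (K1 + 1) * e" using e by (simp add: ring_distribs)
    qed (use hb[OF p] pos e K1(1) in auto)
    then show "(cmod (W p))\<^sup>2 \<ge> 1 - (K1 + 1) / hm * ((fst p)\<^sup>2 + (snd p)\<^sup>2)"
      using W_E[of p] by (simp add: e_def)
    have "\<bar>\<sigma> p\<bar> \<le> sqrt e"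
    proof -
      have "\<bar>\<sigma> p\<bar> \<le> \<bar>fst p / 2 + snd p / 2\<bar>" by (rule abs_sin_x_le_abs_x)
      also have "\<dots> \<le> sqrt e"
      proof (rule real_le_rsqrt)
        have "\<bar>fst p / 2 + snd p / 2\<bar>\<^sup>2 = (2 * e - (fst p - snd p)\<^sup>2) / 4"
          by (simp add: e_def power2_eq_square field_simps)
        also have "\<dots> \<le> e" using e zero_le_power2[of "fst p - snd p"] by (simp add: field_simps del: zero_le_power2)
        finally show "\<bar>fst p / 2 + snd p / 2\<bar>\<^sup>2 \<le> e" .
      qed
      finally show ?thesis .
    qed
    moreover have "\<bar>K p\<bar> \<le> (C1 + 1) * e"
    proof -
      have "\<bar>K p\<bar> \<le> C1 * e" using C1(2)[OF p] by (simp add: e_def)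
      then show ?thesis using e by (simp add: ring_distribs)
    qed
    ultimately have "\<bar>\<sigma> p\<bar> * \<bar>K p\<bar> \<le> sqrt e * ((C1 + 1) * e)"
      by (intro mult_mono) (use e in auto)
    then have "\<bar>\<sigma> p\<bar> * \<bar>K p\<bar> / (cmod (H p))\<^sup>2 \<le> sqrt e * ((C1 + 1) * e) / hm"
      using hb[OF p] pos e C1(1) by (intro frac_le) auto
    then show "\<bar>Im (W p)\<bar> \<le> (C1 + 1) / hm * ((fst p)\<^sup>2 + (snd p)\<^sup>2) * sqrt ((fst p)\<^sup>2 + (snd p)\<^sup>2)"
      by (simp add: Im_W abs_mult e_def mult_ac)
  qed
qed

end

text \<open>Controls the phase of w^n by |Im w| without arguments or logarithms: |z^n - 1| \<le> n
  |z - 1| for unimodular z, applied to z = w / |w|.\<close>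

lemma norm_power_minus_one_le:
  fixes w :: complex
  assumes "Re w \<ge> 1 / 2"
  shows "cmod ((w / of_real (cmod w)) ^ n - 1) \<le> n * (4 * \<bar>Im w\<bar>)"
proof -
  have w: "cmod w \<ge> 1 / 2" "Re w \<le> cmod w" using assms complex_Re_le_cmod[of w] by auto
  then have w0: "cmod w > 0" "w \<noteq> 0" by auto
  have "cmod ((w / of_real (cmod w)) ^ n - 1 ^ n) \<le> n * cmod (w / of_real (cmod w) - 1)"
    using w0 by (intro norm_power_diff) (auto simp: norm_divide)
  also have "cmod (w / of_real (cmod w) - 1) = cmod (w - of_real (cmod w)) / cmod w"
  proof -
    have "w / of_real (cmod w) - 1 = (w - of_real (cmod w)) / of_real (cmod w)"
      using w0 by (simp add: diff_divide_distrib)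
    then show ?thesis by (simp add: norm_divide)
  qed
  also have "cmod (w - of_real (cmod w)) \<le> 2 * \<bar>Im w\<bar>"
  proof -
    have "cmod w \<le> \<bar>Re w\<bar> + \<bar>Im w\<bar>" by (rule cmod_le)
    then have "\<bar>Re w - cmod w\<bar> \<le> \<bar>Im w\<bar>" using assms w by simp
    then show ?thesis using cmod_le[of "w - of_real (cmod w)"] by simp
  qed
  finally have "cmod ((w / of_real (cmod w)) ^ n - 1) \<le> n * (2 * \<bar>Im w\<bar> / cmod w)"
    using w0 by (simp add: divide_right_mono mult_left_mono)
  also have "\<dots> \<le> n * (4 * \<bar>Im w\<bar>)"
  proof -
    have "2 * \<bar>Im w\<bar> * 1 \<le> 2 * \<bar>Im w\<bar> * (2 * cmod w)" using w by (intro mult_left_mono) auto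
    then show ?thesis using w0 by (intro mult_left_mono) (auto simp: field_simps)
  qed
  finally show ?thesis .
qed

section \<open>Laplace's method at the dominant real critical point\<close>

context real_saddle
begin

lemma H_0: "H (0, 0) = of_real h0" and W_0: "W (0, 0) = 1"
proof -
  have H: "Hc a (of_real s) (of_real s) = of_real h0"
    by (simp add: Hc_def h0_def P_def Q'_def power2_eq_square)
  then show "H (0, 0) = of_real h0" by (simp add: Ht_def)
  have "of_real s * Gc a b (of_real s) (of_real s) = (of_real (P - 2 * Q' - R) :: complex)"
    by (simp add: Gc_def P_def Q'_def R_def power2_eq_square power3_eq_cube algebra_simps)
  also have "P - 2 * Q' - R = h0" using A0 by (simp add: h0_def)
  finally show "W (0, 0) = 1" using H h0_pos by (simp add: Wt_def)
qed

lemma near_0: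
  obtains d where "d > 0" "\<And>p. sqrt ((fst p)\<^sup>2 + (snd p)\<^sup>2) < d \<Longrightarrow> Re (W p) \<ge> 1 / 2 \<and> cmod (of_real h0 / H p - 1) \<le> 1 / 4"
proof -
  have "continuous_on UNIV (\<lambda>p. Re (W p))"
    by (intro continuous_intros continuous_on_Wt[OF zf cmod_x0])
  then have "((\<lambda>p. Re (W p)) \<longlongrightarrow> Re (W (0, 0))) (at (0, 0))"
    by (simp add: continuous_on_def)
  then have 1: "\<forall>\<^sub>F p in at (0, 0). Re (W p) > 1 / 2"
    unfolding W_0 by (rule order_tendstoD) simp
  have "continuous_on UNIV (\<lambda>p. cmod (of_real h0 / H p - 1))"
    using Ht_nonzero[OF zf cmod_x0] by (intro continuous_intros) auto
  then have "((\<lambda>p. cmod (of_real h0 / H p - 1)) \<longlongrightarrow> cmod (of_real h0 / H (0, 0) - 1)) (at (0, 0))"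
    by (simp add: continuous_on_def)
  moreover have "cmod (of_real h0 / H (0, 0) - 1) = 0" unfolding H_0 using h0_pos by simp
  ultimately have "((\<lambda>p. cmod (of_real h0 / H p - 1)) \<longlongrightarrow> 0) (at (0, 0))" by simp
  then have 2: "\<forall>\<^sub>F p in at (0, 0). cmod (of_real h0 / H p - 1) < 1 / 4"
    by (rule order_tendstoD(2)) simp
  from eventually_conj[OF 1 2] obtain d where d: "d > 0"
    "\<And>p. p \<noteq> (0, 0) \<Longrightarrow> dist p (0, 0) < d \<Longrightarrow> Re (W p) > 1 / 2 \<and> cmod (of_real h0 / H p - 1) < 1 / 4"
    unfolding eventually_at by blast
  show ?thesis
  proof (rule that[OF d(1)])
    fix p :: "real \<times> real" assume p: "sqrt ((fst p)\<^sup>2 + (snd p)\<^sup>2) < d"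
    show "Re (W p) \<ge> 1 / 2 \<and> cmod (of_real h0 / H p - 1) \<le> 1 / 4"
    proof (cases "p = (0, 0)")
      case True
      then show ?thesis using H_0 W_0 h0_pos by simp
    next
      case False
      moreover have "dist p (0, 0) < d" using p by (cases p) (simp add: dist_Pair_Pair)
      ultimately show ?thesis using d(2)[of p] by simp
    qed
  qed
qed

text \<open>The torus is cut at radius c0 n^(-1/3). Inside, n r^3 \<le> c0^3 keeps the phase of W^n
  small; outside, |W|^n is at most exp (- const n^(1/3)). A box of side of order n^(-1/2) already
  contributes a multiple of 1/n, which outweighs the outer error, so no limit of the integral is
  needed.\<close>

lemma eventually_positive: "\<forall>\<^sub>F n in sequentially. \<delta> a b n * (1 / \<alpha>) ^ (3 * n) > 0"
proof -
  obtain \<kappa> K2 C hm where b: "\<kappa> > 0" "K2 > 0" "C > 0" "hm > 0"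
    and b1: "\<And>p. p \<in> torus \<Longrightarrow> (cmod (W p))\<^sup>2 \<le> 1 - \<kappa> * ((fst p)\<^sup>2 + (snd p)\<^sup>2)"
    and b2: "\<And>p. p \<in> torus \<Longrightarrow> (cmod (W p))\<^sup>2 \<ge> 1 - K2 * ((fst p)\<^sup>2 + (snd p)\<^sup>2)"
    and b3: "\<And>p. p \<in> torus \<Longrightarrow> \<bar>Im (W p)\<bar> \<le> C * ((fst p)\<^sup>2 + (snd p)\<^sup>2) * sqrt ((fst p)\<^sup>2 + (snd p)\<^sup>2)"
    and b4: "\<And>p. p \<in> torus \<Longrightarrow> cmod (H p) \<ge> hm"
    by (rule W_bounds) blast
  obtain d where d: "d > 0" "\<And>p. sqrt ((fst p)\<^sup>2 + (snd p)\<^sup>2) < d \<Longrightarrow> Re (W p) \<ge> 1 / 2 \<and> cmod (of_real h0 / H p - 1) \<le> 1 / 4"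
    by (rule near_0) blast
  \<comment> \<open>Makes 4 C c0^3 \<le> 1/4, the admissible phase error in the inner
    region.\<close>
  define c0 where "c0 = min 1 (1 / (16 * C))"
  have c0: "0 < c0" "c0 \<le> 1" "C * c0 \<le> 1 / 16"
    using b(3) by (auto simp: c0_def min_def field_simps)
  \<comment> \<open>The factor \<open>h0\<close> normalises the integrand to 1 at the origin, where
    W = 1 and H = \<open>h0\<close>.\<close>
  define g where "g = (\<lambda>n p. Re (of_real h0 * (W p ^ n / H p)))"
  define err where "err = (\<lambda>n :: nat. h0 / hm * exp (- (\<kappa> * c0\<^sup>2 / 2 * real n powr (1 / 3))))"
  have W1: "cmod (W p) \<le> 1" if "p \<in> torus" for p
  proof -
    have "\<kappa> * ((fst p)\<^sup>2 + (snd p)\<^sup>2) \<ge> 0" using b(1) by (intro mult_nonneg_nonneg) auto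
    then have "(cmod (W p))\<^sup>2 \<le> 1\<^sup>2" using b1[OF that] by simp
    then show ?thesis by (rule power2_le_imp_le) simp
  qed
  have near: "g n p \<ge> 7 / 16 * cmod (W p) ^ n"
    if p: "p \<in> torus" and r: "sqrt ((fst p)\<^sup>2 + (snd p)\<^sup>2) \<le> c0 * n powr (- 1 / 3)"
      "sqrt ((fst p)\<^sup>2 + (snd p)\<^sup>2) < d" and n: "n > 0" for n p
  proof -
    define r where "r = sqrt ((fst p)\<^sup>2 + (snd p)\<^sup>2)"
    have r0: "r \<ge> 0" "(fst p)\<^sup>2 + (snd p)\<^sup>2 = r\<^sup>2" by (auto simp: r_def)
    let ?z = "(W p / of_real (cmod (W p))) ^ n" and ?h = "of_real h0 / H p"
    have W0: "Re (W p) \<ge> 1 / 2" "cmod (?h - 1) \<le> 1 / 4" using d(2)[OF r(2)] by auto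
    then have Wpos: "cmod (W p) > 0" using complex_Re_le_cmod[of "W p"] by linarith
    have "cmod (?z - 1) \<le> n * (4 * \<bar>Im (W p)\<bar>)"
      by (rule norm_power_minus_one_le[OF W0(1)])
    also have "\<dots> \<le> n * (4 * (C * r ^ 3))"
      using b3[OF p, unfolded r0(2)] r0(1) by (intro mult_left_mono) (auto simp: power3_eq_cube power2_eq_square)
    also have "\<dots> \<le> n * (4 * (C * (c0 * n powr (- 1 / 3)) ^ 3))"
      using r(1) r0(1) b(3) by (intro mult_left_mono power_mono) (auto simp: r_def)
    also have "\<dots> = 4 * C * c0 ^ 3 * (n * (n powr (- 1 / 3)) ^ 3)"
      by (simp add: power_mult_distrib)
    also have "n * (n powr (- 1 / 3)) ^ 3 = 1"
      using n by (subst powr_power) (simp_all add: powr_minus)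
    also have "4 * C * c0 ^ 3 * 1 \<le> 4 * C * c0"
      using c0 b(3) by (simp add: power3_eq_cube mult_le_one)
    also have "\<dots> \<le> 1 / 4" using c0(3) by simp
    finally have z: "cmod (?z - 1) \<le> 1 / 4" .
    have "cmod (?z * ?h - 1) = cmod ((?z - 1) * ?h + (?h - 1))" by (simp add: algebra_simps)
    also have "\<dots> \<le> cmod (?z - 1) * cmod ?h + cmod (?h - 1)"
      by (metis norm_mult norm_triangle_ineq)
    also have "\<dots> \<le> 1 / 4 * (5 / 4) + 1 / 4"
    proof -
      have "cmod ?h \<le> 5 / 4" using W0(2) norm_triangle_ineq[of "?h - 1" 1] by simp
      then show ?thesis using z W0(2) by (intro add_mono mult_mono) auto
    qed
    finally have "\<bar>Re (?z * ?h - 1)\<bar> \<le> 9 / 16" using abs_Re_le_cmod[of "?z * ?h - 1"] by linarith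
    moreover have "Re (?z * ?h - 1) = Re (?z * ?h) - 1" by simp
    ultimately have "Re (?z * ?h) \<ge> 7 / 16" by linarith
    moreover have "g n p = cmod (W p) ^ n * Re (?z * ?h)"
    proof -
      have "W p ^ n = of_real (cmod (W p) ^ n) * ?z" using Wpos by (simp add: power_divide)
      then have "of_real h0 * (W p ^ n / H p) = of_real (cmod (W p) ^ n) * (?z * ?h)" by simp
      moreover have "Re (of_real c * w) = c * Re w" for c w by simp
      ultimately show ?thesis unfolding g_def by metis
    qed
    ultimately show ?thesis
      by (metis mult.commute mult_right_mono norm_ge_zero zero_le_power)
  qed
  have far: "g n p \<ge> - err n"
    if p: "p \<in> torus" and r: "sqrt ((fst p)\<^sup>2 + (snd p)\<^sup>2) > c0 * n powr (- 1 / 3)" for n p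
  proof -
    define e where "e = (fst p)\<^sup>2 + (snd p)\<^sup>2"
    have "(c0 * n powr (- 1 / 3))\<^sup>2 \<le> (sqrt e)\<^sup>2"
      using r c0 by (intro power_mono) (auto simp: e_def)
    then have e: "c0\<^sup>2 * (n powr (- 1 / 3))\<^sup>2 \<le> e" by (simp add: power_mult_distrib e_def)
    have "(cmod (W p))\<^sup>2 \<le> 1 - \<kappa> * e" using b1[OF p] by (simp add: e_def)
    also have "\<dots> \<le> exp (- (\<kappa> * e))" using exp_ge_add_one_self[of "- (\<kappa> * e)"] by simp
    also have "\<dots> = (exp (- (\<kappa> * e / 2)))\<^sup>2" by (simp add: power2_eq_square flip: exp_add)
    finally have "cmod (W p) \<le> exp (- (\<kappa> * e / 2))" by (rule power2_le_imp_le) simp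
    then have "cmod (W p) ^ n \<le> exp (- (\<kappa> * e / 2)) ^ n" by (intro power_mono) auto
    also have "\<dots> = exp (- (\<kappa> / 2 * (n * e)))" by (simp add: exp_of_nat_mult[symmetric])
    also have "\<dots> \<le> exp (- (\<kappa> / 2 * (n * (c0\<^sup>2 * (n powr (- 1 / 3))\<^sup>2))))"
      using e b(1) by (simp add: mult_left_mono)
    also have "n * (c0\<^sup>2 * (n powr (- 1 / 3))\<^sup>2) = c0\<^sup>2 * n powr (1 / 3)"
      by (cases "n = 0") (simp_all add: powr_power powr_mult_base)
    finally have Wn: "cmod (W p) ^ n \<le> exp (- (\<kappa> * c0\<^sup>2 / 2 * n powr (1 / 3)))"
      by (simp add: mult_ac)
    have "\<bar>g n p\<bar> \<le> cmod (of_real h0 * (W p ^ n / H p))" unfolding g_def by (rule abs_Re_le_cmod)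
    also have "\<dots> = h0 * cmod (W p) ^ n / cmod (H p)"
      using h0_pos by (simp add: norm_mult norm_divide norm_power)
    also have "\<dots> \<le> h0 * exp (- (\<kappa> * c0\<^sup>2 / 2 * n powr (1 / 3))) / hm"
      using h0_pos b4[OF p] b(4) Wn by (intro frac_le mult_left_mono) auto
    finally show ?thesis by (simp add: err_def)
  qed
  have err0: "err n \<ge> 0" for n using h0_pos b(4) by (simp add: err_def)
  \<comment> \<open>On the box of this half-side |p|^2 \<le> 1 / (2 K2 n), so Bernoulli's inequality
    gives |W|^(2 n) \<ge> 1/2 there. The area of the box is 1 / (K2 n).\<close>
  define \<rho> where "\<rho> = (\<lambda>n :: nat. 1 / (2 * sqrt (K2 * n)))"
  have "\<forall>\<^sub>F n in sequentially. c0 * real n powr (- 1 / 3) < d"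
    using d(1) by real_asymp
  moreover have "\<forall>\<^sub>F n in sequentially. sqrt 2 * (1 / (2 * sqrt (K2 * real n))) \<le> c0 * real n powr (- 1 / 3)"
    using c0(1) b(2) by real_asymp
  moreover have "\<forall>\<^sub>F n in sequentially. 1 / (2 * sqrt (K2 * real n)) \<le> pi"
    using b(2) by real_asymp
  moreover have "\<forall>\<^sub>F n in sequentially. h0 / hm * exp (- (\<kappa> * c0\<^sup>2 / 2 * real n powr (1 / 3))) * (4 * pi\<^sup>2) < 7 / 32 * (1 / (K2 * real n))"
    using c0(1) b h0_pos by real_asymp
  moreover have "\<forall>\<^sub>F n in sequentially. n > (0 :: nat)" by (rule eventually_gt_at_top)
  ultimately show ?thesis
  proof eventually_elim
    case (elim n)
    note n = elim[folded \<rho>_def]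
    have r0: "\<rho> n \<ge> 0" by (simp add: \<rho>_def b(2) less_imp_le)
    have \<rho>2: "(\<rho> n)\<^sup>2 = 1 / (4 * K2 * n)" using b(2) by (simp add: \<rho>_def power_divide power_mult_distrib)
    have lower: "g n p \<ge> - err n" if p: "p \<in> torus" for p
    proof (cases "sqrt ((fst p)\<^sup>2 + (snd p)\<^sup>2) \<le> c0 * n powr (- 1 / 3)")
      case True
      then have "g n p \<ge> 7 / 16 * cmod (W p) ^ n" using n(1,5) by (intro near[OF p]) auto
      moreover have "7 / 16 * cmod (W p) ^ n \<ge> 0" by simp
      ultimately show ?thesis using err0[of n] by linarith
    next
      case False
      then show ?thesis by (intro far[OF p]) auto
    qed
    let ?U = "cbox (- \<rho> n, - \<rho> n) (\<rho> n, \<rho> n) :: (real \<times> real) set"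
    have sub: "?U \<subseteq> torus" using n(3) unfolding torus_def \<rho>_def by (auto simp: subset_iff)
    have core: "g n p \<ge> 7 / 32" if p: "p \<in> ?U" for p
    proof -
      have pt: "p \<in> torus" using p sub by auto
      have "(fst p)\<^sup>2 \<le> (\<rho> n)\<^sup>2" "(snd p)\<^sup>2 \<le> (\<rho> n)\<^sup>2"
        using p by (cases p; auto simp: abs_le_square_iff[symmetric] abs_le_iff)+
      then have e: "(fst p)\<^sup>2 + (snd p)\<^sup>2 \<le> 2 * (\<rho> n)\<^sup>2" by simp
      then have "sqrt ((fst p)\<^sup>2 + (snd p)\<^sup>2) \<le> sqrt 2 * \<rho> n"
        using real_sqrt_le_mono[OF e] r0 by (simp add: real_sqrt_mult)
      also have "\<dots> \<le> c0 * n powr (- 1 / 3)" using n(2) by (simp add: \<rho>_def)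
      finally have "g n p \<ge> 7 / 16 * cmod (W p) ^ n" using n(1,5) by (intro near[OF pt]) auto
      moreover have "cmod (W p) ^ n \<ge> 1 / 2"
      proof -
        have x: "- (K2 * (2 * (\<rho> n)\<^sup>2)) \<ge> - 1" using b(2) n(5) by (simp add: \<rho>2 field_simps)
        have "1 / 2 = 1 + n * (- (K2 * (2 * (\<rho> n)\<^sup>2)))" using b(2) n(5) by (simp add: \<rho>2)
        also have "\<dots> \<le> (1 + - (K2 * (2 * (\<rho> n)\<^sup>2))) ^ n" by (rule Bernoulli_inequality[OF x])
        also have "\<dots> \<le> ((cmod (W p))\<^sup>2) ^ n"
        proof (rule power_mono)
          have "K2 * ((fst p)\<^sup>2 + (snd p)\<^sup>2) \<le> K2 * (2 * (\<rho> n)\<^sup>2)" using e b(2) by (intro mult_left_mono) auto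
          then show "1 + - (K2 * (2 * (\<rho> n)\<^sup>2)) \<le> (cmod (W p))\<^sup>2" using b2[OF pt] by linarith
        qed (use x in simp)
        also have "\<dots> \<le> cmod (W p) ^ n"
          using W1[OF pt] by (intro power_mono) (auto simp: power2_eq_square mult_left_le_one_le)
        finally show ?thesis .
      qed
      ultimately show ?thesis by linarith
    qed
    have cg: "continuous_on S (\<lambda>p. of_real h0 * (W p ^ n / H p))" for S
      using Ht_nonzero[OF zf cmod_x0] by (intro continuous_intros continuous_on_Wt[OF zf cmod_x0]) auto
    have cg': "continuous_on S (g n)" for S unfolding g_def by (intro continuous_intros cg)
    have gi: "(\<lambda>p. g n p + err n) integrable_on torus" "(\<lambda>p. g n p + err n) integrable_on ?U" "g n integrable_on torus"
      unfolding torus_def by (intro integrable_continuous continuous_intros cg')+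
    have "7 / 32 * (1 / (K2 * n)) = integral ?U (\<lambda>p. 7 / 32)"
      using r0 \<rho>2 b(2) by (simp add: content_Pair power2_eq_square)
    also have "\<dots> \<le> integral ?U (\<lambda>p. g n p + err n)"
      using core err0[of n] by (intro integral_le gi) (auto intro!: add_increasing2)
    also have "\<dots> \<le> integral torus (\<lambda>p. g n p + err n)"
    proof (intro integral_subset_le sub gi ballI)
      show "0 \<le> g n p + err n" if "p \<in> torus" for p using lower[OF that] by linarith
    qed
    also have "\<dots> = integral torus (g n) + err n * (4 * pi\<^sup>2)"
    proof -
      have "integral torus (\<lambda>p. err n) = err n * (4 * pi\<^sup>2)"
        unfolding torus_def by (simp add: content_Pair power2_eq_square)
      then show ?thesis using gi(3) by (subst integral_add) (auto simp: torus_def)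
    qed
    finally have "integral torus (g n) > 0" using n(4) by (simp add: err_def)
    also have "integral torus (g n) = Re (of_real h0 * integral torus (\<lambda>p. W p ^ n / H p))"
      unfolding g_def by (subst integral_Re_torus[OF cg]) (simp only: integral_mult_right)
    also have "\<dots> = 4 * pi\<^sup>2 * h0 * (\<delta> a b n * (1 / \<alpha>) ^ (3 * n))"
      unfolding delta_integral[OF zf cmod_x0, symmetric]
      by (simp add: s_def flip: of_real_power of_real_mult)
    finally have "4 * pi\<^sup>2 * h0 * (\<delta> a b n * (1 / \<alpha>) ^ (3 * n)) > 0" .
    moreover have "4 * pi\<^sup>2 * h0 > 0" using h0_pos by simp
    ultimately show ?case by (rule zero_less_mult_pos)
  qed
qed

end

section \<open>Criterion for oscillation and the case of three critical points of equal modulus\<close>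

lemma Wt_le_1:
  assumes zf: "zero_free a \<rho>" and Ef: "\<And>u v. Ef \<rho> (a * \<rho>\<^sup>2) (b * \<rho> ^ 3) u v \<ge> 0" and x: "cmod x = \<rho>"
  shows "cmod (Wt a b x p) \<le> 1"
proof -
  have "x = of_real \<rho> * cis (Arg x)" using rcis_cmod_Arg[of x] x by (simp add: rcis_def)
  have "1 - (cmod (Wt a b x p))\<^sup>2 \<ge> 0"
    unfolding Wt_Ef[OF \<open>x = _\<close> Ht_nonzero[OF zf x], of b p] by (intro divide_nonneg_nonneg Ef zero_le_power2)
  then have "(cmod (Wt a b x p))\<^sup>2 \<le> 1" by simp
  then show ?thesis using power2_le_imp_le[of "cmod (Wt a b x p)" 1] by simp
qed

text \<open>The bound m keeps the generating function bounded along the positive axis, and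
  \<open>ub\<close> makes it diverge in the direction of (x1 / \<rho>)^3. Only the cube matters,
  since the coefficients come with x0^(3 n).\<close>

lemma oscillation_criterion:
  assumes zf: "zero_free a \<rho>"
    and W: "\<And>x p. cmod x = \<rho> \<Longrightarrow> cmod (Wt a b x p) \<le> 1"
    and m: "m > 0" "\<And>\<tau> p. 0 < \<tau> \<Longrightarrow> \<tau> < 1 \<Longrightarrow> p \<in> torus \<Longrightarrow> cmod (Qt a b (of_real \<rho>) \<tau> p) \<ge> m"
    and x1: "cmod x1 = \<rho>"
    and ub: "\<And>M. \<exists>\<tau>. 0 < \<tau> \<and> \<tau> < 1 \<and> M < cmod (integral torus (\<lambda>p. 1 / Qt a b x1 \<tau> p))"
  shows "infinite {n. \<delta> a b n > 0} \<and> infinite {n. \<delta> a b n < 0}"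
proof -
  have \<rho>: "\<rho> > 0" using zf by (simp add: zero_free_def)
  define f where "f = (\<lambda>n. 4 * pi\<^sup>2 * \<delta> a b n * \<rho> ^ (3 * n))"
  define \<zeta> where "\<zeta> = (x1 / of_real \<rho>) ^ 3"
  have sums: "(\<lambda>n. of_real (f n) * (x / of_real \<rho>) ^ (3 * n) * of_real \<tau> ^ n) sums integral torus (\<lambda>p. 1 / Qt a b x \<tau> p)"
    if "cmod x = \<rho>" "0 < \<tau>" "\<tau> < 1" for x \<tau>
  proof -
    have "of_real (f n) * (x / of_real \<rho>) ^ (3 * n) = of_real (4 * pi\<^sup>2 * \<delta> a b n) * x ^ (3 * n)" for n
      using \<rho> by (simp add: f_def power_divide)
    then show ?thesis using delta_gf_integral[OF zf that(1) W[OF that(1)], of \<tau>] that by simp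
  qed
  have r: "(\<lambda>n. of_real (f n * \<tau> ^ n)) sums integral torus (\<lambda>p. 1 / Qt a b (of_real \<rho>) \<tau> p)"
    if "0 < \<tau>" "\<tau> < 1" for \<tau>
    using sums[of "of_real \<rho>" \<tau>] that \<rho> by simp
  have "infinite {n. f n > 0} \<and> infinite {n. f n < 0}"
  proof (rule sign_changes)
    fix \<tau> :: real assume \<tau>: "0 < \<tau>" "\<tau> < 1"
    from r[OF \<tau>] show sm: "summable (\<lambda>n. f n * \<tau> ^ n)"
      using summable_complex_of_real sums_summable by blast
    have "\<bar>\<Sum>n. f n * \<tau> ^ n\<bar> = cmod (integral torus (\<lambda>p. 1 / Qt a b (of_real \<rho>) \<tau> p))"
      using sums_unique[OF r[OF \<tau>]] suminf_of_real[OF sm, where ?'a = complex] by (metis norm_of_real)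
    also have "\<dots> \<le> 1 / m * measure lborel (cbox (-pi, -pi) (pi, pi) :: (real \<times> real) set)"
      unfolding torus_def
    proof (rule integrable_bound)
      have nz: "Qt a b (of_real \<rho>) \<tau> p \<noteq> 0" for p
        using Qt_nonzero[OF zf _ W] \<tau> \<rho> by auto
      then show "(\<lambda>p. 1 / Qt a b (of_real \<rho>) \<tau> p) integrable_on cbox (-pi, -pi) (pi, pi)"
        by (intro integrable_continuous continuous_intros) auto
      show "cmod (1 / Qt a b (of_real \<rho>) \<tau> p) \<le> 1 / m" if "p \<in> cbox (-pi, -pi) (pi, pi)" for p
        using m(2)[OF \<tau>, of p] m(1) nz[of p] that by (simp add: torus_def norm_divide frac_le)
    qed (use m in auto)
    finally show "\<bar>\<Sum>n. f n * \<tau> ^ n\<bar> \<le> 1 / m * measure lborel (cbox (-pi, -pi) (pi, pi) :: (real \<times> real) set)" .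
  next
    show "cmod \<zeta> = 1" using x1 \<rho> by (simp add: \<zeta>_def norm_power norm_divide)
    show "\<exists>\<tau>>0. \<tau> < 1 \<and> M < cmod (\<Sum>n. of_real (f n) * \<zeta> ^ n * of_real \<tau> ^ n)" for M
    proof -
      from ub[of M] obtain \<tau> where \<tau>: "0 < \<tau>" "\<tau> < 1" "M < cmod (integral torus (\<lambda>p. 1 / Qt a b x1 \<tau> p))"
        by blast
      from sums_unique[OF sums[OF x1 \<tau>(1,2)]] \<tau> show ?thesis by (auto simp: \<zeta>_def power_mult)
    qed
  qed
  moreover have "f n > 0 \<longleftrightarrow> \<delta> a b n > 0" "f n < 0 \<longleftrightarrow> \<delta> a b n < 0" for n
    using \<rho> by (simp_all add: f_def zero_less_mult_iff mult_less_0_iff)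
  ultimately show ?thesis by simp
qed

section \<open>Q on the torus as a function of the trace, and the tie of three moduli\<close>

lemma Qt_expand:
  fixes p :: "real \<times> real"
  defines "X \<equiv> cis (fst p)" and "Y \<equiv> cis (snd p)" and "Z \<equiv> cis (- fst p - snd p)"
  shows "Qt a b x0 \<tau> p = 1 - x0 * (X + Y + of_real \<tau> * Z)
    + of_real a * x0\<^sup>2 * (cnj Z + of_real \<tau> * (cnj X + cnj Y)) + of_real b * of_real \<tau> * x0 ^ 3"
proof -
  have Z: "cis (- fst p) * cis (- snd p) = Z" by (simp add: Z_def cis_mult)
  have c: "X * Y = cnj Z" "Z * X = cnj Y" "Z * Y = cnj X" by (simp_all add: X_def Y_def Z_def cis_mult cis_cnj add.commute)
  have "Z * (X * Y) = 1" by (simp add: X_def Y_def Z_def cis_mult)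
  moreover have "Qt a b x0 \<tau> p = 1 - x0 * (X + Y + of_real \<tau> * Z)
    + of_real a * x0\<^sup>2 * (X * Y + of_real \<tau> * (Z * Y + Z * X)) + of_real b * of_real \<tau> * x0 ^ 3 * (Z * (X * Y))"
    unfolding Qt_def Ht_def Hc_def Gc_def Z mult.assoc[of x0 "cis (- fst p)"] X_def[symmetric] Y_def[symmetric]
    by (simp add: algebra_simps power2_eq_square power3_eq_cube)
  ultimately show ?thesis unfolding c by simp
qed

(* The trace X + Y + Z with XYZ = 1: since XY + XZ + YZ is its conjugate, Q depends on it alone. *)
definition chi :: "real \<times> real \<Rightarrow> complex" where
  "chi p = cis (fst p) + cis (snd p) + cis (- fst p - snd p)"

lemma Re_chi: "Re (chi p) = cos (fst p) + cos (snd p) + cos (fst p + snd p)"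
  by (simp add: chi_def) (metis cos_minus minus_add_distrib diff_conv_add_uminus)

lemma Im_chi: "Im (chi p) = sin (fst p) + sin (snd p) - sin (fst p + snd p)"
proof -
  have "sin (- fst p - snd p) = - sin (fst p + snd p)" by (metis sin_minus minus_add_distrib diff_conv_add_uminus)
  then show ?thesis by (simp add: chi_def)
qed

text \<open>In half angles Im chi = 4 sin u sin v sin (u + v). It is cubic at the origin and
  vanishes along whole lines such as y = 0.\<close>

lemma Im_chi_le: "\<bar>Im (chi p)\<bar> \<le> \<bar>fst p\<bar> * \<bar>snd p\<bar> * (\<bar>fst p\<bar> + \<bar>snd p\<bar>) / 2"
proof -
  define u v where "u = fst p / 2" "v = snd p / 2"
  have "Im (chi p) = sin (2 * u) + sin (2 * v) - sin (2 * (u + v))"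
    by (simp add: Im_chi u_v_def)
  also have "\<dots> = 4 * sin u * sin v * sin (u + v)"
  proof -
    have "sin (2 * u) + sin (2 * v) - sin (2 * (u + v)) - 4 * sin u * sin v * sin (u + v)
      = 2 * sin u * cos u * (1 - (sin v)\<^sup>2 - (cos v)\<^sup>2) + 2 * sin v * cos v * (1 - (sin u)\<^sup>2 - (cos u)\<^sup>2)"
      unfolding sin_double sin_add cos_add by algebra
    also have "\<dots> = 0" by (simp add: diff_diff_eq)
    finally show ?thesis by simp
  qed
  finally have "\<bar>Im (chi p)\<bar> = 4 * (\<bar>sin u\<bar> * \<bar>sin v\<bar> * \<bar>sin (u + v)\<bar>)" by (simp add: abs_mult)
  also have "\<dots> \<le> 4 * (\<bar>u\<bar> * \<bar>v\<bar> * \<bar>u + v\<bar>)"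
    by (intro mult_left_mono mult_mono abs_sin_x_le_abs_x) auto
  also have "\<dots> \<le> 4 * (\<bar>u\<bar> * \<bar>v\<bar> * (\<bar>u\<bar> + \<bar>v\<bar>))"
    by (intro mult_left_mono abs_triangle_ineq) auto
  finally show ?thesis by (simp add: u_v_def field_simps)
qed

lemma Qt_1_chi: "Qt a b x0 1 p = 1 - x0 * chi p + of_real a * x0\<^sup>2 * cnj (chi p) + of_real b * x0 ^ 3"
  unfolding Qt_expand chi_def by (simp add: algebra_simps)

lemma Re_one_divide: "Re (1 / z) = Re z / (cmod z)\<^sup>2"
  by (simp add: Re_divide cmod_power2)

text \<open>The roots in 1/x are a and a conjugate pair, all of modulus |a|, and |W| = 1 on the
  whole torus. Through x0 = \<rho> there is still no zero of Q, because 3 \<rho> < 1. Through x0 =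
  -\<rho>, Q vanishes along the curves Im chi = 0 rather than at isolated points; the divergence is
  found in a strip along one of these curves, close to their crossing at the origin.\<close>

lemma oscillation_tie:
  assumes a: "a < - 3"
  shows "infinite {n. \<delta> a (- (a ^ 3)) n > 0} \<and> infinite {n. \<delta> a (- (a ^ 3)) n < 0}"
proof -
  define R where "R = - a"
  have R: "R > 3" "a = - R" "- (a ^ 3) = R ^ 3" using a by (auto simp: R_def)
  define \<rho> where "\<rho> = 1 / R"
  have \<rho>: "\<rho> > 0" "a * \<rho>\<^sup>2 = - \<rho>" "- (a ^ 3) * \<rho> ^ 3 = 1"
    using R by (auto simp: \<rho>_def power2_eq_square power3_eq_cube)
  have \<rho>3: "\<rho> < 1 / 3" using R by (simp add: \<rho>_def field_simps)
  have zf: "zero_free a \<rho>" unfolding zero_free_def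
  proof (intro conjI ballI)
    fix t assume t: "t \<in> {0..\<rho>}"
    have "a * t\<^sup>2 \<le> 0" using R by (simp add: mult_le_0_iff)
    then show "a * t\<^sup>2 < 1" by simp
    have "R * t\<^sup>2 \<le> R * \<rho>\<^sup>2" using t R by (intro mult_left_mono power_mono) auto
    also have "\<dots> = \<rho>" using \<rho>(2) R(2) by simp
    finally have "a * t\<^sup>2 \<ge> - \<rho>" using R(2) by simp
    then show "1 - 2 * t + a * t\<^sup>2 > 0" using t \<rho>3 by auto
  qed (use \<rho> in auto)
  have Q: "Qt a (- (a ^ 3)) (of_real x) \<tau> p = 1 - of_real x * (cis (fst p) + cis (snd p) + of_real \<tau> * cis (- fst p - snd p))
      - of_real \<rho> * (cnj (cis (- fst p - snd p)) + of_real \<tau> * (cnj (cis (fst p)) + cnj (cis (snd p)))) + of_real (x / \<rho> * \<tau>)"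
    if "x = \<rho> \<or> x = - \<rho>" for x \<tau> p
  proof -
    have "of_real a * (of_real x)\<^sup>2 = (of_real (a * x\<^sup>2) :: complex)" by simp
    also have "a * x\<^sup>2 = - \<rho>" using that \<rho>(2) by auto
    finally have 1: "of_real a * (of_real x)\<^sup>2 = (- of_real \<rho> :: complex)" by simp
    have "of_real (- (a ^ 3)) * of_real \<tau> * (of_real x) ^ 3 = (of_real (- (a ^ 3) * x ^ 3 * \<tau>) :: complex)" by simp
    also have "- (a ^ 3) * x ^ 3 = x / \<rho>" using that \<rho>(1,3) by auto
    finally show ?thesis unfolding Qt_expand 1 by simp
  qed
  show ?thesis
  proof (rule oscillation_criterion[OF zf])
    show "cmod (Wt a (- (a ^ 3)) x p) \<le> 1" if "cmod x = \<rho>" for x p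
      using zf _ that
    proof (rule Wt_le_1)
      have "a ^ 3 * \<rho> ^ 3 = - 1" using \<rho>(3) by simp
      \<comment> \<open>With p = \<rho>, q = -\<rho>, r = 1, both 1 - p - q - r and 1 + 3 p + 3 q -
        r vanish, so the form is identically zero.\<close>
      then show "Ef \<rho> (a * \<rho>\<^sup>2) (- (a ^ 3) * \<rho> ^ 3) u v \<ge> 0" for u v by (simp add: Ef_def \<rho>)
    qed
    show "1 - 3 * \<rho> > 0" using \<rho>3 by simp
    show "1 - 3 * \<rho> \<le> cmod (Qt a (- (a ^ 3)) (of_real \<rho>) \<tau> p)" if \<tau>: "0 < \<tau>" "\<tau> < 1" for \<tau> p
    proof -
      let ?A = "cis (fst p) + cis (snd p) + of_real \<tau> * cis (- fst p - snd p)"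
      let ?B = "cnj (cis (- fst p - snd p)) + of_real \<tau> * (cnj (cis (fst p)) + cnj (cis (snd p)))"
      have "cmod ?A \<le> 1 + 1 + \<tau> * 1"
        using \<tau> by (intro norm_triangle_le add_mono) (auto simp: norm_mult)
      moreover have "cmod ?B \<le> 1 + \<tau> * (1 + 1)"
        using \<tau> unfolding norm_mult norm_of_real
        by (intro norm_triangle_le add_mono) (auto simp: norm_mult intro!: mult_left_mono norm_triangle_le)
      ultimately have "Re (of_real \<rho> * (?A + ?B)) \<le> \<rho> * (3 + 3 * \<tau>)"
        using \<rho>(1) complex_Re_le_cmod[of "?A + ?B"] norm_triangle_ineq[of ?A ?B] by simp
      moreover have "Qt a (- (a ^ 3)) (of_real \<rho>) \<tau> p = of_real (1 + \<tau>) - of_real \<rho> * (?A + ?B)"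
        using Q[of \<rho> \<tau> p] \<rho>(1) by (simp add: algebra_simps)
      ultimately have "Re (Qt a (- (a ^ 3)) (of_real \<rho>) \<tau> p) \<ge> (1 + \<tau>) - \<rho> * (3 + 3 * \<tau>)"
        by simp
      also have "(1 + \<tau>) - \<rho> * (3 + 3 * \<tau>) = (1 - 3 * \<rho>) * (1 + \<tau>)" by (simp add: algebra_simps)
      finally have "Re (Qt a (- (a ^ 3)) (of_real \<rho>) \<tau> p) \<ge> (1 - 3 * \<rho>) * (1 + \<tau>)" .
      moreover have "(1 - 3 * \<rho>) * (1 + \<tau>) \<ge> 1 - 3 * \<rho>" using \<rho>3 \<tau> by (simp add: mult_le_cancel_left1)
      ultimately show ?thesis using complex_Re_le_cmod by (meson order.trans)
    qed
    show "cmod (of_real (- \<rho>)) = \<rho>" using \<rho> by simp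
    fix M :: real
    define c where "c = 1 - 3 * \<rho>"
    have c: "c > 0" using \<rho>3 by (simp add: c_def)
    \<comment> \<open>The 10 is 5 times 2: |Q|^2 \<le> 5 \<epsilon>^2 on the box chosen below, whose
      area is \<epsilon> / (2 \<eta>). The choice of \<epsilon> gives that box height \<eta> /
      2.\<close>
    define \<eta> where "\<eta> = min 1 (c / (10 * (\<bar>M\<bar> + 1)))"
    define \<epsilon> where "\<epsilon> = \<eta> ^ 3 / 2"
    have \<eta>: "0 < \<eta>" "\<eta> \<le> 1" "c / (10 * \<eta>) > M"
    proof -
      show "0 < \<eta>" "\<eta> \<le> 1" using c by (auto simp: \<eta>_def)
      have "\<eta> \<le> c / (10 * (\<bar>M\<bar> + 1))" by (simp add: \<eta>_def)
      then have "\<bar>M\<bar> + 1 \<le> c / (10 * \<eta>)" using \<open>0 < \<eta>\<close> by (simp add: field_simps)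
      then show "c / (10 * \<eta>) > M" by linarith
    qed
    have \<epsilon>: "0 < \<epsilon>" "\<epsilon> < 1" "\<epsilon> / \<eta>\<^sup>2 \<le> \<eta>"
      using \<eta> power_le_one[of \<eta> 3] by (auto simp: \<epsilon>_def field_simps power2_eq_square power3_eq_cube)
    let ?q = "Qt a (- (a ^ 3)) (of_real (- \<rho>)) (1 - \<epsilon>)"
    have reQ: "Re (?q p) = \<epsilon> * (1 + \<rho> * (cos (fst p) + cos (snd p) - cos (fst p + snd p)))" for p
      unfolding Q[of "- \<rho>", OF disjI2[OF refl]] using \<rho>(1) cos_minus[of "fst p + snd p"]
      by (simp add: algebra_simps del: cos_minus)
    have imQ: "Im (?q p) = \<rho> * (2 - \<epsilon>) * Im (chi p)" for p
      unfolding Q[of "- \<rho>", OF disjI2[OF refl]] Im_chi using \<rho>(1) sin_minus[of "fst p + snd p"]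
      by (simp add: algebra_simps del: sin_minus)
    have re_bounds: "c * \<epsilon> \<le> Re (?q p)" "Re (?q p) \<le> 2 * \<epsilon>" for p
    proof -
      let ?C = "cos (fst p) + cos (snd p) - cos (fst p + snd p)"
      have "\<bar>?C\<bar> \<le> 3"
        using abs_cos_le_one[of "fst p"] abs_cos_le_one[of "snd p"] abs_cos_le_one[of "fst p + snd p"] by linarith
      then have "\<bar>\<rho> * ?C\<bar> \<le> \<rho> * 3" using \<rho>(1) by (simp add: abs_mult)
      then have "c \<le> 1 + \<rho> * ?C" "1 + \<rho> * ?C \<le> 2" using \<rho>3 by (auto simp: c_def abs_le_iff)
      then show "c * \<epsilon> \<le> Re (?q p)" "Re (?q p) \<le> 2 * \<epsilon>" unfolding reQ using \<epsilon>(1) by auto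
    qed
    have re0: "0 \<le> Re (?q p)" for p using re_bounds(1)[of p] mult_pos_pos[OF c \<epsilon>(1)] by linarith
    have nz: "?q p \<noteq> 0" for p
      using re_bounds(1)[of p] c \<epsilon> by (metis mult_pos_pos not_less zero_complex.sel(1))
    \<comment> \<open>A strip along the zero line y = 0. Its height makes |Im chi| \<le> \<epsilon>,
      so real and imaginary part of Q are both of order \<epsilon>.\<close>
    let ?U = "cbox (\<eta> / 2, 0) (\<eta>, \<epsilon> / \<eta>\<^sup>2) :: (real \<times> real) set"
    have sub: "?U \<subseteq> torus"
      using \<eta> \<epsilon> pi_gt3 unfolding torus_def by (auto simp: subset_iff)
    have cont: "continuous_on S (\<lambda>p. 1 / ?q p)" for S
      using nz by (intro continuous_intros) auto
    have cont': "continuous_on S (\<lambda>p. Re (1 / ?q p))" for S by (intro continuous_intros cont)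
    have low: "c / (5 * \<epsilon>) \<le> Re (1 / ?q p)" if p: "p \<in> ?U" for p
    proof -
      obtain x y where xy: "p = (x, y)" "0 \<le> x" "x \<le> \<eta>" "0 \<le> y" "y \<le> \<epsilon> / \<eta>\<^sup>2"
        using p \<eta>(1) by (cases p) auto
      have "\<bar>Im (chi p)\<bar> \<le> x * y * (x + y) / 2" using Im_chi_le[of p] xy by simp
      also have "\<dots> \<le> \<eta> * (\<epsilon> / \<eta>\<^sup>2) * (\<eta> + \<eta>) / 2"
        using xy \<eta> \<epsilon> by (intro divide_right_mono mult_mono add_mono) auto
      also have "\<dots> = \<epsilon>" using \<eta>(1) by (simp add: power2_eq_square)
      finally have "\<rho> * (2 - \<epsilon>) * \<bar>Im (chi p)\<bar> \<le> \<rho> * (2 - \<epsilon>) * \<epsilon>"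
        using \<rho>(1) \<epsilon> by (intro mult_left_mono) auto
      moreover have "\<bar>Im (?q p)\<bar> = \<rho> * (2 - \<epsilon>) * \<bar>Im (chi p)\<bar>"
        unfolding imQ using \<rho>(1) \<epsilon> by (simp add: abs_mult)
      ultimately have "\<bar>Im (?q p)\<bar> \<le> \<rho> * (2 - \<epsilon>) * \<epsilon>" by simp
      also have "\<dots> \<le> 1 * \<epsilon>"
        using \<rho>(1) \<rho>3 \<epsilon> mult_mono[of \<rho> "1/3" "2 - \<epsilon>" 2] by (intro mult_right_mono) auto
      finally have "(Im (?q p))\<^sup>2 \<le> \<epsilon>\<^sup>2" using \<epsilon>(1) by (simp add: abs_le_square_iff[symmetric])
      moreover have "(Re (?q p))\<^sup>2 \<le> (2 * \<epsilon>)\<^sup>2"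
        using re_bounds(2) re0 by (intro power_mono) auto
      ultimately have "(cmod (?q p))\<^sup>2 \<le> 5 * \<epsilon>\<^sup>2" by (simp add: cmod_power2 power_mult_distrib)
      moreover have "(cmod (?q p))\<^sup>2 > 0" using nz by simp
      ultimately have "c * \<epsilon> / (5 * \<epsilon>\<^sup>2) \<le> Re (?q p) / (cmod (?q p))\<^sup>2"
        by (intro frac_le re_bounds(1) re0)
      then show ?thesis using \<epsilon>(1) unfolding Re_one_divide by (simp add: power2_eq_square)
    qed
    have "c / (10 * \<eta>) = integral ?U (\<lambda>p. c / (5 * \<epsilon>))"
      using \<eta> \<epsilon> by (simp add: content_Pair power2_eq_square)
    also have "\<dots> \<le> integral ?U (\<lambda>p. Re (1 / ?q p))"
      using low by (intro integral_le integrable_continuous cont') auto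
    also have "\<dots> \<le> integral torus (\<lambda>p. Re (1 / ?q p))"
    proof (intro integral_subset_le sub ballI)
      show "Re (1 / ?q p) \<ge> 0" for p
        unfolding Re_one_divide by (intro divide_nonneg_nonneg re0 zero_le_power2)
    qed (unfold torus_def, (intro integrable_continuous cont')+)
    also have "\<dots> = Re (integral torus (\<lambda>p. 1 / ?q p))"
      by (rule integral_Re_torus[OF cont])
    also have "\<dots> \<le> cmod (integral torus (\<lambda>p. 1 / ?q p))" by (rule complex_Re_le_cmod)
    finally have "M < cmod (integral torus (\<lambda>p. 1 / ?q p))" using \<eta>(3) by linarith
    then show "\<exists>\<tau>>0. \<tau> < 1 \<and> M < cmod (integral torus (\<lambda>p. 1 / Qt a (- (a ^ 3)) (of_real (- \<rho>)) \<tau> p))"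
      using \<epsilon> by (intro exI[of _ "1 - \<epsilon>"]) auto
  qed
qed

section \<open>A dominant pair of complex conjugate critical points\<close>

lemma sin_half_diff_zero:
  assumes "sin ((s - t) / 2) = 0"
  shows "cis s = cis t"
proof -
  have e: "2 * ((s - t) / 2) = s - t" by simp
  have "cos (s - t) = 1" "sin (s - t) = 0"
    using assms cos_double_sin[of "(s - t) / 2"] sin_double[of "(s - t) / 2"] unfolding e by simp_all
  then have "cis (s - t) = 1" by (simp add: complex_eq_iff)
  then have "cis t * cis (s - t) = cis t" by simp
  then show ?thesis by (simp add: cis_mult)
qed

lemma cis_eq_1:
  assumes "cis t = 1" "\<bar>t\<bar> \<le> pi"
  shows "t = 0"
proof -
  have "cos t = 1" using assms(1) by (simp add: complex_eq_iff)
  then have "cos \<bar>t\<bar> = cos 0" by simp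
  then show ?thesis using cos_inj_pi[of "\<bar>t\<bar>" 0] assms(2) by simp
qed

(* The symmetry of Q in y and z transfers statements about X and Y to X and Z. *)
lemma Qt_1_swap: "Qt a b x0 1 (fst p, - fst p - snd p) = Qt a b x0 1 p"
  unfolding Qt_1_chi chi_def by (simp add: algebra_simps)

text \<open>Parametrised by the real root \<gamma>, from which \<open>b\<close> is computed. The
  other two roots have sum 3 - \<gamma> and product \<gamma>^2 - 3 \<gamma> + 3 a. The first
  hypothesis says that this product exceeds \<gamma>^2, the second that these roots are not
  real.\<close>

locale complex_pair =
  fixes a \<gamma> :: real
  assumes \<gamma>: "\<gamma> < a" "(\<gamma> - 1)\<^sup>2 > 4 * (1 - a)"
begin

definition b where "b = - (\<gamma> ^ 3) + 3 * \<gamma>\<^sup>2 - 3 * a * \<gamma>"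
text \<open>The sum of the conjugate pair. Then \<open>r\<close> is its modulus, h + i y the root
  \<alpha> in the upper half plane, and x1 = 1/\<alpha> the corresponding zero of Q(x, x, x), of
  modulus \<rho>.\<close>

definition \<sigma> where "\<sigma> = 3 - \<gamma>"
definition r where "r = sqrt (\<gamma>\<^sup>2 - 3 * \<gamma> + 3 * a)"
definition \<rho> where "\<rho> = 1 / r"
definition h where "h = \<sigma> / 2"
definition y where "y = sqrt (r\<^sup>2 - h\<^sup>2)"
definition \<alpha> where "\<alpha> = Complex h y"
definition x1 where "x1 = 1 / \<alpha>"
abbreviation "H0 \<equiv> Hc a x1 x1"
abbreviation "\<kappa>0 \<equiv> x1 - of_real a * x1\<^sup>2"

lemma radicand: "\<gamma>\<^sup>2 - 3 * \<gamma> + 3 * a > \<gamma>\<^sup>2" "\<gamma>\<^sup>2 - 3 * \<gamma> + 3 * a > a"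
    "4 * (\<gamma>\<^sup>2 - 3 * \<gamma> + 3 * a) > \<sigma>\<^sup>2"
proof -
  show "\<gamma>\<^sup>2 - 3 * \<gamma> + 3 * a > \<gamma>\<^sup>2" using \<gamma>(1) by simp
  show "4 * (\<gamma>\<^sup>2 - 3 * \<gamma> + 3 * a) > \<sigma>\<^sup>2" using \<gamma>(2) unfolding \<sigma>_def by (simp add: power2_eq_square algebra_simps)
  show "\<gamma>\<^sup>2 - 3 * \<gamma> + 3 * a > a"
  proof (cases "a \<le> 1")
    case True
    \<comment> \<open>Half the sum of this inequality and the discriminant hypothesis is \<gamma>^2
      - 3 \<gamma> + 2 a > 0.\<close>
    with \<gamma>(1) have "0 < (1 - \<gamma>) * (3 - \<gamma>)" by (intro mult_pos_pos) auto
    then show ?thesis using \<gamma>(2) by (simp add: algebra_simps power2_eq_square)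
  next
    case False
    have "\<gamma>\<^sup>2 - 3 * \<gamma> + 2 * a > 0"
    proof (cases "0 \<le> \<gamma> \<and> \<gamma> \<le> 1")
      case True
      then have "0 \<le> (1 - \<gamma>) * (2 - \<gamma>)" by simp
      with False show ?thesis by (simp add: algebra_simps power2_eq_square)
    next
      case F: False
      have "0 \<le> \<gamma> * (\<gamma> - 1)" using F by (auto simp: zero_le_mult_iff)
      with \<gamma>(1) show ?thesis by (simp add: algebra_simps power2_eq_square)
    qed
    then show ?thesis by simp
  qed
qed

lemma r2: "r\<^sup>2 = \<gamma>\<^sup>2 - 3 * \<gamma> + 3 * a" and r_pos: "r > 0"
proof -
  have "\<gamma>\<^sup>2 - 3 * \<gamma> + 3 * a > 0" using radicand(1) zero_le_power2[of \<gamma>] by linarith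
  then show "r\<^sup>2 = \<gamma>\<^sup>2 - 3 * \<gamma> + 3 * a" "r > 0" by (simp_all add: r_def)
qed

lemma abs_\<gamma>: "\<bar>\<gamma>\<bar> < r" and abs_\<sigma>: "\<bar>\<sigma>\<bar> < 2 * r" and a_less: "a < r\<^sup>2" and b_eq: "b = - \<gamma> * r\<^sup>2"
proof -
  have "\<bar>\<gamma>\<bar>\<^sup>2 < r\<^sup>2" using radicand(1) r2 by simp
  then show "\<bar>\<gamma>\<bar> < r" by (rule power2_less_imp_less) (use r_pos in simp)
  have "\<bar>\<sigma>\<bar>\<^sup>2 < (2 * r)\<^sup>2" using radicand(3) r2 by (simp add: power_mult_distrib)
  then show "\<bar>\<sigma>\<bar> < 2 * r" by (rule power2_less_imp_less) (use r_pos in simp)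
  show "a < r\<^sup>2" using radicand(2) r2 by simp
  show "b = - \<gamma> * r\<^sup>2" unfolding b_def r2 by (simp add: power2_eq_square power3_eq_cube algebra_simps)
qed

lemma \<rho>_pos: "\<rho> > 0" and \<rho>_r: "\<rho> * r = 1" "r\<^sup>2 * \<rho>\<^sup>2 = 1"
  using r_pos by (simp_all add: \<rho>_def power_divide)

lemma zf: "zero_free a \<rho>"
  unfolding zero_free_def
proof (intro conjI ballI)
  fix t assume t: "t \<in> {0..\<rho>}"
  have t2: "t\<^sup>2 \<le> \<rho>\<^sup>2" using t by (intro power_mono) auto
  have at: "a * t\<^sup>2 < 1"
  proof (cases "a \<le> 0")
    case True
    then have "a * t\<^sup>2 \<le> 0" by (simp add: mult_le_0_iff)
    then show ?thesis by simp
  next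
    case False
    then have "a * t\<^sup>2 \<le> a * \<rho>\<^sup>2" using t2 by (intro mult_left_mono) auto
    also have "\<dots> < r\<^sup>2 * \<rho>\<^sup>2" using a_less \<rho>_pos by simp
    finally show ?thesis by (simp add: \<rho>_r)
  qed
  then show "a * t\<^sup>2 < 1" .
  show "1 - 2 * t + a * t\<^sup>2 > 0"
  proof (cases "a > 1")
    case True
    have "1 - 2 * t + a * t\<^sup>2 = (1 - t)\<^sup>2 + (a - 1) * t\<^sup>2" by (simp add: power2_eq_square algebra_simps)
    also have "\<dots> > 0"
      using True by (cases "t = 0") (auto intro!: add_nonneg_pos mult_pos_pos)
    finally show ?thesis .
  next
    case False
    \<comment> \<open>Now 1 - 2 t + a t^2 = (1 - t)^2 - s^2 t^2, whose first positive zero is 1 / (1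
      + s). It remains to see that 1 + s < r.\<close>
    define s where "s = sqrt (1 - a)"
    have s: "s \<ge> 0" "a = 1 - s\<^sup>2" using False by (simp_all add: s_def)
    have "\<gamma> < 1 - 2 * s"
    proof -
      have "(2 * s)\<^sup>2 < \<bar>\<gamma> - 1\<bar>\<^sup>2" using \<gamma>(2) s by (simp add: power_mult_distrib)
      then have "2 * s < \<bar>\<gamma> - 1\<bar>" by (rule power2_less_imp_less) simp
      moreover have "\<gamma> < 1" using \<gamma>(1) s zero_le_power2[of s] by linarith
      ultimately show ?thesis by simp
    qed
    \<comment> \<open>In terms of the slack k, r^2 - (1 + s)^2 becomes a sum of nonnegative terms
      with k > 0 among them.\<close>
    define k where "k = 1 - 2 * s - \<gamma>"
    have k: "k > 0" "\<gamma> = 1 - 2 * s - k" using \<open>\<gamma> < 1 - 2 * s\<close> by (simp_all add: k_def)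
    have "\<gamma>\<^sup>2 - 3 * \<gamma> + 3 * a = (1 + s)\<^sup>2 + (k\<^sup>2 + k + 4 * k * s)"
      unfolding k(2) s(2) by (simp add: power2_eq_square algebra_simps)
    then have "r\<^sup>2 = (1 + s)\<^sup>2 + (k\<^sup>2 + k + 4 * k * s)" using r2 by simp
    also have "\<dots> > (1 + s)\<^sup>2" using k(1) s(1) by (simp add: add_pos_nonneg)
    finally have "(1 + s)\<^sup>2 < r\<^sup>2" .
    then have "1 + s < r" by (rule power2_less_imp_less) (use r_pos in simp)
    moreover have "t * r \<le> 1" using t r_pos by (simp add: \<rho>_def field_simps)
    ultimately have "t * (1 + s) < 1"
      using t s(1) by (cases "t = 0") (auto intro: less_le_trans[OF mult_strict_left_mono])
    then have "(1 - t - s * t) > 0" by (simp add: algebra_simps)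
    moreover have "(1 - t + s * t) \<ge> 1 - t - s * t" using t s by simp
    ultimately have "(1 - t - s * t) * (1 - t + s * t) > 0" by (intro mult_pos_pos) auto
    then show ?thesis unfolding s(2) by (simp add: power2_eq_square algebra_simps)
  qed
qed (rule \<rho>_pos)

text \<open>The roots divided by r, which puts the pair on the unit circle: \<open>g\<close> is the
  real root and \<open>w\<close> twice the cosine of the argument of the pair.\<close>

definition g where "g = \<gamma> * \<rho>"
definition w where "w = \<sigma> * \<rho>"

lemma gw: "\<bar>g\<bar> < 1" "\<bar>w\<bar> < 2" "\<rho> = (g + w) / 3" "a * \<rho>\<^sup>2 = (1 + g * w) / 3" "b * \<rho> ^ 3 = - g"
proof -
  show "\<bar>g\<bar> < 1" "\<bar>w\<bar> < 2"
    using abs_\<gamma> abs_\<sigma> r_pos by (auto simp: g_def w_def \<rho>_def abs_mult field_simps)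
  show "\<rho> = (g + w) / 3" by (simp add: g_def w_def \<sigma>_def algebra_simps)
  have "3 * a = r\<^sup>2 + \<gamma> * \<sigma>" unfolding r2 \<sigma>_def by (simp add: power2_eq_square algebra_simps)
  then have "3 * a * \<rho>\<^sup>2 = r\<^sup>2 * \<rho>\<^sup>2 + g * w" by (simp add: g_def w_def power2_eq_square algebra_simps)
  then show "a * \<rho>\<^sup>2 = (1 + g * w) / 3" by (simp add: \<rho>_r)
  have "b * \<rho> ^ 3 = - \<gamma> * \<rho> * (r\<^sup>2 * \<rho>\<^sup>2)" unfolding b_eq by (simp add: power2_eq_square power3_eq_cube)
  then show "b * \<rho> ^ 3 = - g" by (simp add: \<rho>_r g_def)
qed

text \<open>The scaled cubic is (1 - g z)(1 - w z + z^2). The Cayley transform turns its second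
  factor into (2 - w) + (2 + w) t^2, without linear term, so the four coefficients satisfy B0 B3 = 9
  B1 B2. This relation makes everything beyond the sin (u - v) term a perfect square.\<close>

lemma Ef_lower:
  obtains c :: real where "c > 0" "\<And>u v :: real. Ef \<rho> (a * \<rho>\<^sup>2) (b * \<rho> ^ 3) u v \<ge> c * (sin (u - v))\<^sup>2"
proof -
  define B0 B1 B2 B3 where "B0 = (1 - g) * (2 - w)" "B1 = (1 + g) * (2 - w) / 3"
    "B2 = (1 - g) * (2 + w) / 3" "B3 = (1 + g) * (2 + w)"
  note B = this
  have pos: "B0 > 0" "B1 > 0" "B2 > 0" "B3 > 0" using gw(1,2) by (auto simp: B abs_less_iff)
  have BB: "B0 * B3 = 9 * (B1 * B2)" by (simp add: B)
  show ?thesis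
  proof (rule that)
    show "B1 * B2 > 0" using pos by simp
    fix u v :: real
    define A C where "A = cos u * cos v" "C = sin u * sin v"
    have "1 - \<rho> - a * \<rho>\<^sup>2 - b * \<rho> ^ 3 = B1" "1 + \<rho> - a * \<rho>\<^sup>2 + b * \<rho> ^ 3 = B2"
      "1 - 3 * \<rho> + 3 * (a * \<rho>\<^sup>2) + b * \<rho> ^ 3 = B0" "1 + 3 * \<rho> + 3 * (a * \<rho>\<^sup>2) - b * \<rho> ^ 3 = B3"
      unfolding gw(4,5) unfolding gw(3) B by (simp_all add: field_simps)
    then have "Ef \<rho> (a * \<rho>\<^sup>2) (b * \<rho> ^ 3) u v = B1 * B2 * (sin (u + v))\<^sup>2 + (B1 * A - B3 * C) * (B0 * A - B2 * C)"
      by (simp add: Ef_def A_C_def)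
    \<comment> \<open>Trading sin (u + v) for sin (u - v) isolates the term that vanishes for u = v;
      what remains is a form in A and C of discriminant zero.\<close>
    also have "(sin (u + v))\<^sup>2 = (sin (u - v))\<^sup>2 + 4 * (A * C)"
      unfolding A_C_def sin_add sin_diff by (simp add: power2_eq_square algebra_simps)
    also have "B1 * B2 * ((sin (u - v))\<^sup>2 + 4 * (A * C)) + (B1 * A - B3 * C) * (B0 * A - B2 * C)
        = B1 * B2 * (sin (u - v))\<^sup>2 + (B0 * B1 * A\<^sup>2 + (3 * (B1 * B2) - B0 * B3) * (A * C) + B2 * B3 * C\<^sup>2)"
      by (simp add: power2_eq_square algebra_simps)
    also have "B0 * B1 * A\<^sup>2 + (3 * (B1 * B2) - B0 * B3) * (A * C) + B2 * B3 * C\<^sup>2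
        = (B0 * B1 * A - 3 * (B1 * B2) * C)\<^sup>2 / (B0 * B1)"
    proof -
      have "(B0 * B1) * (B0 * B1 * A\<^sup>2 + (3 * (B1 * B2) - B0 * B3) * (A * C) + B2 * B3 * C\<^sup>2)
        = (B0 * B1 * A - 3 * (B1 * B2) * C)\<^sup>2"
      proof -
        have *: "(B0 * B1) * (B2 * B3) = 9 * (B1 * B2)\<^sup>2"
          using arg_cong[OF BB, of "\<lambda>t. t * (B1 * B2)"] by (simp add: power2_eq_square mult_ac)
        have "(B0 * B1) * (B0 * B1 * A\<^sup>2 + (3 * (B1 * B2) - B0 * B3) * (A * C) + B2 * B3 * C\<^sup>2)
           = (B0 * B1)\<^sup>2 * A\<^sup>2 - 6 * (B0 * B1) * (B1 * B2) * (A * C) + ((B0 * B1) * (B2 * B3)) * C\<^sup>2"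
          unfolding BB by (simp add: power2_eq_square algebra_simps)
        also have "\<dots> = (B0 * B1 * A - 3 * (B1 * B2) * C)\<^sup>2"
          unfolding * by (simp add: power2_eq_square algebra_simps)
        finally show ?thesis .
      qed
      then show ?thesis using pos by (simp add: field_simps)
    qed
    finally show "B1 * B2 * (sin (u - v))\<^sup>2 \<le> Ef \<rho> (a * \<rho>\<^sup>2) (b * \<rho> ^ 3) u v" using pos by simp
  qed
qed

lemma W_le_1: "cmod x = \<rho> \<Longrightarrow> cmod (Wt a b x p) \<le> 1"
proof (rule Wt_le_1[OF zf])
  obtain c :: real where c: "c > 0" "\<And>u v :: real. Ef \<rho> (a * \<rho>\<^sup>2) (b * \<rho> ^ 3) u v \<ge> c * (sin (u - v))\<^sup>2"
    by (rule Ef_lower) (rule that)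
  show "Ef \<rho> (a * \<rho>\<^sup>2) (b * \<rho> ^ 3) u v \<ge> 0" for u v
    by (rule order.trans[OF _ c(2)]) (use c(1) in simp)
qed

text \<open>A zero of Q means W = 1, hence \<open>Ef\<close> = 0, and \<open>Ef_lower\<close> then
  forces sin (u - v) = 0.\<close>

lemma zero_imp_eq:
  assumes x: "cmod x = \<rho>" and Q: "Qt a b x 1 p = 0"
  shows "cis (fst p) = cis (snd p)"
proof -
  obtain c where c: "c > 0" "\<And>u v. Ef \<rho> (a * \<rho>\<^sup>2) (b * \<rho> ^ 3) u v \<ge> c * (sin (u - v))\<^sup>2"
    by (rule Ef_lower) blast
  have x': "x = of_real \<rho> * cis (Arg x)" using rcis_cmod_Arg[of x] x by (simp add: rcis_def)
  have "Wt a b x p = 1" using Q Ht_nonzero[OF zf x] unfolding Qt_Wt[OF zf x] by simp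
  with Wt_Ef[OF x' Ht_nonzero[OF zf x], of b p] Ht_nonzero[OF zf x, of p]
  have "Ef \<rho> (a * \<rho>\<^sup>2) (b * \<rho> ^ 3) ((Arg x + fst p) / 2) ((Arg x + snd p) / 2) = 0" by simp
  with c(2)[of "(Arg x + fst p) / 2" "(Arg x + snd p) / 2"] c(1)
  have "(sin ((Arg x + fst p) / 2 - (Arg x + snd p) / 2))\<^sup>2 \<le> 0" by (simp add: mult_le_0_iff)
  then have "sin ((Arg x + fst p) / 2 - (Arg x + snd p) / 2) = 0" by simp
  also have "(Arg x + fst p) / 2 - (Arg x + snd p) / 2 = (fst p - snd p) / 2" by (simp add: field_simps)
  finally show ?thesis by (rule sin_half_diff_zero)
qed

lemma P_factor:
  fixes z :: complex
  shows "1 - 3 * z + 3 * of_real a * z\<^sup>2 + of_real b * z ^ 3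
    = (1 - of_real \<gamma> * z) * (of_real (r\<^sup>2) * z\<^sup>2 - of_real \<sigma> * z + 1)"
proof -
  have "3 * a = r\<^sup>2 + \<gamma> * \<sigma>" unfolding r2 \<sigma>_def by (simp add: power2_eq_square algebra_simps)
  then have 1: "3 * complex_of_real a = of_real (r\<^sup>2 + \<gamma> * \<sigma>)" by (metis of_real_mult of_real_numeral)
  have 2: "(3 :: complex) = of_real (\<sigma> + \<gamma>)" by (simp add: \<sigma>_def)
  have "1 - 3 * z + 3 * of_real a * z\<^sup>2 + of_real b * z ^ 3
    = 1 - of_real (\<sigma> + \<gamma>) * z + of_real (r\<^sup>2 + \<gamma> * \<sigma>) * z\<^sup>2 + of_real (- \<gamma> * r\<^sup>2) * z ^ 3"
    unfolding 1[symmetric] 2[symmetric] b_eq by simp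
  then show ?thesis by (simp add: power2_eq_square power3_eq_cube algebra_simps)
qed

text \<open>Exchanging Y and Z in the previous argument gives X = Y = Z, a cube root of unity since
  XYZ = 1. So every zero is diagonal, and the real factor is excluded by |g| < 1.\<close>

lemma zero_at_boundary:
  assumes x: "cmod x = \<rho>" and Q: "Qt a b x 1 p = 0"
  defines "X \<equiv> cis (fst p)"
  shows "cis (snd p) = X" "X ^ 3 = 1" "of_real (r\<^sup>2) * (x * X)\<^sup>2 - of_real \<sigma> * (x * X) + 1 = 0"
proof -
  show Y: "cis (snd p) = X" using zero_imp_eq[OF x Q] by (simp add: X_def)
  have Z: "cis (- fst p - snd p) = X"
    using zero_imp_eq[OF x, of "(fst p, - fst p - snd p)"] Q by (simp add: Qt_1_swap X_def)
  have "cis (fst p) * cis (snd p) * cis (- fst p - snd p) = 1" by (simp add: cis_mult)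
  then show X3: "X ^ 3 = 1" unfolding Y Z by (simp add: X_def[symmetric] power3_eq_cube)
  then have cX: "cnj X = X\<^sup>2"
  proof -
    have "cnj X * X = 1" by (simp add: X_def cis_cnj cis_mult)
    then have "cnj X * (X * X\<^sup>2) = X\<^sup>2" by (simp add: mult.assoc[symmetric])
    moreover have "X * X\<^sup>2 = 1" using X3 by (simp add: power2_eq_square power3_eq_cube mult.assoc)
    ultimately show ?thesis by simp
  qed
  let ?z = "x * X"
  have "chi p = 3 * X" unfolding chi_def Y Z by (simp add: X_def)
  then have "Qt a b x 1 p = 1 - 3 * ?z + 3 * of_real a * ?z\<^sup>2 + of_real b * ?z ^ 3"
    unfolding Qt_1_chi using X3 cX by (simp add: power_mult_distrib)
  then have "(1 - of_real \<gamma> * ?z) * (of_real (r\<^sup>2) * ?z\<^sup>2 - of_real \<sigma> * ?z + 1) = 0"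
    unfolding P_factor[symmetric] using Q by simp
  moreover have "1 - of_real \<gamma> * ?z \<noteq> 0"
  proof
    assume "1 - of_real \<gamma> * ?z = 0"
    then have "cmod (of_real \<gamma> * ?z) = 1" by simp
    moreover have "cmod (of_real \<gamma> * ?z) = \<bar>g\<bar>" using x \<rho>_pos by (simp add: norm_mult X_def g_def abs_mult)
    ultimately show False using gw(1) by simp
  qed
  ultimately show "of_real (r\<^sup>2) * ?z\<^sup>2 - of_real \<sigma> * ?z + 1 = 0" by simp
qed

lemma cube_root_unity:
  assumes "X ^ 3 = (1 :: complex)" "X \<noteq> 1"
  shows "X\<^sup>2 + X + 1 = 0"
proof -
  have "(X - 1) * (X\<^sup>2 + X + 1) = 0" using assms(1) by (simp add: power2_eq_square power3_eq_cube algebra_simps)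
  with assms(2) show ?thesis by simp
qed

text \<open>Otherwise the pair would have arguments of modulus 2 pi / 3 and a positive cube, and Q
  would vanish on the torus through \<rho>.\<close>

lemma not_\<sigma>_minus_r: "\<sigma> \<noteq> - r"
proof
  assume "\<sigma> = - r"
  then have "\<gamma> = 3 + r" by (simp add: \<sigma>_def)
  with abs_\<gamma> show False by linarith
qed

text \<open>A zero needs X = 1 and w = 2, or X a primitive cube root of unity and w = -1. This is
  the boundedness half of the oscillation argument.\<close>

lemma no_zero_positive: "Qt a b (of_real \<rho>) 1 p \<noteq> 0"
proof
  assume Q: "Qt a b (of_real \<rho>) 1 p = 0"
  have x: "cmod (of_real \<rho>) = \<rho>" using \<rho>_pos by simp
  note z = zero_at_boundary[OF x Q]
  let ?X = "cis (fst p)"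
  have "of_real (r\<^sup>2) * (of_real \<rho> * ?X)\<^sup>2 = of_real (r\<^sup>2 * \<rho>\<^sup>2) * ?X\<^sup>2" by (simp add: power_mult_distrib)
  with z(3) have *: "?X\<^sup>2 - of_real w * ?X + 1 = 0" by (simp add: \<rho>_r w_def mult.assoc)
  show False
  proof (cases "?X = 1")
    case True
    then have "of_real (2 - w) = (0 :: complex)" using * by simp
    then show False using gw(2) by (simp only: of_real_eq_0_iff)
  next
    case False
    have "of_real (w + 1) * ?X = (?X\<^sup>2 + ?X + 1) - (?X\<^sup>2 - of_real w * ?X + 1)"
      by (simp add: algebra_simps)
    also have "\<dots> = 0" unfolding cube_root_unity[OF z(2) False] * by simp
    finally have "w + 1 = 0" by (simp only: mult_eq_0_iff of_real_eq_0_iff cis_neq_zero simp_thms)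
    then have "w = - 1" by simp
    then have "\<sigma> = - r" using \<rho>_pos r_pos by (simp add: w_def \<rho>_def field_simps)
    with not_\<sigma>_minus_r show False by simp
  qed
qed

text \<open>Including the endpoint \<tau> = 1 makes the parameter set compact, so the bound does not
  degenerate as \<tau> tends to 1.\<close>

lemma compact_away:
  assumes "compact S" "\<And>p. p \<in> S \<Longrightarrow> Qt a b x 1 p \<noteq> 0" "cmod x = \<rho>"
  shows "\<exists>m>0. \<forall>\<tau> p. 0 < \<tau> \<longrightarrow> \<tau> < 1 \<longrightarrow> p \<in> S \<longrightarrow> cmod (Qt a b x \<tau> p) \<ge> m"
proof (cases "S = {}")
  case False
  let ?K = "{0..1::real} \<times> S"
  have cK: "compact ?K" "?K \<noteq> {}" using assms(1) False by (auto intro: compact_Times)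
  have "continuous_on ?K (\<lambda>z. cmod (Qt a b x (fst z) (snd z)))"
    unfolding Qt_def Ht_def Gc_def Hc_def by (intro continuous_intros)
  from continuous_attains_inf[OF cK this] obtain z where z: "z \<in> ?K"
    and z': "\<forall>z'\<in>?K. cmod (Qt a b x (fst z) (snd z)) \<le> cmod (Qt a b x (fst z') (snd z'))"
    by (elim bexE) (rule that)
  have "Qt a b x (fst z) (snd z) \<noteq> 0"
  proof (cases "fst z = 1")
    case True
    then show ?thesis using z assms(2) by auto
  next
    case False
    then show ?thesis using z by (intro Qt_nonzero[OF zf assms(3) W_le_1[OF assms(3)]]) auto
  qed
  then have "cmod (Qt a b x (fst z) (snd z)) > 0" by simp
  moreover have "cmod (Qt a b x \<tau> p) \<ge> cmod (Qt a b x (fst z) (snd z))" if "0 < \<tau>" "\<tau> < 1" "p \<in> S" for \<tau> p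
    using z'[rule_format, of "(\<tau>, p)"] that by auto
  ultimately show ?thesis by (intro exI[of _ "cmod (Qt a b x (fst z) (snd z))"]) simp
qed (auto intro: exI[of _ 1])

lemma pair_oscillation:
  assumes "cmod x = \<rho>" "\<And>M. \<exists>\<tau>. 0 < \<tau> \<and> \<tau> < 1 \<and> M < cmod (integral torus (\<lambda>p. 1 / Qt a b x \<tau> p))"
  shows "infinite {n. \<delta> a b n > 0} \<and> infinite {n. \<delta> a b n < 0}"
proof -
  have x: "cmod (of_real \<rho>) = \<rho>" using \<rho>_pos by simp
  have "\<exists>m>0. \<forall>\<tau> p. 0 < \<tau> \<longrightarrow> \<tau> < 1 \<longrightarrow> p \<in> torus \<longrightarrow> cmod (Qt a b (of_real \<rho>) \<tau> p) \<ge> m"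
    by (rule compact_away[OF compact_torus _ x]) (rule no_zero_positive)
  then obtain m where m: "m > 0" "\<forall>\<tau> p. 0 < \<tau> \<longrightarrow> \<tau> < 1 \<longrightarrow> p \<in> torus \<longrightarrow> cmod (Qt a b (of_real \<rho>) \<tau> p) \<ge> m"
    by (elim exE conjE) (rule that)
  show ?thesis
  proof (rule oscillation_criterion[OF zf _ m(1) _ assms])
    show "cmod (Wt a b x p) \<le> 1" if "cmod x = \<rho>" for x p using that by (rule W_le_1)
    show "m \<le> cmod (Qt a b (of_real \<rho>) \<tau> p)" if "0 < \<tau>" "\<tau> < 1" "p \<in> torus" for \<tau> p
      using m(2) that by blast
  qed
qed

end

text \<open>Since 1 - cos t = 2 sin (t / 2)^2, the deficit 3 - Re chi is comparable to |p|^2,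
  whereas Im chi is cubic and can be made a small fraction of |p|^2.\<close>

lemma chi_near:
  assumes p: "p \<in> torus"
  defines "e \<equiv> (fst p)\<^sup>2 + (snd p)\<^sup>2"
  shows "3 - Re (chi p) \<ge> e / 18" "3 - Re (chi p) \<le> 2 * e"
    "\<bar>fst p\<bar> \<le> \<nu> \<Longrightarrow> \<bar>snd p\<bar> \<le> \<nu> \<Longrightarrow> \<bar>Im (chi p)\<bar> \<le> e * \<nu> / 2"
proof -
  have c: "1 - cos t = 2 * (sin (t / 2))\<^sup>2" for t :: real
    using cos_double_sin[of "t / 2"] by simp
  have d: "3 - Re (chi p) = 2 * (sin (fst p / 2))\<^sup>2 + 2 * (sin (snd p / 2))\<^sup>2 + 2 * (sin ((fst p + snd p) / 2))\<^sup>2"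
    unfolding Re_chi c[symmetric] by simp
  have "(sin (t / 2))\<^sup>2 \<ge> t\<^sup>2 / 36" if "\<bar>t\<bar> \<le> pi" for t :: real
    using sin_squared_ge[of "t / 2"] that pi_less_4 by (simp add: power_divide)
  then have sp: "(sin (fst p / 2))\<^sup>2 \<ge> (fst p)\<^sup>2 / 36" "(sin (snd p / 2))\<^sup>2 \<ge> (snd p)\<^sup>2 / 36"
    using p by (auto simp: torus_iff)
  have "(X + Y) / 18 \<le> 2 * A + 2 * B + 2 * C" if "X / 36 \<le> A" "Y / 36 \<le> B" "0 \<le> C" for A B C X Y :: real
    using that by (simp add: field_simps)
  from this[OF sp zero_le_power2] show "3 - Re (chi p) \<ge> e / 18" unfolding d e_def .
  have s: "(sin (t / 2))\<^sup>2 \<le> t\<^sup>2 / 4" for t :: real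
  proof -
    have "(sin (t / 2))\<^sup>2 \<le> (t / 2)\<^sup>2" using abs_sin_x_le_abs_x[of "t / 2"] abs_le_square_iff by blast
    then show ?thesis by (simp add: power_divide)
  qed
  have "(fst p + snd p)\<^sup>2 + (fst p - snd p)\<^sup>2 = 2 * e" by (simp add: e_def power2_eq_square algebra_simps)
  then have "(fst p + snd p)\<^sup>2 \<le> 2 * e" using zero_le_power2[of "fst p - snd p"] by linarith
  then have "(fst p + snd p)\<^sup>2 / 4 \<le> e / 2" by simp
  moreover have "2 * A + 2 * B + 2 * C \<le> 2 * (X + Y)"
    if "A \<le> X / 4" "B \<le> Y / 4" "C \<le> Z / 4" "Z / 4 \<le> (X + Y) / 2" "0 \<le> X" "0 \<le> Y" for A B C X Y Z :: real
    using that by (simp add: field_simps)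
  from this[OF s s s _ zero_le_power2 zero_le_power2] calculation show "3 - Re (chi p) \<le> 2 * e"
    unfolding d e_def by blast
  show "\<bar>Im (chi p)\<bar> \<le> e * \<nu> / 2" if n: "\<bar>fst p\<bar> \<le> \<nu>" "\<bar>snd p\<bar> \<le> \<nu>"
  proof -
    have "2 * (\<bar>fst p\<bar> * \<bar>snd p\<bar>) \<le> e"
      using sum_squares_bound[of "\<bar>fst p\<bar>" "\<bar>snd p\<bar>"] by (simp add: e_def)
    then have "2 * (\<bar>fst p\<bar> * \<bar>snd p\<bar>) * (\<bar>fst p\<bar> + \<bar>snd p\<bar>) \<le> e * (\<nu> + \<nu>)"
      using n by (intro mult_mono add_mono) (auto simp: e_def)
    then show ?thesis using Im_chi_le[of p] by simp
  qed
qed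

lemma Re_mult_of_real: "Re (w * of_real c) = Re w * c"
  by simp

lemma Re_divide_cnj: "Re (z / w) = Re (w * cnj z) / (cmod w)\<^sup>2"
  by (simp add: Re_divide cmod_power2 mult.commute)

section \<open>Divergence when the two roots of the pair have different cubes\<close>

context complex_pair
begin

lemma y2: "y\<^sup>2 = 3 * (h\<^sup>2 - 2 * h + a)" and y_pos: "y > 0" and hy: "h\<^sup>2 + y\<^sup>2 = r\<^sup>2"
proof -
  have "\<bar>h\<bar>\<^sup>2 < r\<^sup>2" using abs_\<sigma> r_pos unfolding h_def by (intro power_strict_mono) auto
  then have "r\<^sup>2 - h\<^sup>2 > 0" by simp
  then show "y > 0" and hy: "h\<^sup>2 + y\<^sup>2 = r\<^sup>2" by (simp_all add: y_def)
  then have "y\<^sup>2 = \<gamma>\<^sup>2 - 3 * \<gamma> + 3 * a - h\<^sup>2" using r2 by simp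
  also have "\<dots> = 3 * (h\<^sup>2 - 2 * h + a)"
    unfolding h_def \<sigma>_def by (simp add: power2_eq_square field_simps)
  finally show "y\<^sup>2 = 3 * (h\<^sup>2 - 2 * h + a)" .
qed

lemma cmod_\<alpha>: "cmod \<alpha> = r" and \<alpha>_nz: "\<alpha> \<noteq> 0" and cmod_x1: "cmod x1 = \<rho>"
proof -
  show "cmod \<alpha> = r" using hy r_pos by (simp add: \<alpha>_def cmod_def)
  then show "\<alpha> \<noteq> 0" "cmod x1 = \<rho>" using r_pos by (auto simp: x1_def norm_divide \<rho>_def)
qed

lemma x1_root: "of_real (r\<^sup>2) * x1\<^sup>2 - of_real \<sigma> * x1 + 1 = 0"
proof -
  have "\<alpha>\<^sup>2 - of_real \<sigma> * \<alpha> + of_real (r\<^sup>2) = 0"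
    unfolding hy[symmetric] by (simp add: complex_eq_iff \<alpha>_def h_def power2_eq_square)
  then have "0 = (\<alpha>\<^sup>2 - of_real \<sigma> * \<alpha> + of_real (r\<^sup>2)) * x1\<^sup>2" by simp
  also have "\<dots> = of_real (r\<^sup>2) * x1\<^sup>2 - of_real \<sigma> * x1 + 1"
    using \<alpha>_nz by (simp add: x1_def power2_eq_square field_simps)
  finally show ?thesis by simp
qed

text \<open>Excludes cancellation: with this sign, both leading terms of Q times the conjugate of H0
  have positive real part near the origin. Up to the factor r^4 the quantity is 2 k (a - \<gamma>)
  with k = y^2 / 3, so the sign is the hypothesis \<gamma> < a.\<close>

lemma Re_\<kappa>0_H0: "Re (\<kappa>0 * cnj H0) > 0"
proof -
  define k where "k = h\<^sup>2 - 2 * h + a"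
  have k: "y * y = 3 * k" "k > 0"
  proof -
    show "y * y = 3 * k" using y2 by (simp add: k_def power2_eq_square)
    then show "k > 0" using mult_pos_pos[OF y_pos y_pos] by simp
  qed
  have "\<kappa>0 = (\<alpha> - of_real a) / \<alpha>\<^sup>2" "H0 = (\<alpha>\<^sup>2 - 2 * \<alpha> + of_real a) / \<alpha>\<^sup>2"
    using \<alpha>_nz by (simp_all add: x1_def Hc_def power2_eq_square field_simps)
  then have "\<kappa>0 * cnj H0 = (\<alpha> - of_real a) * cnj (\<alpha>\<^sup>2 - 2 * \<alpha> + of_real a) / (\<alpha>\<^sup>2 * cnj (\<alpha>\<^sup>2))"
    by simp
  also have "\<alpha>\<^sup>2 * cnj (\<alpha>\<^sup>2) = of_real (r ^ 4)"
    unfolding complex_norm_square[symmetric] by (simp add: norm_power cmod_\<alpha> flip: power_mult)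
  finally have "Re (\<kappa>0 * cnj H0) = Re ((\<alpha> - of_real a) * cnj (\<alpha>\<^sup>2 - 2 * \<alpha> + of_real a)) / r ^ 4"
    by (simp only: Re_divide_of_real)
  also have "Re ((\<alpha> - of_real a) * cnj (\<alpha>\<^sup>2 - 2 * \<alpha> + of_real a)) = (h - a) * (h\<^sup>2 - 2 * h + a - y * y) + (y * y) * (2 * h - 2)"
    by (simp add: \<alpha>_def power2_eq_square algebra_simps)
  also have "\<dots> = k * (4 * h + 2 * a - 6)" unfolding k(1) k_def[symmetric] by (simp add: algebra_simps)
  also have "4 * h + 2 * a - 6 = 2 * (a - \<gamma>)" by (simp add: h_def \<sigma>_def field_simps)
  finally show ?thesis using k(2) \<gamma>(1) r_pos by simp
qed

text \<open>At \<tau> = 1, Q is affine in chi and its conjugate. Subtracting its value 0 at chi = 3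
  leaves terms in 3 - Re chi and Im chi. \<open>V\<close> is zG.\<close>

lemma Qt_near:
  fixes p :: "real \<times> real"
  defines "V \<equiv> x1 * cis (- fst p) * cis (- snd p) * Gc a b (x1 * cis (fst p)) (x1 * cis (snd p))"
  shows "Qt a b x1 \<tau> p = \<kappa>0 * of_real (3 - Re (chi p)) - \<i> * (x1 + of_real a * x1\<^sup>2) * of_real (Im (chi p)) + of_real (1 - \<tau>) * V"
proof -
  have P0: "1 - 3 * x1 + 3 * of_real a * x1\<^sup>2 + of_real b * x1 ^ 3 = 0"
    unfolding P_factor x1_root by simp
  have chi: "chi p = of_real (Re (chi p)) + \<i> * of_real (Im (chi p))"
    "cnj (chi p) = of_real (Re (chi p)) - \<i> * of_real (Im (chi p))"
    by (simp_all add: complex_eq_iff)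
  have "Qt a b x1 \<tau> p = Qt a b x1 1 p + of_real (1 - \<tau>) * V"
    by (simp add: Qt_def V_def algebra_simps)
  also have "Qt a b x1 1 p = Qt a b x1 1 p - (1 - 3 * x1 + 3 * of_real a * x1\<^sup>2 + of_real b * x1 ^ 3)"
    using P0 by simp
  also have "\<dots> = x1 * (3 - chi p) - of_real a * x1\<^sup>2 * (3 - cnj (chi p))"
    unfolding Qt_1_chi by (simp add: algebra_simps)
  also have "\<dots> = \<kappa>0 * of_real (3 - Re (chi p)) - \<i> * (x1 + of_real a * x1\<^sup>2) * of_real (Im (chi p))"
    by (subst chi(2), subst chi(1)) (simp add: algebra_simps)
  finally show ?thesis .
qed

text \<open>At a second zero, x1 X with X a primitive cube root of unity would also be a root of the
  quadratic factor. Subtracting the two equations then gives |\<sigma>| = r.\<close>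

lemma only_zero_x1:
  assumes "\<sigma>\<^sup>2 \<noteq> r\<^sup>2" "p \<in> torus" "Qt a b x1 1 p = 0"
  shows "p = (0, 0)"
proof -
  note z = zero_at_boundary[OF cmod_x1 assms(3)]
  let ?X = "cis (fst p)"
  have X1: "?X = 1"
  proof (rule ccontr)
    assume n: "?X \<noteq> 1"
    have "of_real (r\<^sup>2) * (x1 * ?X)\<^sup>2 - of_real \<sigma> * (x1 * ?X) - (of_real (r\<^sup>2) * x1\<^sup>2 - of_real \<sigma> * x1) = 0"
      using z(3) x1_root by (simp add: add_eq_0_iff2)
    then have "x1 * (?X - 1) * (of_real (r\<^sup>2) * (x1 * (?X + 1)) - of_real \<sigma>) = 0"
      by (simp add: power2_eq_square algebra_simps)
    moreover have "x1 \<noteq> 0" using cmod_x1 \<rho>_pos by auto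
    ultimately have "of_real (r\<^sup>2) * (x1 * (?X + 1)) = of_real \<sigma>" using n by simp
    moreover have "?X + 1 = - (?X\<^sup>2)" using cube_root_unity[OF z(2) n] by (simp add: eq_neg_iff_add_eq_0 add_ac)
    ultimately have "cmod (of_real (r\<^sup>2) * (x1 * - (?X\<^sup>2))) = \<bar>\<sigma>\<bar>" by (metis norm_of_real)
    then have "r\<^sup>2 * \<rho> = \<bar>\<sigma>\<bar>" by (simp add: norm_mult norm_power cmod_x1)
    then have "\<bar>\<sigma>\<bar> = r" using r_pos by (simp add: \<rho>_def power2_eq_square)
    with assms(1) show False by (metis power2_abs)
  qed
  then have "fst p = 0" "snd p = 0" using z(1) assms(2) by (auto intro!: cis_eq_1 simp: torus_iff)
  then show ?thesis by (cases p) simp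
qed

text \<open>Multiplication by H0 rotates 1/Q so that near its only singularity the real part is at
  least a multiple of 1 / (\<epsilon> + |p|^2); away from it compactness bounds the integrand. Hence
  the divergence is logarithmic.\<close>

lemma blow_up_generic:
  assumes "\<sigma>\<^sup>2 \<noteq> r\<^sup>2"
  shows "\<exists>\<tau>. 0 < \<tau> \<and> \<tau> < 1 \<and> M < cmod (integral torus (\<lambda>p. 1 / Qt a b x1 \<tau> p))"
proof -
  define K0 L N where "K0 = Re (\<kappa>0 * cnj H0)" "L = cmod (x1 + of_real a * x1\<^sup>2)" "N = cmod H0"
  note KLN = this
  have K0: "K0 > 0" and N: "N > 0" and L: "L \<ge> 0"
    using Re_\<kappa>0_H0 Hc_nonzero[OF zf cmod_x1 cmod_x1] by (auto simp: KLN)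
  define V where "V = (\<lambda>p. x1 * cis (- fst p) * cis (- snd p) * Gc a b (x1 * cis (fst p)) (x1 * cis (snd p)))"
  have V0: "V (0, 0) = H0"
  proof -
    have "Qt a b x1 1 (0, 0) = 0" unfolding Qt_near by (simp add: chi_def)
    then show ?thesis by (simp add: Qt_def V_def Ht_def)
  qed
  have "isCont V (0, 0)" unfolding V_def Gc_def
    by (rule continuous_on_interior[of UNIV]) (auto intro!: continuous_intros)
  then obtain d where d: "d > 0" "\<And>p. dist p (0, 0) < d \<Longrightarrow> dist (V p) H0 < N / 2"
    using N unfolding continuous_at_eps_delta V0 by (meson half_gt_zero)
  \<comment> \<open>Small enough that the Im chi term uses at most half of the K0 / 18 gained from 3
    - Re chi.\<close>
  define \<nu> where "\<nu> = min (min 1 (d / 2)) (K0 / (18 * (L * N + 1)))"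
  have LN: "L * N + 1 > 0" using L N by (simp add: add_nonneg_pos)
  have \<nu>: "\<nu> > 0" "\<nu> \<le> 1" "\<nu> < d" "L * N * \<nu> / 2 \<le> K0 / 36"
  proof -
    show "\<nu> > 0" using d(1) K0 LN by (simp add: \<nu>_def)
    have "\<nu> \<le> d / 2" "\<nu> \<le> 1" unfolding \<nu>_def by linarith+
    then show "\<nu> \<le> 1" "\<nu> < d" using d(1) by auto
    have "\<nu> \<le> K0 / (18 * (L * N + 1))" unfolding \<nu>_def by (rule min.cobounded2)
    then have "(L * N + 1) * \<nu> \<le> K0 / 18" using LN by (simp add: field_simps)
    then show "L * N * \<nu> / 2 \<le> K0 / 36" using \<open>\<nu> > 0\<close> by (simp add: algebra_simps)
  qed
  \<comment> \<open>Relative to \<epsilon> + |p|^2, \<open>c1\<close> bounds the real part of Q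
    times the conjugate of H0 from below, and \<open>C2\<close> bounds |Q| from above.\<close>
  define c1 where "c1 = min (K0 / 36) (N\<^sup>2 / 2)"
  define C2 where "C2 = 2 * cmod \<kappa>0 + L + 2 * N"
  have c1: "c1 > 0" "c1 \<le> K0 / 36" "c1 \<le> N\<^sup>2 / 2" using K0 N by (auto simp: c1_def)
  have C2: "C2 > 0" unfolding C2_def using N L by (simp add: add_nonneg_pos)
  have key: "Re (H0 / Qt a b x1 (1 - \<epsilon>) p) \<ge> c1 / C2\<^sup>2 / (\<epsilon> + (fst p)\<^sup>2 + (snd p)\<^sup>2)"
    if \<epsilon>: "0 < \<epsilon>" and p: "\<bar>fst p\<bar> \<le> \<nu>" "\<bar>snd p\<bar> \<le> \<nu>" "dist p (0, 0) < d" for \<epsilon> p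
  proof -
    define e where "e = (fst p)\<^sup>2 + (snd p)\<^sup>2"
    have e: "e \<ge> 0" by (simp add: e_def)
    let ?Q = "Qt a b x1 (1 - \<epsilon>) p"
    have pt: "p \<in> torus" using p \<nu>(2) pi_gt3 by (simp add: torus_iff)
    note ch = chi_near(1,2)[OF pt, folded e_def] chi_near(3)[OF pt p(1,2), folded e_def]
    have Q: "?Q = \<kappa>0 * of_real (3 - Re (chi p)) - \<i> * (x1 + of_real a * x1\<^sup>2) * of_real (Im (chi p)) + of_real \<epsilon> * V p"
      using Qt_near[of "1 - \<epsilon>" p] by (simp add: V_def)
    have dV: "cmod (V p - H0) < N / 2" using d(2)[OF p(3)] by (simp add: dist_norm)
    have V1: "Re (V p * cnj H0) \<ge> N\<^sup>2 / 2"
    proof -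
      have "V p * cnj H0 = (V p - H0) * cnj H0 + of_real (N\<^sup>2)"
        by (simp add: algebra_simps KLN complex_norm_square[symmetric])
      moreover have "\<bar>Re ((V p - H0) * cnj H0)\<bar> \<le> N / 2 * N"
      proof -
        have "\<bar>Re ((V p - H0) * cnj H0)\<bar> \<le> cmod (V p - H0) * N"
          using abs_Re_le_cmod[of "(V p - H0) * cnj H0"] by (simp add: norm_mult KLN)
        also have "\<dots> \<le> N / 2 * N" using dV N by (intro mult_right_mono) auto
        finally show ?thesis .
      qed
      ultimately have "Re (V p * cnj H0) = Re ((V p - H0) * cnj H0) + N\<^sup>2" "\<bar>Re ((V p - H0) * cnj H0)\<bar> \<le> N\<^sup>2 / 2"
        by (simp_all only: plus_complex.sel Re_complex_of_real power2_eq_square times_divide_eq_left)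
      then show ?thesis by linarith
    qed
    have V2: "cmod (V p) \<le> 2 * N"
    proof -
      have "cmod (V p) \<le> cmod (V p - H0) + cmod H0" using norm_triangle_ineq[of "V p - H0" H0] by simp
      then show ?thesis using dV N unfolding KLN(3) by linarith
    qed
    have "\<bar>Re (\<i> * (x1 + of_real a * x1\<^sup>2) * of_real (Im (chi p)) * cnj H0)\<bar> \<le> L * N * (e * \<nu> / 2)"
    proof -
      have "\<bar>Re (\<i> * (x1 + of_real a * x1\<^sup>2) * of_real (Im (chi p)) * cnj H0)\<bar> \<le> cmod (\<i> * (x1 + of_real a * x1\<^sup>2) * of_real (Im (chi p)) * cnj H0)"
        by (rule abs_Re_le_cmod)
      also have "\<dots> = L * N * \<bar>Im (chi p)\<bar>" by (simp add: norm_mult KLN)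
      also have "\<dots> \<le> L * N * (e * \<nu> / 2)" using ch(3) L N by (intro mult_left_mono) auto
      finally show ?thesis .
    qed
    moreover have "L * N * (e * \<nu> / 2) \<le> K0 / 36 * e"
      using mult_right_mono[OF \<nu>(4) e] by (simp add: algebra_simps)
    moreover have "Re (\<kappa>0 * of_real (3 - Re (chi p)) * cnj H0) = K0 * (3 - Re (chi p))"
    proof -
      have "\<kappa>0 * of_real (3 - Re (chi p)) * cnj H0 = (\<kappa>0 * cnj H0) * of_real (3 - Re (chi p))" by (simp only: mult_ac)
      then have "Re (\<kappa>0 * of_real (3 - Re (chi p)) * cnj H0) = Re ((\<kappa>0 * cnj H0) * of_real (3 - Re (chi p)))"
        by (rule arg_cong)
      also have "\<dots> = Re (\<kappa>0 * cnj H0) * (3 - Re (chi p))" by (rule Re_mult_of_real)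
      finally show ?thesis unfolding KLN(1) .
    qed
    moreover have "K0 * (3 - Re (chi p)) \<ge> K0 * (e / 18)" using ch(1) K0 by (intro mult_left_mono) auto
    moreover have "Re (of_real \<epsilon> * V p * cnj H0) \<ge> \<epsilon> * (N\<^sup>2 / 2)"
    proof -
      have "Re (of_real \<epsilon> * V p * cnj H0) = \<epsilon> * Re (V p * cnj H0)" by (simp add: algebra_simps)
      then show ?thesis using V1 \<epsilon> by simp
    qed
    moreover have "Re (?Q * cnj H0) = Re (\<kappa>0 * of_real (3 - Re (chi p)) * cnj H0)
        - Re (\<i> * (x1 + of_real a * x1\<^sup>2) * of_real (Im (chi p)) * cnj H0) + Re (of_real \<epsilon> * V p * cnj H0)"
      unfolding Q by (simp only: ring_distribs minus_complex.sel plus_complex.sel)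
    ultimately have "Re (?Q * cnj H0) \<ge> K0 / 36 * e + \<epsilon> * (N\<^sup>2 / 2)" by linarith
    moreover have "K0 / 36 * e \<ge> c1 * e" using c1 e by (intro mult_right_mono) auto
    moreover have "\<epsilon> * (N\<^sup>2 / 2) \<ge> c1 * \<epsilon>" using c1(3) \<epsilon> by (subst mult.commute, intro mult_right_mono) auto
    ultimately have low: "Re (?Q * cnj H0) \<ge> c1 * (\<epsilon> + e)" unfolding distrib_left by linarith
    have "cmod ?Q \<le> cmod (\<kappa>0 * of_real (3 - Re (chi p)) - \<i> * (x1 + of_real a * x1\<^sup>2) * of_real (Im (chi p))) + cmod (of_real \<epsilon> * V p)"
      unfolding Q by (rule norm_triangle_ineq)
    also have "cmod (\<kappa>0 * of_real (3 - Re (chi p)) - \<i> * (x1 + of_real a * x1\<^sup>2) * of_real (Im (chi p)))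
       \<le> cmod (\<kappa>0 * of_real (3 - Re (chi p))) + cmod (\<i> * (x1 + of_real a * x1\<^sup>2) * of_real (Im (chi p)))"
      by (rule norm_triangle_ineq4)
    also have "cmod (\<kappa>0 * of_real (3 - Re (chi p))) \<le> cmod \<kappa>0 * (2 * e)"
      unfolding norm_mult norm_of_real using ch(1,2) e by (intro mult_left_mono) auto
    also have "cmod (\<i> * (x1 + of_real a * x1\<^sup>2) * of_real (Im (chi p))) \<le> L * e"
    proof -
      have "\<bar>Im (chi p)\<bar> \<le> e * \<nu> / 2" by (rule ch(3))
      also have "\<dots> \<le> e" using e \<nu>(1,2) mult_left_mono[OF \<nu>(2) e] by simp
      finally show ?thesis using L by (simp add: norm_mult KLN mult_left_mono)
    qed
    also have "cmod (of_real \<epsilon> * V p) \<le> \<epsilon> * (2 * N)" using V2 \<epsilon> by (simp add: norm_mult)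
    finally have "cmod ?Q \<le> (2 * cmod \<kappa>0 + L) * e + 2 * N * \<epsilon>" by (simp add: algebra_simps)
    also have "\<dots> \<le> C2 * e + C2 * \<epsilon>"
      using L N e \<epsilon> by (rule_tac add_mono; intro mult_right_mono) (auto simp: C2_def)
    finally have up: "cmod ?Q \<le> C2 * (\<epsilon> + e)" by (simp add: algebra_simps)
    have pos: "\<epsilon> + e > 0" using \<epsilon> e by simp
    then have "Re (?Q * cnj H0) > 0" using low c1(1) by (meson less_le_trans mult_pos_pos)
    then have "cmod ?Q > 0" by auto
    have "c1 / C2\<^sup>2 / (\<epsilon> + e) = c1 * (\<epsilon> + e) / (C2 * (\<epsilon> + e))\<^sup>2"
    proof -
      have "c1 / C2\<^sup>2 / t = c1 * t / (C2 * t)\<^sup>2" if "t > 0" for t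
        using that C2 by (simp add: power2_eq_square)
      from this[OF pos] show ?thesis .
    qed
    also have "\<dots> \<le> Re (?Q * cnj H0) / (cmod ?Q)\<^sup>2"
      using low up \<open>cmod ?Q > 0\<close> pos c1(1) \<open>Re (?Q * cnj H0) > 0\<close> by (intro frac_le power_mono) auto
    finally show ?thesis unfolding Re_divide_cnj e_def by (simp only: add.assoc)
  qed
  define S where "S = {p \<in> torus. \<nu> \<le> \<bar>fst p\<bar> \<or> \<nu> \<le> dist p (0, 0)}"
  have cS: "compact S"
  proof -
    have "closed {p :: real \<times> real. \<nu> \<le> \<bar>fst p\<bar> \<or> \<nu> \<le> dist p (0, 0)}"
      by (intro closed_Collect_disj closed_Collect_le continuous_intros)
    then show ?thesis unfolding S_def using compact_Int_closed[OF compact_torus] by (simp only: Collect_conj_eq Collect_mem_eq)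
  qed
  have ne: "Qt a b x1 1 p \<noteq> 0" if "p \<in> S" for p
    using only_zero_x1[OF assms, of p] that \<nu>(1) by (auto simp: S_def)
  have "\<exists>m>0. \<forall>\<tau> p. 0 < \<tau> \<longrightarrow> \<tau> < 1 \<longrightarrow> p \<in> S \<longrightarrow> cmod (Qt a b x1 \<tau> p) \<ge> m"
    by (rule compact_away[OF cS _ cmod_x1]) (rule ne)
  then obtain m where m: "m > 0" "\<forall>\<tau> p. 0 < \<tau> \<longrightarrow> \<tau> < 1 \<longrightarrow> p \<in> S \<longrightarrow> cmod (Qt a b x1 \<tau> p) \<ge> m"
    by (elim exE conjE) (rule that)
  have nz: "Qt a b x1 (1 - \<epsilon>) p \<noteq> 0" if "0 < \<epsilon>" "\<epsilon> < 1" for \<epsilon> p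
    by (rule Qt_nonzero[OF zf cmod_x1 W_le_1[OF cmod_x1]]) (use that in auto)
  have cont: "continuous_on T (\<lambda>p. H0 / Qt a b x1 (1 - \<epsilon>) p)" if "0 < \<epsilon>" "\<epsilon> < 1" for \<epsilon> T
    using nz[OF that] by (intro continuous_intros) auto
  have "\<exists>\<epsilon>>0. \<epsilon> < 1 \<and> integral torus (\<lambda>p. Re (H0 / Qt a b x1 (1 - \<epsilon>) p)) > \<bar>M\<bar> * N"
  proof (rule torus_log_divergence)
    show "c1 / C2\<^sup>2 > 0" using c1 C2 by simp
    show "\<nu> / 2 > 0" "\<nu> / 2 \<le> pi" "(1 :: real) > 0" using \<nu> pi_gt3 by auto
    show "N / m \<ge> 0" using N m(1) by simp
    fix \<epsilon> :: real assume \<epsilon>: "0 < \<epsilon>" "\<epsilon> < 1"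
    show "continuous_on torus (\<lambda>p. Re (H0 / Qt a b x1 (1 - \<epsilon>) p))" by (intro continuous_intros cont \<epsilon>)
    show "- (N / m) \<le> Re (H0 / Qt a b x1 (1 - \<epsilon>) p)" if p: "p \<in> torus" for p
    proof (cases "p \<in> S")
      case True
      then have "m \<le> cmod (Qt a b x1 (1 - \<epsilon>) p)" using m(2)[rule_format, of "1 - \<epsilon>" p] \<epsilon> by simp
      then have "cmod (H0 / Qt a b x1 (1 - \<epsilon>) p) \<le> N / m"
        unfolding norm_divide KLN(3) using m(1) by (intro frac_le) auto
      then show ?thesis using abs_Re_le_cmod[of "H0 / Qt a b x1 (1 - \<epsilon>) p"] by linarith
    next
      case False
      then have n: "\<bar>fst p\<bar> < \<nu>" "dist p (0, 0) < \<nu>" using p unfolding S_def mem_Collect_eq by linarith+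
      have "\<bar>snd p\<bar> \<le> dist p (0, 0)" using dist_snd_le[of p "(0, 0)"] by (simp add: dist_real_def)
      then have "c1 / C2\<^sup>2 / (\<epsilon> + (fst p)\<^sup>2 + (snd p)\<^sup>2) \<le> Re (H0 / Qt a b x1 (1 - \<epsilon>) p)"
        using n \<nu>(3) by (intro key \<epsilon>) auto
      moreover have "c1 / C2\<^sup>2 / (\<epsilon> + (fst p)\<^sup>2 + (snd p)\<^sup>2) \<ge> 0" using c1 \<epsilon> by simp
      moreover have "N / m \<ge> 0" using N m(1) by simp
      ultimately show ?thesis by linarith
    qed
    show "c1 / C2\<^sup>2 / (\<epsilon> + x\<^sup>2 + z\<^sup>2) \<le> Re (H0 / Qt a b x1 (1 - \<epsilon>) (x, z))"
      if "0 \<le> x" "x \<le> \<nu> / 2" "0 \<le> z" "z \<le> \<nu> / 2" for x z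
    proof -
      have "dist (x, z) (0, 0) \<le> \<bar>x\<bar> + \<bar>z\<bar>"
        unfolding dist_Pair_Pair dist_real_def using sqrt_sum_squares_le_sum_abs[of x z] by simp
      then have "dist (x, z) (0, 0) < d" using that \<nu>(3) by simp
      then have "c1 / C2\<^sup>2 / (\<epsilon> + (fst (x, z))\<^sup>2 + (snd (x, z))\<^sup>2) \<le> Re (H0 / Qt a b x1 (1 - \<epsilon>) (x, z))"
        using that \<nu>(1) by (intro key[OF \<epsilon>(1)]) auto
      then show ?thesis by (simp only: fst_conv snd_conv)
    qed
  qed
  then obtain \<epsilon> where \<epsilon>: "0 < \<epsilon>" "\<epsilon> < 1" "integral torus (\<lambda>p. Re (H0 / Qt a b x1 (1 - \<epsilon>) p)) > \<bar>M\<bar> * N"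
    by (elim exE conjE) (rule that)
  have "integral torus (\<lambda>p. Re (H0 / Qt a b x1 (1 - \<epsilon>) p)) = Re (integral torus (\<lambda>p. H0 / Qt a b x1 (1 - \<epsilon>) p))"
    by (rule integral_Re_torus[OF cont[OF \<epsilon>(1,2)]])
  also have "\<dots> \<le> cmod (integral torus (\<lambda>p. H0 * (1 / Qt a b x1 (1 - \<epsilon>) p)))"
    unfolding times_divide_eq_right mult_1_right by (rule complex_Re_le_cmod)
  also have "\<dots> = N * cmod (integral torus (\<lambda>p. 1 / Qt a b x1 (1 - \<epsilon>) p))"
    unfolding integral_mult_right norm_mult KLN(3) ..
  finally have "\<bar>M\<bar> * N < N * cmod (integral torus (\<lambda>p. 1 / Qt a b x1 (1 - \<epsilon>) p))" using \<epsilon>(3) by linarith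
  then have "M < cmod (integral torus (\<lambda>p. 1 / Qt a b x1 (1 - \<epsilon>) p))" using N by (simp add: mult.commute)
  with \<epsilon>(1,2) show ?thesis by (intro exI[of _ "1 - \<epsilon>"]) simp
qed

end

text \<open>The expansion of |1 + cis A + cis (- B)|^2 \<ge> 0.\<close>

lemma cos_sum_ge:
  fixes A B :: real
  shows "cos A + cos B + cos (A + B) \<ge> - 3 / 2"
proof -
  have sq: "(1 + c + d)\<^sup>2 + (s - t)\<^sup>2 = 1 + (s\<^sup>2 + c\<^sup>2) + (t\<^sup>2 + d\<^sup>2) + 2 * (c + d + (c * d - s * t))"
    for c d s t :: real
    by (simp add: power2_eq_square algebra_simps)
  have "0 \<le> (1 + cos A + cos B)\<^sup>2 + (sin A - sin B)\<^sup>2" by simp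
  then show ?thesis unfolding sq cos_add sin_cos_squared_add by simp
qed

section \<open>Divergence when the two roots of the pair have equal cubes\<close>

context complex_pair
begin

lemma blow_up_special:
  assumes "\<sigma>\<^sup>2 = r\<^sup>2"
  shows "\<exists>\<tau>. 0 < \<tau> \<and> \<tau> < 1 \<and> M < cmod (integral torus (\<lambda>p. 1 / Qt a b (- (of_real \<rho> * cis (2 * pi / 3))) \<tau> p))"
proof -
  define \<zeta> where "\<zeta> = cis (2 * pi / 3)"
  define x2 where "x2 = - (of_real \<rho> * \<zeta>)"
  have cx2: "cmod x2 = \<rho>" using \<rho>_pos by (simp add: x2_def \<zeta>_def norm_mult)
  have \<sigma>r: "\<sigma> = r" using assms not_\<sigma>_minus_r by (simp add: power2_eq_iff)
  define s where "s = r"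
  have \<sigma>s: "\<sigma> = s" and \<gamma>s: "\<gamma> = 3 - s" and \<rho>s: "s * \<rho> = 1"
    using \<sigma>r \<rho>_r(1) by (simp_all only: s_def \<sigma>_def mult.commute)
  have as: "a = s"
  proof -
    have "3 * a = r\<^sup>2 + \<gamma> * \<sigma>" unfolding r2 \<sigma>_def by (simp add: power2_eq_square algebra_simps)
    also have "\<gamma> * \<sigma> = (3 - s) * s" by (rule arg_cong2[OF \<gamma>s \<sigma>s])
    also have "r\<^sup>2 + (3 - s) * s = 3 * s" by (simp add: s_def[symmetric] power2_eq_square algebra_simps)
    finally show ?thesis by simp
  qed
  have \<rho>2: "\<rho> < 2 / 3"
  proof -
    have "3 / 2 < s" using \<gamma>(1) \<gamma>s as by linarith
    then have "3 / 2 * \<rho> < s * \<rho>" using \<rho>_pos by (rule mult_strict_right_mono)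
    then show ?thesis using \<rho>s by linarith
  qed
  have a\<rho>: "a * \<rho>\<^sup>2 = \<rho>"
  proof -
    have "a * \<rho> = s * \<rho>" by (rule arg_cong[OF as])
    then have "a * \<rho> = 1" using \<rho>s by simp
    then show ?thesis by (simp only: power2_eq_square mult.assoc[symmetric] mult_1_left)
  qed
  have b\<rho>: "b * \<rho> ^ 3 = 1 - 3 * \<rho>"
  proof -
    have "g = (3 - s) * \<rho>" unfolding g_def by (rule arg_cong[OF \<gamma>s])
    then have "g = 3 * \<rho> - 1" using \<rho>s by (simp add: left_diff_distrib)
    then show ?thesis using gw(5) by simp
  qed
  \<comment> \<open>The three angles add up to 2 pi, so \<open>cos_sum_ge\<close> makes S
    nonnegative. It vanishes at the origin and carries all of Re Q at \<tau> = 1.\<close>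
  define S where "S = (\<lambda>p. cos (2 * pi / 3 + fst p) + cos (2 * pi / 3 + snd p) + cos (2 * pi / 3 - fst p - snd p) + 3 / 2)"
  have cosC: "cos (2 * pi / 3 - x - y) = cos ((2 * pi / 3 + x) + (2 * pi / 3 + y))" for x y
  proof -
    have "cos (2 * pi / 3 - x - y) = cos (2 * pi - ((2 * pi / 3 + x) + (2 * pi / 3 + y)))"
      by (rule arg_cong[of _ _ cos]) simp
    then show ?thesis by (simp only: cos_2pi_minus)
  qed
  have S0: "S p \<ge> 0" for p
    unfolding S_def cosC using cos_sum_ge[of "2 * pi / 3 + fst p" "2 * pi / 3 + snd p"] by simp
  have S1: "S p = (3 - Re (chi p)) / 2 - sqrt 3 / 2 * Im (chi p)" for p
  proof -
    have c: "cos (2 * pi / 3) = - (1 / 2)" "sin (2 * pi / 3) = sqrt 3 / 2"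
      using cos_120 sin_120 by simp_all
    have e: "2 * pi / 3 - fst p - snd p = 2 * pi / 3 - (fst p + snd p)" by simp
    have "cos (2 * pi / 3 + t) = - (cos t / 2) - sqrt 3 / 2 * sin t"
      "cos (2 * pi / 3 - t) = - (cos t / 2) + sqrt 3 / 2 * sin t" for t
      unfolding cos_add cos_diff c by simp_all
    then show ?thesis unfolding S_def Re_chi Im_chi e by (simp only:) (simp add: field_simps)
  qed
  \<comment> \<open>Positive because 3 - r = \<gamma> < a = r gives r > 3 / 2, that is \<rho> < 2 /
    3.\<close>
  define c0 where "c0 = 1 - 3 * \<rho> / 2"
  have c0: "c0 > 0" "c0 \<le> 1" using \<rho>2 \<rho>_pos by (auto simp: c0_def)
  have Q: "Qt a b x2 \<tau> p = of_real (1 - \<tau> * (1 - 3 * \<rho>)) + of_real \<rho> *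
      (cis (2 * pi / 3 + fst p) + cis (2 * pi / 3 + snd p) + of_real \<tau> * cis (2 * pi / 3 - fst p - snd p)
       + cnj (cis (2 * pi / 3 - fst p - snd p)) + of_real \<tau> * (cnj (cis (2 * pi / 3 + fst p)) + cnj (cis (2 * pi / 3 + snd p))))" for \<tau> p
  proof -
    have z3: "\<zeta> ^ 3 = 1"
      unfolding \<zeta>_def Complex.DeMoivre by simp
    have z2: "\<zeta>\<^sup>2 = cnj \<zeta>"
    proof -
      have "cnj \<zeta> * \<zeta> = 1" by (simp add: \<zeta>_def cis_cnj cis_mult)
      then have "cnj \<zeta> * (\<zeta> * \<zeta>\<^sup>2) = \<zeta>\<^sup>2" by (simp add: mult.assoc[symmetric])
      moreover have "\<zeta> * \<zeta>\<^sup>2 = 1" using z3 by (simp add: power2_eq_square power3_eq_cube mult.assoc)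
      ultimately show ?thesis by simp
    qed
    have 1: "of_real a * x2\<^sup>2 = of_real \<rho> * cnj \<zeta>"
    proof -
      have "of_real a * x2\<^sup>2 = of_real (a * \<rho>\<^sup>2) * \<zeta>\<^sup>2" by (simp add: x2_def power_mult_distrib)
      then show ?thesis unfolding a\<rho> z2 .
    qed
    have 2: "of_real b * of_real \<tau> * x2 ^ 3 = - of_real (\<tau> * (1 - 3 * \<rho>))"
    proof -
      have "of_real b * of_real \<tau> * x2 ^ 3 = - (of_real (\<tau> * (b * \<rho> ^ 3)) * \<zeta> ^ 3)"
        by (simp add: x2_def power_mult_distrib power_minus_odd)
      then show ?thesis unfolding b\<rho> z3 by simp
    qed
    have 3: "cis (2 * pi / 3 + t) = \<zeta> * cis t" for t by (simp add: \<zeta>_def cis_mult)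
    have 4: "cis (2 * pi / 3 - fst p - snd p) = \<zeta> * cis (- fst p - snd p)"
      unfolding \<zeta>_def cis_mult by (rule arg_cong[of _ _ cis]) simp
    show ?thesis unfolding Qt_expand 1 2 3 4 unfolding x2_def by (simp add: algebra_simps)
  qed
  have ReQ: "Re (Qt a b x2 (1 - \<epsilon>) p) = \<epsilon> * c0 + \<rho> * (2 - \<epsilon>) * S p" for \<epsilon> p
    unfolding Q S_def c0_def by (simp add: field_simps)
  have ImQ: "\<bar>Im (Qt a b x2 (1 - \<epsilon>) p)\<bar> \<le> 3 * \<rho> * \<epsilon>" if "\<epsilon> > 0" for \<epsilon> p
  proof -
    let ?I = "sin (2 * pi / 3 + fst p) + sin (2 * pi / 3 + snd p) - sin (2 * pi / 3 - fst p - snd p)"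
    have "Im (Qt a b x2 (1 - \<epsilon>) p) = \<rho> * \<epsilon> * ?I"
      unfolding Q by (simp add: algebra_simps)
    moreover have "\<bar>?I\<bar> \<le> 3"
      using abs_sin_le_one[of "2 * pi / 3 + fst p"] abs_sin_le_one[of "2 * pi / 3 + snd p"]
        abs_sin_le_one[of "2 * pi / 3 - fst p - snd p"] by linarith
    ultimately have "\<bar>Im (Qt a b x2 (1 - \<epsilon>) p)\<bar> \<le> \<rho> * \<epsilon> * 3"
      using that \<rho>_pos by (simp add: abs_mult mult_left_mono)
    then show ?thesis by (simp add: mult_ac)
  qed
  define m where "m = min c0 \<rho>"
  define C where "C = 1 + 3 * \<rho>"
  have m: "m > 0" "m \<le> c0" "m \<le> \<rho>" and C: "C > 0" using c0 \<rho>_pos by (auto simp: m_def C_def)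
  have nz: "Qt a b x2 (1 - \<epsilon>) p \<noteq> 0" if "0 < \<epsilon>" "\<epsilon> < 1" for \<epsilon> p
    by (rule Qt_nonzero[OF zf cx2 W_le_1[OF cx2]]) (use that in auto)
  have cont: "continuous_on T (\<lambda>p. 1 / Qt a b x2 (1 - \<epsilon>) p)" if "0 < \<epsilon>" "\<epsilon> < 1" for \<epsilon> T
    using nz[OF that] by (intro continuous_intros) auto
  have key: "Re (1 / Qt a b x2 (1 - \<epsilon>) p) \<ge> m / C\<^sup>2 / (\<epsilon> + S p)" if \<epsilon>: "0 < \<epsilon>" "\<epsilon> < 1" for \<epsilon> p
  proof -
    let ?q = "Qt a b x2 (1 - \<epsilon>) p"
    have pos: "\<epsilon> + S p > 0" using \<epsilon>(1) S0[of p] by simp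
    have "m * \<epsilon> \<le> \<epsilon> * c0" using m(2) \<epsilon>(1) by (simp add: mult.commute)
    moreover have "m * S p \<le> \<rho> * (2 - \<epsilon>) * S p"
    proof (rule mult_right_mono[OF _ S0])
      have "\<rho> * 1 \<le> \<rho> * (2 - \<epsilon>)" using \<rho>_pos \<epsilon>(2) by (intro mult_left_mono) auto
      then show "m \<le> \<rho> * (2 - \<epsilon>)" using m(3) by simp
    qed
    ultimately have low: "Re ?q \<ge> m * (\<epsilon> + S p)" unfolding ReQ distrib_left by linarith
    have Re_pos: "Re ?q > 0" using low mult_pos_pos[OF m(1) pos] by linarith
    have "cmod ?q \<le> \<bar>Re ?q\<bar> + \<bar>Im ?q\<bar>" by (rule cmod_le)
    also have "\<dots> \<le> (\<epsilon> * c0 + \<rho> * (2 - \<epsilon>) * S p) + 3 * \<rho> * \<epsilon>"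
      using ImQ[OF \<epsilon>(1)] Re_pos unfolding ReQ by (intro add_mono) auto
    also have "\<dots> \<le> C * \<epsilon> + C * S p"
    proof -
      have "\<epsilon> * c0 \<le> \<epsilon> * 1" using c0 \<epsilon> by (intro mult_left_mono) auto
      moreover have "\<rho> * (2 - \<epsilon>) * S p \<le> C * S p"
      proof (rule mult_right_mono[OF _ S0])
        have "\<rho> * (2 - \<epsilon>) \<le> \<rho> * 2" using \<rho>_pos \<epsilon>(1) by (intro mult_left_mono) auto
        also have "\<dots> \<le> C" using \<rho>_pos by (simp add: C_def)
        finally show "\<rho> * (2 - \<epsilon>) \<le> C" .
      qed
      ultimately show ?thesis unfolding C_def distrib_right by linarith
    qed
    finally have up: "cmod ?q \<le> C * (\<epsilon> + S p)" by (simp add: distrib_left)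
    have "m / C\<^sup>2 / t = m * t / (C * t)\<^sup>2" if "t > 0" for t
      using that C by (simp add: power2_eq_square)
    from this[OF pos] have "m / C\<^sup>2 / (\<epsilon> + S p) = m * (\<epsilon> + S p) / (C * (\<epsilon> + S p))\<^sup>2" .
    also have "\<dots> \<le> Re ?q / (cmod ?q)\<^sup>2"
      using low up Re_pos nz[OF \<epsilon>, of p] by (intro frac_le power_mono) auto
    finally show ?thesis unfolding Re_one_divide .
  qed
  have "\<exists>\<epsilon>>0. \<epsilon> < 1 \<and> integral torus (\<lambda>p. Re (1 / Qt a b x2 (1 - \<epsilon>) p)) > M"
  proof (rule torus_log_divergence)
    show "m / C\<^sup>2 / 2 > 0" using m C by simp
    show "(1 :: real) > 0" "(1 :: real) \<le> pi" "(0 :: real) \<le> 0" using pi_gt3 by auto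
    fix \<epsilon> :: real assume \<epsilon>: "0 < \<epsilon>" "\<epsilon> < 1"
    show "continuous_on torus (\<lambda>p. Re (1 / Qt a b x2 (1 - \<epsilon>) p))" by (intro continuous_intros cont \<epsilon>)
    show "- 0 \<le> Re (1 / Qt a b x2 (1 - \<epsilon>) p)" for p
    proof -
      have "m / C\<^sup>2 / (\<epsilon> + S p) \<ge> 0" using m(1) \<epsilon>(1) S0[of p] by simp
      with key[OF \<epsilon>, of p] show ?thesis by linarith
    qed
    show "m / C\<^sup>2 / 2 / (\<epsilon> + x\<^sup>2 + y\<^sup>2) \<le> Re (1 / Qt a b x2 (1 - \<epsilon>) (x, y))"
      if "0 \<le> x" "x \<le> 1" "0 \<le> y" "y \<le> 1" for x y
    proof -
      define e where "e = x\<^sup>2 + y\<^sup>2"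
      have e: "e \<ge> 0" by (simp add: e_def)
      have t: "(x, y) \<in> torus" using that pi_gt3 by (simp add: torus_iff)
      have "\<bar>Im (chi (x, y))\<bar> \<le> e / 2" using chi_near(3)[OF t, of 1] that by (simp add: e_def)
      moreover have "\<bar>sqrt 3 / 2 * Im (chi (x, y))\<bar> \<le> 1 * \<bar>Im (chi (x, y))\<bar>"
        unfolding abs_mult by (intro mult_right_mono) (auto simp: real_sqrt_le_iff intro: real_le_lsqrt)
      moreover have "3 - Re (chi (x, y)) \<le> 2 * e" using chi_near(2)[OF t] by (simp add: e_def)
      moreover have "(3 - R) / 2 - T \<le> 2 * e" if "\<bar>I\<bar> \<le> e / 2" "\<bar>T\<bar> \<le> 1 * \<bar>I\<bar>" "3 - R \<le> 2 * e" for R T I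
        using that e by (auto simp: abs_if field_simps split: if_splits)
      ultimately have "S (x, y) \<le> 2 * e" unfolding S1 by blast
      then have "\<epsilon> + S (x, y) \<le> 2 * (\<epsilon> + e)" using \<epsilon>(1) by simp
      then have "m / C\<^sup>2 / (2 * (\<epsilon> + e)) \<le> m / C\<^sup>2 / (\<epsilon> + S (x, y))"
        using m(1) \<epsilon>(1) e S0[of "(x, y)"] by (intro divide_left_mono mult_pos_pos) (auto simp: add_pos_nonneg)
      also have "m / C\<^sup>2 / (2 * (\<epsilon> + e)) = m / C\<^sup>2 / 2 / (\<epsilon> + x\<^sup>2 + y\<^sup>2)"
        by (simp add: e_def add.assoc)
      finally show ?thesis using key[OF \<epsilon>, of "(x, y)"] by linarith
    qed
  qed simp
  then obtain \<epsilon> where \<epsilon>: "0 < \<epsilon>" "\<epsilon> < 1" "integral torus (\<lambda>p. Re (1 / Qt a b x2 (1 - \<epsilon>) p)) > M"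
    by (elim exE conjE) (rule that)
  note \<epsilon>(3)
  also have "integral torus (\<lambda>p. Re (1 / Qt a b x2 (1 - \<epsilon>) p)) = Re (integral torus (\<lambda>p. 1 / Qt a b x2 (1 - \<epsilon>) p))"
    by (rule integral_Re_torus[OF cont[OF \<epsilon>(1,2)]])
  also have "\<dots> \<le> cmod (integral torus (\<lambda>p. 1 / Qt a b x2 (1 - \<epsilon>) p))" by (rule complex_Re_le_cmod)
  finally show ?thesis using \<epsilon>(1,2) unfolding x2_def \<zeta>_def by (intro exI[of _ "1 - \<epsilon>"]) simp
qed

lemma oscillates:
  "infinite {n. \<delta> a (- (\<gamma> ^ 3) + 3 * \<gamma>\<^sup>2 - 3 * a * \<gamma>) n > 0} \<and>
   infinite {n. \<delta> a (- (\<gamma> ^ 3) + 3 * \<gamma>\<^sup>2 - 3 * a * \<gamma>) n < 0}"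
proof (cases "\<sigma>\<^sup>2 = r\<^sup>2")
  case True
  have "cmod (- (of_real \<rho> * cis (2 * pi / 3))) = \<rho>" using \<rho>_pos by (simp add: norm_mult)
  from pair_oscillation[OF this blow_up_special[OF True]] show ?thesis unfolding b_def .
next
  case False
  from pair_oscillation[OF cmod_x1 blow_up_generic[OF False]] show ?thesis unfolding b_def .
qed

end

section \<open>Location of the critical points\<close>

(* 1/alpha is a zero of Q(x, x, x) if and only if diag_poly a alpha = b *)
definition diag_poly :: "real \<Rightarrow> real \<Rightarrow> real" where
  "diag_poly a x = - (x ^ 3) + 3 * x\<^sup>2 - 3 * a * x"

lemma continuous_on_diag_poly: "continuous_on S (diag_poly a)"
  unfolding diag_poly_def by (intro continuous_intros)

lemma diag_poly_root_above:
  assumes "b < diag_poly a x0"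
  obtains x where "x > x0" "diag_poly a x = b"
proof -
  have "filterlim (diag_poly a) at_bot at_top" unfolding diag_poly_def by real_asymp
  then have "\<forall>\<^sub>F x in at_top. diag_poly a x < b" by (auto simp: filterlim_at_bot_dense)
  then obtain M where "M > x0" "diag_poly a M < b"
    using eventually_conj[OF eventually_gt_at_top[of x0]] eventually_happens'[OF trivial_limit_at_top_linorder] by blast
  then obtain x where "x0 \<le> x" "diag_poly a x = b"
    using IVT2'[of "diag_poly a" M b x0] assms continuous_on_diag_poly by force
  moreover have "x \<noteq> x0" using calculation assms by auto
  ultimately show ?thesis using that[of x] by simp
qed

lemma diag_poly_root_below:
  assumes "diag_poly a x0 < b"
  obtains x where "x < x0" "diag_poly a x = b"
proof -
  have "filterlim (diag_poly a) at_top at_bot" unfolding diag_poly_def by real_asymp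
  then have "\<forall>\<^sub>F x in at_bot. b < diag_poly a x" by (auto simp: filterlim_at_top_dense)
  then obtain M where "M < x0" "b < diag_poly a M"
    using eventually_conj[OF eventually_gt_at_bot[of x0]] eventually_happens'[OF trivial_limit_at_bot_linorder] by blast
  then obtain x where "x \<le> x0" "diag_poly a x = b"
    using IVT2'[of "diag_poly a" x0 b M] assms continuous_on_diag_poly by force
  moreover have "x \<noteq> x0" using calculation assms by auto
  ultimately show ?thesis using that[of x] by simp
qed

lemma zero_free_real:
  assumes "\<beta> > 1" "\<beta>\<^sup>2 - 2 * \<beta> + a > 0" "a < \<beta>"
  shows "zero_free a (1 / \<beta>)"
  unfolding zero_free_def
proof (intro conjI ballI)
  fix t assume t: "t \<in> {0..1 / \<beta>}"
  then have t\<beta>: "t * \<beta> \<le> 1" "0 \<le> t" using assms(1) by (auto simp: field_simps)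
  have t1: "t < 1" using t assms(1) by (auto intro: le_less_trans)
  show "a * t\<^sup>2 < 1"
  proof (cases "t = 0")
    case False
    then have "t\<^sup>2 * a < t\<^sup>2 * \<beta>" using assms(3) by simp
    also have "\<dots> = t * (t * \<beta>)" by (simp add: power2_eq_square)
    also have "\<dots> \<le> t * 1" using t\<beta> by (intro mult_left_mono)
    finally show ?thesis using t1 by (simp add: mult.commute)
  qed simp
  show "1 - 2 * t + a * t\<^sup>2 > 0"
  proof (cases "t = 0")
    case False
    then have "t > 0" using t by simp
    \<comment> \<open>Used in 1 - 2 t + a t^2 = (1 - t)^2 - (t (\<beta> - 1))^2 + t^2 (\<beta>^2 - 2
      \<beta> + a).\<close>
    have "(t * (\<beta> - 1))\<^sup>2 \<le> (1 - t)\<^sup>2"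
    proof (rule power_mono)
      show "t * (\<beta> - 1) \<le> 1 - t" using t\<beta>(1) by (simp add: algebra_simps)
      show "0 \<le> t * (\<beta> - 1)" using t\<beta>(2) assms(1) by (intro mult_nonneg_nonneg) auto
    qed
    moreover have "t\<^sup>2 * (\<beta>\<^sup>2 - 2 * \<beta> + a) > 0" using assms(2) \<open>t > 0\<close> by simp
    ultimately show ?thesis by (simp add: power2_eq_square algebra_simps)
  qed simp
qed (use assms in simp)

lemma powr_three_halves:
  assumes "c \<ge> (0 :: real)"
  shows "c powr (3 / 2) = sqrt c ^ 3"
proof -
  have "c powr (3 / 2) = c powr (1 / 2 * 3)" by simp
  also have "\<dots> = (c powr (1 / 2)) powr 3" by (rule powr_powr[symmetric])
  also have "\<dots> = sqrt c ^ 3" using assms by (simp add: powr_half_sqrt)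
  finally show ?thesis .
qed

text \<open>Rational parametrisation of the double-root curve: at b = \<open>B a\<close> the roots
  are 1 + s, twice, and 1 - 2 s.\<close>

lemma sqrt_bounds:
  assumes "- 3 \<le> a" "a \<le> 1"
  obtains s where "0 \<le> s" "s \<le> 2" "a = 1 - s\<^sup>2" "B a = 2 * s ^ 3 + 3 * s\<^sup>2 - 1"
proof
  let ?s = "sqrt (1 - a)"
  show "0 \<le> ?s" "a = 1 - ?s\<^sup>2" using assms by simp_all
  show "?s \<le> 2" using assms by (intro real_le_lsqrt) auto
  show "B a = 2 * ?s ^ 3 + 3 * ?s\<^sup>2 - 1"
    using B_cases(2)[OF assms] powr_three_halves[of "1 - a"] assms by simp
qed

text \<open>At a, 1 + s and sqrt (-3 a) respectively, \<open>diag_poly\<close> takes the value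
  \<open>B a\<close>, and one of the three dominance inequalities is an equality. Any root beyond
  that point satisfies all three.\<close>

lemma positive_root:
  assumes "b < B a"
  obtains \<alpha> where "diag_poly a \<alpha> = b" "\<alpha> > 1" "\<alpha>\<^sup>2 - 2 * \<alpha> + a > 0" "a < \<alpha>" "\<alpha>\<^sup>2 + 3 * a > 0"
proof -
  consider "a \<ge> 1" | "- 3 \<le> a" "a \<le> 1" | "a \<le> - 3" by linarith
  then show ?thesis
  proof cases
    case 1
    then have "b < diag_poly a a" using assms B_cases(3)[OF 1] by (simp add: diag_poly_def power2_eq_square power3_eq_cube)
    then obtain \<alpha> where \<alpha>: "\<alpha> > a" "diag_poly a \<alpha> = b" by (rule diag_poly_root_above)
    have "(\<alpha> - 1)\<^sup>2 > 0" using \<alpha>(1) 1 by simp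
    then have "\<alpha>\<^sup>2 - 2 * \<alpha> + a > 0" using 1 by (simp add: power2_eq_square algebra_simps)
    moreover have "\<alpha>\<^sup>2 + 3 * a > 0" using 1 by (intro add_nonneg_pos) auto
    ultimately show ?thesis using that[of \<alpha>] \<alpha> 1 by simp
  next
    case 2
    then obtain s where s: "0 \<le> s" "s \<le> 2" "a = 1 - s\<^sup>2" "B a = 2 * s ^ 3 + 3 * s\<^sup>2 - 1" by (rule sqrt_bounds)
    have "diag_poly a (1 + s) = 2 * s ^ 3 + 3 * s\<^sup>2 - 1"
      unfolding diag_poly_def s(3) by (simp add: power2_eq_square power3_eq_cube algebra_simps)
    then have "b < diag_poly a (1 + s)" using assms s(4) by simp
    then obtain \<alpha> where \<alpha>: "\<alpha> > 1 + s" "diag_poly a \<alpha> = b" by (rule diag_poly_root_above)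
    have "s\<^sup>2 < (\<alpha> - 1)\<^sup>2" using \<alpha>(1) s(1) by (intro power_strict_mono) auto
    then have "\<alpha>\<^sup>2 - 2 * \<alpha> + a > 0" unfolding s(3) by (simp add: power2_eq_square algebra_simps)
    moreover have "(1 + s)\<^sup>2 < \<alpha>\<^sup>2" using \<alpha>(1) s(1) by (intro power_strict_mono) auto
    \<comment> \<open>(1 + s)^2 + 3 a = 2 (2 - s)(1 + s), so the condition s \<le> 2, that is a
      \<ge> -3, is what this regime needs.\<close>
    moreover have "0 \<le> (2 - s) * (1 + s)" using s by simp
    then have "(1 + s)\<^sup>2 + 3 * a \<ge> 0" unfolding s(3) by (simp add: power2_eq_square algebra_simps)
    ultimately show ?thesis using that[of \<alpha>] \<alpha> s(1,3) zero_le_power2[of s] by linarith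
  next
    case 3
    define q where "q = sqrt (- 3 * a)"
    have q: "q\<^sup>2 = - 3 * a" using 3 by (simp add: q_def)
    have q3: "q \<ge> 3" unfolding q_def using 3 by (intro real_le_rsqrt) auto
    have "q ^ 3 = q * q\<^sup>2" by (simp add: power2_eq_square power3_eq_cube)
    then have "diag_poly a q = - 9 * a" unfolding diag_poly_def q by simp
    then have "b < diag_poly a q" using assms B_cases(1)[OF 3] by simp
    then obtain \<alpha> where \<alpha>: "\<alpha> > q" "diag_poly a \<alpha> = b" by (rule diag_poly_root_above)
    have "q\<^sup>2 < \<alpha>\<^sup>2" using \<alpha>(1) q3 by (intro power_strict_mono) auto
    then have a3: "\<alpha>\<^sup>2 + 3 * a > 0" using q by simp
    have "3 * \<alpha> \<le> \<alpha> * \<alpha>" using \<alpha>(1) q3 by (intro mult_right_mono) auto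
    then have "\<alpha>\<^sup>2 - 2 * \<alpha> + a > 0" using a3 by (simp add: power2_eq_square)
    with a3 show ?thesis using that[of \<alpha>] \<alpha> q3 3 by linarith
  qed
qed

text \<open>Between a and -sqrt (-3 a) a negative root dominates: at the right end it ties with its
  own negative (b = -9 a), at the left end with the conjugate pair (b = -a^3).\<close>

lemma negative_root:
  assumes "a < - 3" "- 9 * a < b" "b < - (a ^ 3)"
  obtains \<alpha> where "diag_poly a \<alpha> = b" "\<alpha> < - 3" "a < \<alpha>" "\<alpha>\<^sup>2 + 3 * a > 0"
proof -
  define q where "q = sqrt (- 3 * a)"
  have q: "q\<^sup>2 = - 3 * a" using assms by (simp add: q_def)
  have q3: "q \<ge> 3" unfolding q_def using assms by (intro real_le_rsqrt) auto
  have "q ^ 3 = q * q\<^sup>2" by (simp add: power2_eq_square power3_eq_cube)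
  then have "diag_poly a (- q) = - 9 * a" unfolding diag_poly_def by (simp add: q)
  moreover have "diag_poly a a = - (a ^ 3)" by (simp add: diag_poly_def power2_eq_square power3_eq_cube)
  moreover have "a \<le> - q"
  proof -
    have "3 * - a \<le> - a * - a" using assms(1) by (intro mult_right_mono) auto
    then have "q\<^sup>2 \<le> (- a)\<^sup>2" unfolding q by (simp add: power2_eq_square)
    then show ?thesis using power2_le_imp_le[of q "- a"] assms(1) by simp
  qed
  ultimately obtain \<alpha> where \<alpha>: "a \<le> \<alpha>" "\<alpha> \<le> - q" "diag_poly a \<alpha> = b"
    using IVT2'[of "diag_poly a" "- q" b a] assms continuous_on_diag_poly by force
  have "\<alpha> \<noteq> a" "\<alpha> \<noteq> - q"
    using \<alpha>(3) \<open>diag_poly a (- q) = _\<close> \<open>diag_poly a a = _\<close> assms by auto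
  then have "a < \<alpha>" "\<alpha> < - q" using \<alpha> by auto
  moreover have "q\<^sup>2 < (- \<alpha>)\<^sup>2" using \<open>\<alpha> < - q\<close> q3 by (intro power_strict_mono) auto
  ultimately show ?thesis using that[of \<alpha>] \<alpha>(3) q q3 by simp
qed

text \<open>The real root is sought below the point where the pair ceases to dominate or to be
  nonreal: a itself, or the simple root 1 - 2 s accompanying the double root.\<close>

lemma complex_pair_root:
  assumes "b > B a" "a \<ge> - 3 \<or> b > - (a ^ 3)"
  obtains \<gamma> where "complex_pair a \<gamma>" "diag_poly a \<gamma> = b"
proof -
  have fa: "diag_poly a a = - (a ^ 3)" by (simp add: diag_poly_def power2_eq_square power3_eq_cube)
  consider "a \<ge> 1" | "- 3 \<le> a" "a \<le> 1" | "a < - 3" by linarith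
  then show ?thesis
  proof cases
    case 1
    then have "diag_poly a a < b" using assms B_cases(3)[OF 1] fa by simp
    then obtain \<gamma> where \<gamma>: "\<gamma> < a" "diag_poly a \<gamma> = b" by (rule diag_poly_root_below)
    have "4 * (1 - a) < (\<gamma> - 1)\<^sup>2"
    proof (cases "a = 1")
      case True
      then show ?thesis using \<gamma>(1) by simp
    next
      case False
      with 1 have "4 * (1 - a) < 0" by simp
      then show ?thesis using zero_le_power2[of "\<gamma> - 1"] by linarith
    qed
    with \<gamma> show ?thesis using that[of \<gamma>] by (simp add: complex_pair_def)
  next
    case 2
    then obtain s where s: "0 \<le> s" "s \<le> 2" "a = 1 - s\<^sup>2" "B a = 2 * s ^ 3 + 3 * s\<^sup>2 - 1" by (rule sqrt_bounds)
    have "diag_poly a (1 - 2 * s) = 2 * s ^ 3 + 3 * s\<^sup>2 - 1"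
      unfolding diag_poly_def s(3) by (simp add: power2_eq_square power3_eq_cube algebra_simps)
    then have "diag_poly a (1 - 2 * s) < b" using assms s(4) by simp
    then obtain \<gamma> where \<gamma>: "\<gamma> < 1 - 2 * s" "diag_poly a \<gamma> = b" by (rule diag_poly_root_below)
    \<comment> \<open>Since s \<le> 2, 1 - 2 s \<le> 1 - s^2 = a, so lying below 1 - 2 s also puts
      \<gamma> below a.\<close>
    have "s * s \<le> 2 * s" using s by (intro mult_right_mono)
    then have "\<gamma> < a" using \<gamma>(1) s(3) by (simp add: power2_eq_square)
    moreover have "(2 * s)\<^sup>2 < (1 - \<gamma>)\<^sup>2" using \<gamma>(1) s(1) by (intro power_strict_mono) auto
    then have "4 * (1 - a) < (\<gamma> - 1)\<^sup>2" unfolding s(3) by (simp add: power2_eq_square algebra_simps)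
    ultimately show ?thesis using that[of \<gamma>] \<gamma>(2) by (simp add: complex_pair_def)
  next
    case 3
    then have "diag_poly a a < b" using assms fa by simp
    then obtain \<gamma> where \<gamma>: "\<gamma> < a" "diag_poly a \<gamma> = b" by (rule diag_poly_root_below)
    have "4 * (1 - a) < (1 - a) * (1 - a)" using 3 by (intro mult_strict_right_mono) auto
    also have "\<dots> \<le> (1 - \<gamma>) * (1 - \<gamma>)" using 3 \<gamma>(1) by (intro mult_mono) auto
    finally have "4 * (1 - a) < (\<gamma> - 1)\<^sup>2" by (simp add: power2_eq_square algebra_simps)
    with \<gamma> show ?thesis using that[of \<gamma>] by (simp add: complex_pair_def)
  qed
qed

lemma alternating_signs:
  fixes f :: "nat \<Rightarrow> real"
  assumes "\<forall>\<^sub>F n in sequentially. f n * x ^ (3 * n) > 0" "x < 0"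
  shows "infinite {n. f n > 0} \<and> infinite {n. f n < 0}"
proof -
  obtain N where N: "\<And>n. n \<ge> N \<Longrightarrow> f n * x ^ (3 * n) > 0"
    using assms(1) by (auto simp: eventually_sequentially)
  have "\<exists>n>m. n \<in> {n. f n > 0}" for m
  proof -
    let ?n = "2 * (N + m + 1)"
    have "x ^ (3 * ?n) > 0" using assms(2) by (simp add: power_mult power_even_eq zero_less_power_eq)
    then have "f ?n > 0" using N[of ?n] by (simp add: zero_less_mult_iff)
    then show ?thesis by (intro exI[of _ ?n]) simp
  qed
  moreover have "\<exists>n>m. n \<in> {n. f n < 0}" for m
  proof -
    let ?n = "2 * (N + m + 1) + 1"
    have "x ^ (3 * ?n) < 0" using assms(2) by (simp only: power_less_zero_eq) simp
    have neg: "y < 0" if "y * z > 0" "z < 0" for y z :: real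
      using that by (auto simp: zero_less_mult_iff)
    have "f ?n < 0" by (rule neg[OF N \<open>x ^ (3 * ?n) < 0\<close>]) simp
    then show ?thesis by (intro exI[of _ ?n]) simp
  qed
  ultimately show ?thesis by (simp add: infinite_nat_iff_unbounded)
qed

theorem theorem7:
  fixes a b :: real
  shows "(b < B a \<longrightarrow> (\<forall>\<^sub>F n in sequentially. \<delta> a b n > 0)) \<and>
         (b > B a \<longrightarrow> infinite {n. \<delta> a b n > 0} \<and> infinite {n. \<delta> a b n < 0})"
proof (intro conjI impI)
  assume "b < B a"
  then obtain \<alpha> where al: "diag_poly a \<alpha> = b" "\<alpha> > 1" "\<alpha>\<^sup>2 - 2 * \<alpha> + a > 0" "a < \<alpha>" "\<alpha>\<^sup>2 + 3 * a > 0"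
    by (rule positive_root)
  then interpret real_saddle a b \<alpha>
    using zero_free_real[OF al(2,3,4)] by unfold_locales (auto simp: diag_poly_def)
  from eventually_positive show "\<forall>\<^sub>F n in sequentially. \<delta> a b n > 0"
    by eventually_elim (use al(2) in \<open>simp add: zero_less_divide_iff zero_less_mult_iff\<close>)
next
  assume b: "b > B a"
  have "infinite {n. \<delta> a b n > 0} \<and> infinite {n. \<delta> a b n < 0}"
  \<comment> \<open>In the negative case a < -3 and b \<le> -a^3: equality is the tie of three
    moduli, strict inequality leaves a dominant negative root.\<close>
  proof (cases "a \<ge> - 3 \<or> b > - (a ^ 3)")
    case True
    with b obtain \<gamma> where \<gamma>: "complex_pair a \<gamma>" "diag_poly a \<gamma> = b" by (rule complex_pair_root)
    from complex_pair.oscillates[OF \<gamma>(1)] show ?thesis using \<gamma>(2) unfolding diag_poly_def by simp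
  next
    case F: False
    show ?thesis
    proof (cases "b = - (a ^ 3)")
      case True
      then show ?thesis using oscillation_tie[of a] F by simp
    next
      case False
      have ab: "a < - 3" "- 9 * a < b" "b < - (a ^ 3)" using F False b B_cases(1)[of a] by auto
      then obtain \<alpha> where al: "diag_poly a \<alpha> = b" "\<alpha> < - 3" "a < \<alpha>" "\<alpha>\<^sup>2 + 3 * a > 0"
        by (rule negative_root)
      have "3 * - \<alpha> \<le> - \<alpha> * - \<alpha>" using al(2) by (intro mult_right_mono) auto
      then have c: "(- \<alpha>)\<^sup>2 - 2 * (- \<alpha>) + a > 0" "\<alpha>\<^sup>2 - 2 * \<alpha> + a > 0"
        using al(2,4) by (simp_all add: power2_eq_square)
      have "zero_free a (1 / - \<alpha>)" using al(2) ab(1) by (intro zero_free_real c) auto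
      then interpret real_saddle a b \<alpha>
        using al c(2) by unfold_locales (auto simp: diag_poly_def)
      show ?thesis by (rule alternating_signs[OF eventually_positive]) (use al(2) in simp)
    qed
  qed
  then show "infinite {n. \<delta> a b n > 0}" "infinite {n. \<delta> a b n < 0}" by simp_all
qed

end
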